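(* Let $d\ge 1$ and let $(\sigma^t)_{t\ge 0}$ be the zero-temperature stochastic homogeneous Ising ferromagnet on $\mathbf{Z}^d$ started from the symmetric Bernoulli product measure. Let $C_o(t)$ be the cluster at the origin at time $t$. Then, almost surely, the size of the cluster at the origin diverges as $t\to\infty$: $$\lim_{t\to\infty}|C_o(t)|=\infty .$$
   Context: Model. The state space is $\mathcal{S}=\{-1,+1\}^{\mathbf{Z}^d}$. The initial state $\sigma^0$ has law $\mu^0$, the product measure under which the spins $\sigma^0_x$ are i.i.d. and equal to $+1$ or $-1$ with probability $1/2$ each. The continuous-time dynamics are: to each site $x\in\mathbf{Z}^d$ is attached an independent rate-$1$ Poisson process of "clock rings", with an independent fair coin toss attached to each ring. When the clock at $x$ rings, let $k$ be the number of the $2d$ nearest neighbors $y$ of $x$ (Euclidean distance $\|x-y\|=1$) with $\sigma_y\ne\sigma_x$: if $k>d$ the spin at $x$ flips ($\sigma_x\to-\sigma_x$); if $k=d$ it flips with probability $1/2$, according to the coin toss; if $k<d$ it does not flip. $P=\mu^0\times P_{dyn}$ is the joint law of the initial configuration and the clock rings and coin tosses, and "almost surely" is with respect to $P$. The cluster $C_x(t)$ at site $x$ at time $t$ is the maximal subset of $\mathbf{Z}^d$ that contains $x$, is connected (through nearest-neighbor paths within the subset), and on which $\sigma^t$ is constant. $|C_x(t)|$ is its number of sites (possibly $\infty$), and $o$ is the origin. *)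

theory Defs
  imports "HOL-Probability.Probability"
begin

text \<open>
  The lattice \<open>\<int>\<^sup>d\<close> is \<open>int ^ 'n\<close> with \<open>d = CARD('n)\<close>; the origin is \<open>0\<close>.
\<close>

type_synonym 'n site = "int ^ 'n"

type_synonym 'n config = "'n site \<Rightarrow> int"

text \<open>
  The clock of one site is recorded as the sequence of pairs (waiting time between the previous ring
  and this one, coin toss attached to this ring).
\<close>

type_synonym clock = "nat \<Rightarrow> real \<times> bool"


definition nearest_neighbors :: "('n::finite) site \<Rightarrow> 'n site \<Rightarrow> bool" where
  "nearest_neighbors x y \<longleftrightarrow>
     dist (\<chi> i. real_of_int (x $ i)) ((\<chi> i. real_of_int (y $ i)) :: real ^ 'n) = 1"


section \<open>The probability space\<close>

definition initial_law :: "('n::finite) config measure" where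
  "initial_law = (\<Pi>\<^sub>M x\<in>UNIV. uniform_count_measure {-1, 1})"

text \<open>
  A rate-1 Poisson process is given by its i.i.d. exponential(1) waiting times.
\<close>

definition clock_law :: "clock measure" where
  "clock_law = (\<Pi>\<^sub>M n\<in>UNIV. density lborel (exponential_density 1) \<Otimes>\<^sub>M
                             measure_pmf (bernoulli_pmf (1 / 2)))"

definition dyn_law :: "('n::finite site \<Rightarrow> clock) measure" where
  "dyn_law = (\<Pi>\<^sub>M x\<in>UNIV. clock_law)"

definition ising_law :: "('n::finite config \<times> ('n site \<Rightarrow> clock)) measure" where
  "ising_law = initial_law \<Otimes>\<^sub>M dyn_law"

definition ring_time :: "clock \<Rightarrow> nat \<Rightarrow> real" where
  "ring_time c n = (\<Sum>k\<le>n. fst (c k))"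

definition ring_coin :: "clock \<Rightarrow> nat \<Rightarrow> bool" where
  "ring_coin c n = snd (c n)"


section \<open>The dynamics\<close>

definition disagreements :: "('n::finite) config \<Rightarrow> 'n site \<Rightarrow> nat" where
  "disagreements s x = card {y. nearest_neighbors x y \<and> s y \<noteq> s x}"

definition updated_spin :: "('n::finite) config \<Rightarrow> 'n site \<Rightarrow> bool \<Rightarrow> int" where
  "updated_spin s x coin =
     (if disagreements s x > CARD('n) \<or> disagreements s x = CARD('n) \<and> coin
      then - s x else s x)"

text \<open>
  \<open>ising_path s0 w \<sigma>\<close>: the trajectory \<open>\<sigma>\<close>, given at times \<open>t \<ge> 0\<close>, starts from \<open>s0\<close> and follows the
  dynamics driven by the clocks \<open>w\<close>. The configuration seen by a ring at time \<open>t\<close> is the one just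
  before \<open>t\<close>; around \<open>x\<close> it is constant on a left neighbourhood of \<open>t\<close>, since almost surely
  ring times are positive, distinct and locally finite at each site. Hence the filter \<open>at_left t\<close>.
\<close>

definition ising_path ::
  "('n::finite) config \<Rightarrow> ('n site \<Rightarrow> clock) \<Rightarrow> (real \<Rightarrow> 'n config) \<Rightarrow> bool" where
  "ising_path s0 w \<sigma> \<longleftrightarrow>
     \<sigma> 0 = s0 \<and>
     (\<forall>x s t. 0 \<le> s \<and> s \<le> t \<and> (\<forall>n. ring_time (w x) n \<notin> {s<..t}) \<longrightarrow> \<sigma> t x = \<sigma> s x) \<and>
     (\<forall>x n. \<forall>\<^sub>F s in at_left (ring_time (w x) n).
        \<sigma> (ring_time (w x) n) x = updated_spin (\<sigma> s) x (ring_coin (w x) n))"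


section \<open>Clusters\<close>

definition nn_connected :: "('n::finite) site set \<Rightarrow> bool" where
  "nn_connected A \<longleftrightarrow>
     (\<forall>a\<in>A. \<forall>b\<in>A. (a, b) \<in> {(u, v). u \<in> A \<and> v \<in> A \<and> nearest_neighbors u v}\<^sup>*)"

text \<open>
  The maximal set with the three properties is the union of all of them; see \<open>cluster_greatest\<close>.
\<close>

definition cluster :: "('n::finite) config \<Rightarrow> 'n site \<Rightarrow> 'n site set" where
  "cluster s x = \<Union>{A. x \<in> A \<and> nn_connected A \<and> (\<forall>y\<in>A. s y = s x)}"

definition set_size :: "'a set \<Rightarrow> enat" where
  "set_size A = (if finite A then enat (card A) else \<infinity>)"


section \<open>Sanity checks\<close>

lemma prob_space_ising_law: "prob_space (ising_law :: ('n::finite config \<times> _) measure)"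
proof -
  have e: "prob_space (density lborel (exponential_density 1))"
    by (rule prob_space_exponential_density) simp
  have "prob_space clock_law"
    unfolding clock_law_def
    by (rule prob_space_PiM, rule prob_space_pair, rule e, rule prob_space_measure_pmf)
  then have "prob_space (dyn_law :: ('n site \<Rightarrow> clock) measure)"
    unfolding dyn_law_def by (rule prob_space_PiM)
  moreover have "prob_space (initial_law :: 'n config measure)"
    unfolding initial_law_def
    by (rule prob_space_PiM, rule prob_space_uniform_count_measure) simp_all
  ultimately show ?thesis
    unfolding ising_law_def by (intro prob_space_pair)
qed

lemma space_initial_law:
  "space (initial_law :: ('n::finite) config measure) = {s. \<forall>x. s x \<in> {-1, 1}}"
  by (auto simp: initial_law_def space_PiM space_uniform_count_measure PiE_def)

lemma cluster_greatest:
  fixes s :: "('n::finite) config"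
  shows "x \<in> cluster s x"
    and "nn_connected (cluster s x)"
    and "\<forall>y\<in>cluster s x. s y = s x"
    and "x \<in> A \<Longrightarrow> nn_connected A \<Longrightarrow> \<forall>y\<in>A. s y = s x \<Longrightarrow> A \<subseteq> cluster s x"
proof -
  have "nn_connected {x}" by (simp add: nn_connected_def)
  then show "x \<in> cluster s x"
    unfolding cluster_def by (intro UnionI[of "{x}"]) auto
  show "\<forall>y\<in>cluster s x. s y = s x"
    unfolding cluster_def by blast
  show "x \<in> A \<Longrightarrow> nn_connected A \<Longrightarrow> \<forall>y\<in>A. s y = s x \<Longrightarrow> A \<subseteq> cluster s x"
    unfolding cluster_def by blast
  let ?R = "\<lambda>A. {(u, v). u \<in> A \<and> v \<in> A \<and> nearest_neighbors u v}"
  have path: "(a, x) \<in> (?R (cluster s x))\<^sup>* \<and> (x, a) \<in> (?R (cluster s x))\<^sup>*"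
    if a: "a \<in> cluster s x" for a
  proof -
    from a obtain A where A: "a \<in> A" "x \<in> A" "nn_connected A" "\<forall>y\<in>A. s y = s x"
      unfolding cluster_def by (elim UnionE CollectE conjE)
    then have "A \<subseteq> cluster s x"
      unfolding cluster_def by (intro Union_upper CollectI conjI)
    then have "?R A \<subseteq> ?R (cluster s x)"
      by (simp add: subset_iff)
    then have "(?R A)\<^sup>* \<subseteq> (?R (cluster s x))\<^sup>*" by (rule rtrancl_mono)
    moreover have "(a, x) \<in> (?R A)\<^sup>*" "(x, a) \<in> (?R A)\<^sup>*"
      using A(3)[unfolded nn_connected_def] A(1,2) by (simp_all only: Ball_def)
    ultimately show ?thesis by (simp only: subset_iff)
  qed
  show "nn_connected (cluster s x)"
    unfolding nn_connected_def
  proof (intro ballI)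
    fix a b assume "a \<in> cluster s x" "b \<in> cluster s x"
    then show "(a, b) \<in> (?R (cluster s x))\<^sup>*"
      by (rule rtrancl_trans[OF conjunct1[OF path] conjunct2[OF path]])
  qed
qed

end

theory Submission
  imports Defs
begin

text \<open>
  The expected number of disagreements of the spin at the origin decreases in time, and, because
  the law is translation invariant and each flip of a spin changes the disagreements of both
  endpoints of an edge, it decreases at a rate proportional to the probability that the origin is
  unstable, i.e. disagrees with more than \<open>d\<close> neighbours. Hence the probabilities that a given
  site is unstable at the times \<open>k = 0, 1, 2, \<dots>\<close> are summable.

  Suppose that the spin is constant on a finite set \<open>C\<close> and opposite on its outer boundary. A site of
  \<open>C\<close> with maximal coordinate sum has at least \<open>d\<close> neighbours outside \<open>C\<close>. Either it is unstable, or
  with probability bounded below it flips within the next unit of time while all other clocks near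
  \<open>C\<close> are silent. By induction on \<open>C\<close>, the probabilities that \<open>C\<close> is such a set at time \<open>k\<close> are
  summable, and the first Borel-Cantelli lemma applies to each of the finitely many connected sets
  of bounded size containing the origin.

  The Markov property is used in the following form: replacing all clocks after time \<open>t\<close> by
  independent ones preserves the law and, since a trajectory up to time \<open>t\<close> is almost surely
  determined by the clocks up to time \<open>t\<close>, does not change the trajectory before \<open>t\<close>. This
  uniqueness holds because in a short time interval the sites that ring do not percolate.
\<close>

subsection \<open>Clocks\<close>

text \<open>The trajectory \<sigma> is not constructed: it is any coordinatewise measurable process
  that almost surely solves the dynamics for its own clocks, so a priori nothing relates its values
  at two sample points. Each use of resampling or of translation therefore needs pathwise
  uniqueness, to identify \<sigma> at the transformed point with the transform of \<sigma>.

  The energy is not differentiated through a generator but expanded over a time step \<delta>: up to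
  an event of probability of order \<delta>^2, at most one site near the origin rings. The errors of
  n steps of length 1/n total order 1/n and vanish in the limit.

  Ties are the obstacle. A flip with exactly d disagreements costs no energy, so the energy controls
  only sites with more than d of them, and a small cluster need not contain such a site. Flipping an
  exposed tied site, however, leaves a smaller set of the same kind, and a single site always has 2d
  > d disagreements, so the shrinking must end in an unstable site.\<close>

definition step_law :: "(real \<times> bool) measure" where
  "step_law = density lborel (exponential_density 1) \<Otimes>\<^sub>M measure_pmf (bernoulli_pmf (1 / 2))"

lemma clock_law_eq: "clock_law = (\<Pi>\<^sub>M n\<in>UNIV. step_law)"
  by (simp add: clock_law_def step_law_def)

interpretation expo: prob_space "density lborel (exponential_density 1)"
  by (rule prob_space_exponential_density) simp

interpretation step: prob_space step_law
  unfolding step_law_def by (intro prob_space_pair expo.prob_space_axioms prob_space_measure_pmf)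

interpretation clock: sequence_space step_law
  by unfold_locales

interpretation clock_law: prob_space clock_law
  unfolding clock_law_eq by unfold_locales

interpretation dyn: product_prob_space "\<lambda>x::'n::finite site. clock_law" UNIV
  by unfold_locales

interpretation dyn_law: prob_space "dyn_law :: ('n::finite site \<Rightarrow> clock) measure"
  unfolding dyn_law_def by unfold_locales

lemma sets_step_law[measurable_cong]: "sets step_law = sets (borel \<Otimes>\<^sub>M count_space UNIV)"
  unfolding step_law_def by (intro sets_pair_measure_cong) auto

lemma space_step_law[simp]: "space step_law = UNIV"
  by (simp add: step_law_def space_pair_measure)

lemma sets_clock_law[measurable_cong]:
  "sets clock_law = sets (\<Pi>\<^sub>M n\<in>UNIV. (borel \<Otimes>\<^sub>M count_space UNIV))"
  unfolding clock_law_eq by (intro sets_PiM_cong) (auto simp: sets_step_law)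

lemma space_clock_law[simp]: "space clock_law = UNIV"
  by (simp add: clock_law_eq space_PiM)

lemma sets_dyn_law[measurable_cong]: "sets dyn_law = sets (\<Pi>\<^sub>M x\<in>UNIV. clock_law)"
  by (simp add: dyn_law_def)

lemma space_dyn_law[simp]: "space dyn_law = UNIV"
  by (simp add: dyn_law_def space_PiM)

lemma measurable_clock_component[measurable (raw)]:
  "(\<lambda>c. c n) \<in> measurable clock_law (borel \<Otimes>\<^sub>M count_space UNIV)"
  using measurable_component_singleton[of n UNIV "\<lambda>_. step_law", folded clock_law_eq]
  by (simp cong: measurable_cong_sets add: sets_step_law)

lemma measurable_dyn_component[measurable (raw)]:
  "(\<lambda>w. w y) \<in> measurable dyn_law clock_law"
  using measurable_component_singleton[of y UNIV "\<lambda>_. clock_law", folded dyn_law_def]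
  by simp

lemma measurable_ring_time[measurable]: "(\<lambda>c. ring_time c n) \<in> borel_measurable clock_law"
  unfolding ring_time_def by measurable

text \<open>The integrand depends only on the coordinates in \<open>J\<close>, whose joint law under
  the infinite product is the finite product, where Fubini factors it.\<close>

lemma nn_integral_PiM_prod:
  fixes M :: "'i \<Rightarrow> 'a measure"
  assumes "\<And>i. prob_space (M i)" "finite J" "\<And>i. i \<in> J \<Longrightarrow> f i \<in> borel_measurable (M i)"
  shows "(\<integral>\<^sup>+x. (\<Prod>i\<in>J. f i (x i)) \<partial>PiM UNIV M) = (\<Prod>i\<in>J. \<integral>\<^sup>+x. f i x \<partial>M i)"
proof -
  interpret prob_space "M i" for i by fact
  interpret P: product_prob_space M UNIV by unfold_locales
  have "(\<Prod>i\<in>J. \<integral>\<^sup>+x. f i x \<partial>M i) = (\<integral>\<^sup>+x. (\<Prod>i\<in>J. f i (x i)) \<partial>PiM J M)"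
    using assms by (intro P.product_nn_integral_prod[symmetric]) auto
  also have "\<dots> = (\<integral>\<^sup>+x. (\<Prod>i\<in>J. f i (x i)) \<partial>distr (PiM UNIV M) (PiM J M) (\<lambda>x. restrict x J))"
    using P.distr_PiM_restrict_finite[of J] assms by simp
  also have "\<dots> = (\<integral>\<^sup>+x. (\<Prod>i\<in>J. f i (restrict x J i)) \<partial>PiM UNIV M)"
  proof (rule nn_integral_distr)
    show "(\<lambda>x. restrict x J) \<in> measurable (PiM UNIV M) (PiM J M)"
      by (rule measurable_restrict_subset) simp
    show "(\<lambda>x. \<Prod>i\<in>J. f i (x i)) \<in> borel_measurable (distr (PiM UNIV M) (PiM J M) (\<lambda>x. restrict x J))"
      unfolding measurable_distr_eq1 using assms(3)
      by (intro borel_measurable_prod_ennreal) (auto intro: measurable_compose[OF measurable_component_singleton])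
  qed
  finally show ?thesis by simp
qed

text \<open>Exposes the first waiting time and leaves a tail that is again a fresh clock, which is
  the form needed for induction on the number of waiting times.\<close>

lemma nn_integral_clock_case:
  assumes [measurable]: "f \<in> borel_measurable clock_law"
  shows "(\<integral>\<^sup>+c. f c \<partial>clock_law) = (\<integral>\<^sup>+x. \<integral>\<^sup>+c. f (case_nat x c) \<partial>clock_law \<partial>step_law)"
proof -
  have [measurable]: "(\<lambda>(x, c). case_nat x c) \<in> measurable (step_law \<Otimes>\<^sub>M clock_law) clock_law"
    unfolding clock_law_eq by measurable
  have "(\<integral>\<^sup>+c. f c \<partial>clock_law) = (\<integral>\<^sup>+p. f (case_nat (fst p) (snd p)) \<partial>(step_law \<Otimes>\<^sub>M clock_law))"
    by (subst clock.PiM_iter[symmetric, folded clock_law_eq], subst nn_integral_distr)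
       (auto simp: case_prod_beta')
  also have "\<dots> = (\<integral>\<^sup>+x. \<integral>\<^sup>+c. f (case_nat x c) \<partial>clock_law \<partial>step_law)"
    by (subst clock_law.nn_integral_fst[symmetric]) (auto simp: case_prod_beta')
  finally show ?thesis .
qed

lemma nn_integral_step_law:
  assumes [measurable]: "f \<in> borel_measurable (borel \<Otimes>\<^sub>M count_space UNIV)"
  shows "(\<integral>\<^sup>+x. f x \<partial>step_law) = (\<integral>\<^sup>+a. (\<integral>\<^sup>+b. f (a, b) \<partial>measure_pmf (bernoulli_pmf (1 / 2))) * 
     (ennreal (exp (- a)) * indicator {0..} a) \<partial>lborel)"
proof -
  have "(\<integral>\<^sup>+x. f x \<partial>step_law) = (\<integral>\<^sup>+a. (\<integral>\<^sup>+b. f (a, b) \<partial>measure_pmf (bernoulli_pmf (1 / 2))) \<partial>density lborel (exponential_density 1))"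
    unfolding step_law_def
  proof (subst measure_pmf.nn_integral_fst[symmetric])
    show "f \<in> borel_measurable (density lborel (exponential_density 1) \<Otimes>\<^sub>M measure_pmf (bernoulli_pmf (1 / 2)))"
      using assms sets_step_law unfolding step_law_def by (simp cong: measurable_cong_sets)
  qed simp
  also have "\<dots> = (\<integral>\<^sup>+a. ennreal (exponential_density 1 a) * (\<integral>\<^sup>+b. f (a, b) \<partial>measure_pmf (bernoulli_pmf (1 / 2))) \<partial>lborel)"
    by (subst nn_integral_density) (auto cong: measurable_cong_sets sets_pair_measure_cong)
  finally show ?thesis 
    by (simp, intro nn_integral_cong, auto simp: exponential_density_def indicator_def mult_ac)
qed

section \<open>Exponential waiting times and restarting a clock\<close>

lemma step_law_gt:
  assumes "t \<ge> 0"
  shows "emeasure step_law {x. fst x > t} = ennreal (exp (- t))"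
    and "emeasure step_law {x. fst x \<le> t} = ennreal (1 - exp (- t))"
proof -
  have D: "distributed step_law lborel fst (exponential_density 1)"
    unfolding distributed_def
  proof (intro conjI)
    show "distr step_law lborel fst = density lborel (\<lambda>x. ennreal (exponential_density 1 x))"
      unfolding step_law_def
      using measure_pmf.distr_pair_fst[of "density lborel (exponential_density 1)" "bernoulli_pmf (1/2)"]
      by (simp cong: distr_cong)
    show "fst \<in> measurable step_law lborel" by measurable
    show "(\<lambda>x. ennreal (exponential_density 1 x)) \<in> borel_measurable lborel" by measurable
  qed
  show "emeasure step_law {x. fst x > t} = ennreal (exp (- t))"
    using step.exponential_distributedD_gt[OF D assms] by (simp add: step.emeasure_eq_measure)
  show "emeasure step_law {x. fst x \<le> t} = ennreal (1 - exp (- t))"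
    using step.exponential_distributedD_le[OF D assms] by (simp add: step.emeasure_eq_measure)
qed

lemma sets_step_law_half_space[measurable]:
  "{x. t < fst x} \<in> sets step_law" "{x. fst x \<le> t} \<in> sets step_law"
proof -
  have "{x. t < fst x} = {x \<in> space step_law. t < fst x}" "{x. fst x \<le> t} = {x \<in> space step_law. fst x \<le> t}"
    by auto
  moreover have "{x \<in> space step_law. t < fst x} \<in> sets step_law" "{x \<in> space step_law. fst x \<le> t} \<in> sets step_law"
    by measurable
  ultimately show "{x. t < fst x} \<in> sets step_law" "{x. fst x \<le> t} \<in> sets step_law"
    by metis+
qed

lemma emeasure_clock_law_UNIV[simp]: "emeasure clock_law UNIV = 1"
  using clock_law.emeasure_space_1 by simp

lemma measurable_step_shift:
  "(\<lambda>x. (t + fst x, snd x)) \<in> measurable step_law (borel \<Otimes>\<^sub>M count_space UNIV)"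
proof -
  have "(\<lambda>x. (t + fst x, snd x)) \<in> measurable (borel \<Otimes>\<^sub>M count_space (UNIV :: bool set)) (borel \<Otimes>\<^sub>M count_space UNIV)"
    by (intro measurable_Pair measurable_snd borel_measurable_add measurable_const) auto
  then show ?thesis by (simp add: sets_step_law cong: measurable_cong_sets)
qed

text \<open>The density satisfies exp (- (t + a)) = exp (- t) * exp (- a), and the coin is
  independent of the waiting time. Writing the conditional law beyond \<open>t\<close> as a product
  avoids dividing by the tail probability.\<close>

lemma step_law_memoryless:
  assumes "t \<ge> 0" and [measurable]: "A \<in> sets (borel \<Otimes>\<^sub>M count_space UNIV)"
  shows "emeasure step_law {x. fst x > t} * emeasure step_law {x. (t + fst x, snd x) \<in> A}
    = emeasure step_law {x \<in> A. fst x > t}"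
proof -
  let ?B = "measure_pmf (bernoulli_pmf (1 / 2))"
  define g :: "real \<Rightarrow> ennreal" where "g a = (\<integral>\<^sup>+b. indicator A (a, b) \<partial>?B)" for a
  have "(\<lambda>x. (t + fst x, snd x)) \<in> measurable step_law (borel \<Otimes>\<^sub>M count_space UNIV)"
    by (rule measurable_step_shift)
  then have [measurable]: "{x. (t + fst x, snd x) \<in> A} \<in> sets step_law"
    using measurable_sets[of "\<lambda>x. (t + fst x, snd x)" step_law "borel \<Otimes>\<^sub>M count_space UNIV" A]
    by (simp add: vimage_def)
  have [measurable]: "{x \<in> A. fst x > t} \<in> sets step_law"
  proof -
    have "{x \<in> A. fst x > t} = A \<inter> {x. fst x > t}" by auto
    moreover have "A \<in> sets step_law" using assms(2) by (simp add: sets_step_law)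
    ultimately show ?thesis by (simp add: sets_step_law_half_space)
  qed
  have [measurable]: "g \<in> borel_measurable borel"
    unfolding g_def by (auto cong: measurable_cong_sets sets_pair_measure_cong intro!: measure_pmf.borel_measurable_nn_integral)
  have "emeasure step_law {x \<in> A. fst x > t} = (\<integral>\<^sup>+x. indicator {x \<in> A. fst x > t} x \<partial>step_law)"
    by simp
  also have "\<dots> = (\<integral>\<^sup>+a. g a * (ennreal (exp (- a)) * indicator {t<..} a) \<partial>lborel)"
  proof (subst nn_integral_step_law)
    show "indicator {x \<in> A. fst x > t} \<in> borel_measurable (borel \<Otimes>\<^sub>M count_space UNIV)"
      using \<open>{x \<in> A. fst x > t} \<in> sets step_law\<close> by (intro borel_measurable_indicator) (simp add: sets_step_law)
    have "(\<integral>\<^sup>+b. indicator {x \<in> A. fst x > t} (a, b) \<partial>?B) * (ennreal (exp (- a)) * indicator {0..} a)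
        = g a * (ennreal (exp (- a)) * indicator {t<..} a)" for a
    proof (cases "t < a")
      case True
      then have "indicator {x \<in> A. fst x > t} (a, b) = (indicator A (a, b) :: ennreal)" for b
        by (simp add: indicator_def)
      then show ?thesis using True assms(1) by (simp add: g_def)
    next
      case False
      then have "indicator {x \<in> A. fst x > t} (a, b) = (0 :: ennreal)" for b
        by (simp add: indicator_def)
      then show ?thesis using False by simp
    qed
    then show "(\<integral>\<^sup>+a. (\<integral>\<^sup>+b. indicator {x \<in> A. fst x > t} (a, b) \<partial>?B) * (ennreal (exp (- a)) * indicator {0..} a) \<partial>lborel)
      = (\<integral>\<^sup>+a. g a * (ennreal (exp (- a)) * indicator {t<..} a) \<partial>lborel)"
      by presburger
  qed
  \<comment> \<open>The point \<open>t\<close> is Lebesgue null, so the half-line may be closed; the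
    shift by \<open>t\<close> then yields exactly the support of the exponential density.\<close>
  also have "\<dots> = (\<integral>\<^sup>+a. g a * (ennreal (exp (- a)) * indicator {t..} a) \<partial>lborel)"
    by (rule nn_integral_cong_AE, use AE_lborel_singleton[of t] in eventually_elim) (auto simp: indicator_def)
  also have "\<dots> = (\<integral>\<^sup>+a. g (t + a) * (ennreal (exp (- (t + a))) * indicator {t..} (t + a)) \<partial>lborel)"
    by (subst nn_integral_real_affine[where c=1 and t=t]) auto
  also have "\<dots> = (\<integral>\<^sup>+a. ennreal (exp (-t)) * (g (t + a) * (ennreal (exp (- a)) * indicator {0..} a)) \<partial>lborel)"
    by (intro nn_integral_cong) (auto simp: indicator_def exp_diff exp_minus divide_inverse ennreal_mult mult_ac)
  also have "\<dots> = ennreal (exp (-t)) * (\<integral>\<^sup>+a. (g (t + a) * (ennreal (exp (- a)) * indicator {0..} a)) \<partial>lborel)"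
    by (rule nn_integral_cmult) measurable
  also have "(\<integral>\<^sup>+a. (g (t + a) * (ennreal (exp (- a)) * indicator {0..} a)) \<partial>lborel)
      = (\<integral>\<^sup>+x. indicator {x. (t + fst x, snd x) \<in> A} x \<partial>step_law)"
  proof (subst nn_integral_step_law)
    show "indicator {x. (t + fst x, snd x) \<in> A} \<in> borel_measurable (borel \<Otimes>\<^sub>M count_space UNIV)"
      using \<open>{x. (t + fst x, snd x) \<in> A} \<in> sets step_law\<close> by (intro borel_measurable_indicator) (simp add: sets_step_law)
    have "indicator {x. (t + fst x, snd x) \<in> A} (a, b) = (indicator A (t + a, b) :: ennreal)" for a b
      by (simp add: indicator_def)
    then have "(\<integral>\<^sup>+b. indicator {x. (t + fst x, snd x) \<in> A} (a, b) \<partial>?B) = g (t + a)" for a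
      by (simp add: g_def)
    then show "(\<integral>\<^sup>+a. (g (t + a) * (ennreal (exp (- a)) * indicator {0..} a)) \<partial>lborel)
      = (\<integral>\<^sup>+a. (\<integral>\<^sup>+b. indicator {x. (t + fst x, snd x) \<in> A} (a, b) \<partial>?B) * (ennreal (exp (- a)) * indicator {0..} a) \<partial>lborel)"
      by presburger
  qed
  finally show ?thesis using assms by (simp add: step_law_gt)
qed

text \<open>The clock that rings like \<open>c\<close> up to time \<open>t\<close> and then like \<open>c'\<close> restarted at time \<open>t\<close>; see
  \<open>marks_splice\<close>. The recursion is on the index of the waiting time.\<close>

primrec splice_clock :: "real \<Rightarrow> clock \<Rightarrow> clock \<Rightarrow> nat \<Rightarrow> real \<times> bool" where
  "splice_clock t c c' 0 = (if fst (c 0) \<le> t then c 0 else (t + fst (c' 0), snd (c' 0)))"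
| "splice_clock t c c' (Suc n) =
     (if fst (c 0) \<le> t then splice_clock (t - fst (c 0)) (\<lambda>k. c (Suc k)) c' n else c' (Suc n))"

lemma measurable_splice_aux[measurable (raw)]:
  assumes "f \<in> borel_measurable M" "g \<in> measurable M clock_law" "h \<in> measurable M clock_law"
  shows "(\<lambda>x. splice_clock (f x) (g x) (h x) n) \<in> measurable M (borel \<Otimes>\<^sub>M count_space UNIV)"
  using assms
proof (induction n arbitrary: f g)
  case 0
  note [measurable] = 0
  have [measurable]: "(\<lambda>x. g x 0) \<in> measurable M (borel \<Otimes>\<^sub>M count_space UNIV)"
    "(\<lambda>x. h x 0) \<in> measurable M (borel \<Otimes>\<^sub>M count_space UNIV)"
    using 0 by (auto intro: measurable_compose[OF _ measurable_clock_component])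
  show ?case by simp
next
  case (Suc n)
  note [measurable] = Suc.prems
  have [measurable]: "(\<lambda>x. g x n) \<in> measurable M (borel \<Otimes>\<^sub>M count_space UNIV)"
    "(\<lambda>x. h x n) \<in> measurable M (borel \<Otimes>\<^sub>M count_space UNIV)" for n
    using Suc.prems by (auto intro: measurable_compose[OF _ measurable_clock_component])
  have [measurable]: "(\<lambda>x k. g x (Suc k)) \<in> measurable M clock_law"
    unfolding clock_law_eq by (rule measurable_PiM_single') (auto simp: sets_step_law cong: measurable_cong_sets)
  have [measurable]: "(\<lambda>x. splice_clock (f x - fst (g x 0)) (\<lambda>k. g x (Suc k)) (h x) n) \<in> measurable M (borel \<Otimes>\<^sub>M count_space UNIV)"
  proof (rule Suc.IH)
    show "(\<lambda>x. f x - fst (g x 0)) \<in> borel_measurable M" by measurable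
  qed fact+
  show ?case unfolding splice_clock.simps by measurable
qed

lemma measurable_splice[measurable (raw)]:
  assumes "f \<in> borel_measurable M" "g \<in> measurable M clock_law" "h \<in> measurable M clock_law"
  shows "(\<lambda>x. splice_clock (f x) (g x) (h x)) \<in> measurable M clock_law"
proof -
  have "(\<lambda>x. splice_clock (f x) (g x) (h x) n) \<in> measurable M step_law" for n
    using measurable_splice_aux[OF assms, of n] by (simp add: sets_step_law cong: measurable_cong_sets)
  then show ?thesis
    unfolding clock_law_eq by (intro measurable_PiM_single') auto
qed

lemma splice_clock_case:
  "fst x \<le> t \<Longrightarrow> splice_clock t (case_nat x c) c' = case_nat x (splice_clock (t - fst x) c c')"
  "\<not> fst x \<le> t \<Longrightarrow> splice_clock t (case_nat x c) c' = case_nat (t + fst (c' 0), snd (c' 0)) (\<lambda>n. c' (Suc n))"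
  by (auto simp: fun_eq_iff split: nat.split)

text \<open>Split off the first waiting time: if it exceeds \<open>t\<close>, use memorylessness, otherwise induct.\<close>

lemma nn_integral_splice_clock:
  assumes "t \<ge> 0" "\<And>i. A i \<in> sets step_law"
  shows "(\<integral>\<^sup>+c. \<integral>\<^sup>+c'. (\<Prod>i<n. indicator (A i) (splice_clock t c c' i)) \<partial>clock_law \<partial>clock_law)
    = (\<Prod>i<n. emeasure step_law (A i))"
  using assms
proof (induction n arbitrary: t A)
  case 0
  show ?case by simp
next
  case (Suc n)
  have [measurable]: "A i \<in> sets (borel \<Otimes>\<^sub>M count_space UNIV)" for i
    using Suc.prems(2) sets_step_law by simp
  let ?P = "\<Prod>i<n. emeasure step_law (A (Suc i))"
  let ?S = "{x. (t + fst x, snd x) \<in> A 0}"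
  have "(\<lambda>x. (t + fst x, snd x)) \<in> measurable step_law (borel \<Otimes>\<^sub>M count_space UNIV)"
    by (rule measurable_step_shift)
  then have S: "?S \<in> sets step_law"
    using measurable_sets[of "\<lambda>x. (t + fst x, snd x)" step_law "borel \<Otimes>\<^sub>M count_space UNIV" "A 0"]
    by (simp add: vimage_def)
  have [measurable]: "(\<lambda>(c, c'). splice_clock t c c') \<in> measurable (clock_law \<Otimes>\<^sub>M clock_law) clock_law"
    by measurable
  have "(\<integral>\<^sup>+c. \<integral>\<^sup>+c'. (\<Prod>i<Suc n. indicator (A i) (splice_clock t c c' i)) \<partial>clock_law \<partial>clock_law)
     = (\<integral>\<^sup>+x. \<integral>\<^sup>+c. \<integral>\<^sup>+c'. (\<Prod>i<Suc n. indicator (A i) (splice_clock t (case_nat x c) c' i))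
          \<partial>clock_law \<partial>clock_law \<partial>step_law)"
    by (rule nn_integral_clock_case) measurable
  also have "\<dots> = (\<integral>\<^sup>+x. (emeasure step_law ?S * ?P) * indicator {x. fst x > t} x 
       + ?P * indicator {x \<in> A 0. fst x \<le> t} x \<partial>step_law)"
  proof (intro nn_integral_cong)
    fix x :: "real \<times> bool"
    show "(\<integral>\<^sup>+c. \<integral>\<^sup>+c'. (\<Prod>i<Suc n. indicator (A i) (splice_clock t (case_nat x c) c' i)) \<partial>clock_law \<partial>clock_law)
      = (emeasure step_law ?S * ?P) * indicator {x. fst x > t} x + ?P * indicator {x \<in> A 0. fst x \<le> t} x"
    proof (cases "fst x \<le> t")
      case True
      have "(\<integral>\<^sup>+c. \<integral>\<^sup>+c'. (\<Prod>i<Suc n. indicator (A i) (splice_clock t (case_nat x c) c' i)) \<partial>clock_law \<partial>clock_law)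
        = (\<integral>\<^sup>+c. \<integral>\<^sup>+c'. indicator (A 0) x * (\<Prod>i<n. indicator (A (Suc i)) (splice_clock (t - fst x) c c' i)) \<partial>clock_law \<partial>clock_law)"
        using True by (simp add: splice_clock_case prod.lessThan_Suc_shift del: splice_clock.simps prod.lessThan_Suc)
      also have "\<dots> = indicator (A 0) x * (\<integral>\<^sup>+c. \<integral>\<^sup>+c'. (\<Prod>i<n. indicator (A (Suc i)) (splice_clock (t - fst x) c c' i)) \<partial>clock_law \<partial>clock_law)"
        by (simp add: nn_integral_cmult)
      also have "\<dots> = indicator (A 0) x * ?P"
        using True Suc.prems by (subst Suc.IH) auto
      finally show ?thesis using True by (auto simp: indicator_def)
    next
      \<comment> \<open>The spliced clock does not depend on \<open>c\<close> in this case: the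
        first entry of \<open>c'\<close> is delayed by \<open>t\<close> and the later entries are
        those of \<open>c'\<close>.\<close>
      case False
      have "(\<integral>\<^sup>+c. \<integral>\<^sup>+c'. (\<Prod>i<Suc n. indicator (A i) (splice_clock t (case_nat x c) c' i)) \<partial>clock_law \<partial>clock_law)
        = (\<integral>\<^sup>+c. \<integral>\<^sup>+c'. (\<Prod>i<Suc n. indicator (if i = 0 then ?S else A i) (c' i)) \<partial>clock_law \<partial>clock_law)"
        using False by (simp add: splice_clock_case prod.lessThan_Suc_shift indicator_def del: splice_clock.simps prod.lessThan_Suc)
      also have "\<dots> = (\<integral>\<^sup>+c'. (\<Prod>i<Suc n. indicator (if i = 0 then ?S else A i) (c' i)) \<partial>clock_law)"
        by (simp del: prod.lessThan_Suc)
      also have "\<dots> = (\<Prod>i<Suc n. \<integral>\<^sup>+x. indicator (if i = 0 then ?S else A i) x \<partial>step_law)"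
        unfolding clock_law_eq using S Suc.prems(2)
        by (intro nn_integral_PiM_prod step.prob_space_axioms) (auto intro!: borel_measurable_indicator)
      also have "\<dots> = emeasure step_law ?S * ?P"
        using S Suc.prems(2) by (simp add: prod.lessThan_Suc_shift del: prod.lessThan_Suc)
      finally show ?thesis using False by (auto simp: indicator_def)
    qed
  qed
  also have "\<dots> = (emeasure step_law ?S * ?P) * emeasure step_law {x. fst x > t}
       + ?P * emeasure step_law {x \<in> A 0. fst x \<le> t}"
  proof -
    have "{x \<in> A 0. fst x \<le> t} = A 0 \<inter> {x. fst x \<le> t}" by auto
    then have [measurable]: "{x \<in> A 0. fst x \<le> t} \<in> sets step_law"
      using sets_step_law_half_space Suc.prems(2) by simp
    show ?thesis by (simp add: nn_integral_add nn_integral_cmult)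
  qed
  also have "\<dots> = (emeasure step_law {x \<in> A 0. fst x > t} + emeasure step_law {x \<in> A 0. fst x \<le> t}) * ?P"
  proof -
    have "(s * p) * e + p * l = (e * s + l) * p" for s p e l :: ennreal
      by (simp add: distrib_left distrib_right mult_ac)
    then show ?thesis
      using Suc.prems(1) step_law_memoryless[of t "A 0"] by simp
  qed
  also have "emeasure step_law {x \<in> A 0. fst x > t} + emeasure step_law {x \<in> A 0. fst x \<le> t} = emeasure step_law (A 0)"
  proof -
    have "{x \<in> A 0. fst x > t} = A 0 \<inter> {x. fst x > t}" 
         "{x \<in> A 0. fst x \<le> t} = A 0 \<inter> {x. fst x \<le> t}" by auto
    then have "{x \<in> A 0. fst x > t} \<in> sets step_law" "{x \<in> A 0. fst x \<le> t} \<in> sets step_law"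
      using sets_step_law_half_space Suc.prems(2) by simp_all
    then show ?thesis by (subst plus_emeasure) (auto intro!: arg_cong[where f="emeasure step_law"])
  qed
  finally show ?case by (simp add: prod.lessThan_Suc_shift del: prod.lessThan_Suc)
qed

text \<open>Cylinder events determine a law on sequences. The product formula above covers initial
  segments of indices, so a general finite index set is padded with the full space.\<close>

lemma distr_splice_clock:
  assumes "t \<ge> 0"
  shows "distr (clock_law \<Otimes>\<^sub>M clock_law) clock_law (\<lambda>(c, c'). splice_clock t c c') = clock_law"
proof -
  have *: "distr (clock_law \<Otimes>\<^sub>M clock_law) clock_law (\<lambda>(c, c'). splice_clock t c c') = PiM UNIV (\<lambda>_. step_law)"
  proof (rule clock.PiM_eq)
    show "sets (distr (clock_law \<Otimes>\<^sub>M clock_law) clock_law (\<lambda>(c, c'). splice_clock t c c')) = sets (PiM UNIV (\<lambda>_. step_law))"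
      by (simp add: clock_law_eq)
    fix J :: "nat set" and F assume J: "finite J" and F: "\<And>j. j \<in> J \<Longrightarrow> F j \<in> sets step_law"
    obtain n where n: "J \<subseteq> {..<n}" using J finite_nat_iff_bounded by auto
    define A where "A i = (if i \<in> J then F i else UNIV)" for i
    have UN: "UNIV \<in> sets step_law" using sets.top[of step_law] by simp
    have A: "A i \<in> sets step_law" for i using F UN by (auto simp: A_def)
    have [measurable]: "(\<lambda>(c, c'). splice_clock t c c') \<in> measurable (clock_law \<Otimes>\<^sub>M clock_law) clock_law"
      by measurable
    have E: "prod_emb UNIV (\<lambda>_. step_law) J (Pi\<^sub>E J F) = {c. \<forall>i<n. c i \<in> A i}"
      using n unfolding prod_emb_def by (fastforce simp: space_PiM A_def PiE_iff)
    have Em: "{c. \<forall>i<n. c i \<in> A i} \<in> sets clock_law"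
      unfolding E[symmetric] clock_law_eq using J F by (intro sets_PiM_I) auto
    have i: "indicator {c. \<forall>i<n. c i \<in> A i} c = (\<Prod>i<n. indicator (A i) (c i) :: ennreal)" for c
      by (induction n) (auto simp: indicator_def less_Suc_eq)
    have "emeasure (distr (clock_law \<Otimes>\<^sub>M clock_law) clock_law (\<lambda>(c, c'). splice_clock t c c')) {c. \<forall>i<n. c i \<in> A i}
      = (\<integral>\<^sup>+p. indicator {c. \<forall>i<n. c i \<in> A i} (splice_clock t (fst p) (snd p)) \<partial>(clock_law \<Otimes>\<^sub>M clock_law))"
      using Em by (subst nn_integral_indicator[symmetric], simp, subst nn_integral_distr) (auto simp: case_prod_beta')
    also have "\<dots> = (\<integral>\<^sup>+c. \<integral>\<^sup>+c'. indicator {c. \<forall>i<n. c i \<in> A i} (splice_clock t c c') \<partial>clock_law \<partial>clock_law)"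
      using Em by (subst clock_law.nn_integral_fst[symmetric]) (auto)
    also have "\<dots> = (\<Prod>i<n. emeasure step_law (A i))"
      unfolding i using nn_integral_splice_clock[OF assms A] .
    also have "\<dots> = (\<Prod>j\<in>J. emeasure step_law (F j))"
      using n J step.emeasure_space_1 by (intro prod.mono_neutral_cong_right) (auto simp: A_def)
    finally show "emeasure (distr (clock_law \<Otimes>\<^sub>M clock_law) clock_law (\<lambda>(c, c'). splice_clock t c c'))
        (prod_emb UNIV (\<lambda>_. step_law) J (Pi\<^sub>E J F)) = (\<Prod>j\<in>J. emeasure step_law (F j))"
      unfolding E .
  qed
  then show ?thesis by (simp add: clock_law_eq)
qed

subsection \<open>The lattice\<close>

text \<open>The squared distance is a sum of squares of integers, and such a sum equals 1 only if a
  single term is 1 and the others vanish.\<close>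

lemma nearest_neighbors_iff:
  fixes x y :: "'n::finite site"
  shows "nearest_neighbors x y \<longleftrightarrow> (\<exists>i. y = x + axis i 1 \<or> y = x - axis i 1)"
proof -
  have "dist (\<chi> i. real_of_int (x $ i)) ((\<chi> i. real_of_int (y $ i)) :: real ^ 'n)
      = sqrt (real_of_int (\<Sum>i\<in>UNIV. (y $ i - x $ i)\<^sup>2))"
  proof -
    have "(real_of_int (x $ i) - real_of_int (y $ i))\<^sup>2 = real_of_int ((y $ i - x $ i)\<^sup>2)" for i
      by (simp add: power2_eq_square algebra_simps)
    then show ?thesis by (simp add: dist_vec_def L2_set_def dist_real_def)
  qed
  then have nn: "nearest_neighbors x y \<longleftrightarrow> (\<Sum>i\<in>UNIV. (y $ i - x $ i)\<^sup>2) = 1"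
    by (simp only: nearest_neighbors_def real_sqrt_eq_1_iff of_int_eq_1_iff)
  show ?thesis
  proof
    assume "nearest_neighbors x y"
    then have s: "(\<Sum>i\<in>UNIV. (y $ i - x $ i)\<^sup>2) = 1" using nn by simp
    then obtain i where i: "(y $ i - x $ i)\<^sup>2 \<noteq> 0"
      using sum.neutral[of UNIV "\<lambda>i. (y $ i - x $ i)\<^sup>2"] by fastforce
    have sp: "(y $ i - x $ i)\<^sup>2 + (\<Sum>j\<in>UNIV - {i}. (y $ j - x $ j)\<^sup>2) = 1"
      using s by (subst (asm) sum.remove[of UNIV i]) auto
    have nn: "(\<Sum>j\<in>UNIV - {i}. (y $ j - x $ j)\<^sup>2) \<ge> 0" by (intro sum_nonneg) auto
    have "(y $ i - x $ i)\<^sup>2 \<ge> 1" using i by (simp add: int_one_le_iff_zero_less)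
    then have 1: "(y $ i - x $ i)\<^sup>2 = 1" and "(\<Sum>j\<in>UNIV - {i}. (y $ j - x $ j)\<^sup>2) = 0"
      using sp nn by linarith+
    then have 2: "\<forall>j\<in>UNIV - {i}. (y $ j - x $ j)\<^sup>2 = 0"
      by (subst (asm) sum_nonneg_eq_0_iff) auto
    have "y $ i - x $ i = 1 \<or> y $ i - x $ i = -1" using 1 by (simp add: power2_eq_1_iff)
    then show "\<exists>i. y = x + axis i 1 \<or> y = x - axis i 1"
    proof
      assume "y $ i - x $ i = 1"
      then have "y = x + axis i 1" using 2 by (auto simp: vec_eq_iff axis_def)
      then show ?thesis by blast
    next
      assume "y $ i - x $ i = -1"
      then have "y = x - axis i 1" using 2 by (auto simp: vec_eq_iff axis_def)
      then show ?thesis by blast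
    qed
  next
    assume "\<exists>i. y = x + axis i 1 \<or> y = x - axis i 1"
    then obtain i where "y = x + axis i 1 \<or> y = x - axis i 1" by blast
    then have "(y $ j - x $ j)\<^sup>2 = (if j = i then 1 else 0)" for j
      by (auto simp: axis_def)
    then show "nearest_neighbors x y" using nn by simp
  qed
qed

definition nbrs :: "('n::finite) site \<Rightarrow> 'n site set" where
  "nbrs x = {y. nearest_neighbors x y}"

lemma nbrs_eq: "nbrs x = (\<lambda>i. x + axis i 1) ` UNIV \<union> (\<lambda>i. x - axis i 1) ` UNIV"
  by (auto simp: nbrs_def nearest_neighbors_iff)

lemma finite_nbrs[simp]: "finite (nbrs x)"
  by (simp add: nbrs_eq)

lemma inj_axis_one: "inj (\<lambda>i. axis i (1::int) :: int ^ 'n::finite)"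
  by (rule injI) (simp add: axis_eq_axis)

lemma card_nbrs: "card (nbrs (x :: 'n::finite site)) = 2 * CARD('n)"
proof -
  have "axis i (1::int) \<noteq> (- axis j 1 :: int ^ 'n)" for i j
  proof
    assume "axis i (1::int) = (- axis j 1 :: int ^ 'n)"
    then have "axis i (1::int) $ i = (- axis j 1 :: int ^ 'n) $ i" by (rule arg_cong)
    then show False by (auto simp: axis_def split: if_splits)
  qed
  then have "(\<lambda>i. x + axis i 1) ` UNIV \<inter> (\<lambda>i. x - axis i 1) ` UNIV = {}"
    by (auto simp: diff_conv_add_uminus simp del: add_uminus_conv_diff)
  moreover have "card ((\<lambda>i. x + axis i 1) ` UNIV) = CARD('n)"
    using inj_axis_one by (intro card_image) (auto simp: inj_on_def)
  moreover have "card ((\<lambda>i. x - axis i 1) ` UNIV) = CARD('n)"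
    using inj_axis_one by (intro card_image) (auto simp: inj_on_def)
  ultimately show ?thesis unfolding nbrs_eq by (subst card_Un_disjoint) auto
qed

lemma nbrs_sym: "y \<in> nbrs x \<longleftrightarrow> x \<in> nbrs y"
  by (simp add: nbrs_def nearest_neighbors_def dist_commute)

lemma nbrs_irrefl: "x \<notin> nbrs x"
  by (simp add: nbrs_def nearest_neighbors_def)

lemma nbrs_translate: "y + z \<in> nbrs (x + z) \<longleftrightarrow> y \<in> nbrs x"
  by (auto simp: nbrs_def nearest_neighbors_iff algebra_simps)

lemma nbrs_translate_image: "nbrs (x + z) = (\<lambda>y. y + z) ` nbrs x"
proof (intro equalityI subsetI)
  fix y assume "y \<in> nbrs (x + z)"
  then have "(y - z) \<in> nbrs x" using nbrs_translate[of "y - z" z x] by simp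
  then show "y \<in> (\<lambda>y. y + z) ` nbrs x" by (metis diff_add_cancel image_eqI)
qed (auto simp: nbrs_translate)

lemma nbrs_0_minus: "y \<in> nbrs 0 \<Longrightarrow> - y \<in> nbrs 0"
  using nbrs_translate[of "- y" y 0] by (simp add: nbrs_sym)

text \<open>A site of \<open>C\<close> with maximal coordinate sum.\<close>

lemma exists_exposed_site:
  fixes C :: "'n::finite site set"
  assumes "finite C" "C \<noteq> {}"
  obtains x where "x \<in> C" "card (nbrs x - C) \<ge> CARD('n)"
proof -
  define f :: "'n site \<Rightarrow> int" where "f x = (\<Sum>i\<in>UNIV. x $ i)" for x
  have "Max (f ` C) \<in> f ` C" using assms by (intro Max_in) auto
  then obtain x where x: "x \<in> C" "f x = Max (f ` C)" by auto
  have "f (x + axis i 1) = f x + 1" for i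
    by (simp add: f_def sum.distrib axis_def)
  then have "x + axis i 1 \<notin> C" for i
    using x assms Max_ge[of "f ` C" "f (x + axis i 1)"] by fastforce
  then have "(\<lambda>i. x + axis i 1) ` UNIV \<subseteq> nbrs x - C" by (auto simp: nbrs_eq)
  moreover have "card ((\<lambda>i. x + axis i 1) ` UNIV) = CARD('n)"
    using inj_axis_one by (intro card_image) (auto simp: inj_on_def)
  ultimately have "card (nbrs x - C) \<ge> CARD('n)"
    using card_mono[of "nbrs x - C"] by (metis finite_Diff finite_nbrs)
  then show thesis using that x by blast
qed

lemma disagreements_eq: "disagreements s x = card {y \<in> nbrs x. s y \<noteq> s x}"
  by (simp add: disagreements_def nbrs_def)

lemma disagreements_le: "disagreements s (x :: 'n::finite site) \<le> 2 * CARD('n)"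
  unfolding disagreements_eq card_nbrs[of x, symmetric] by (intro card_mono) auto

lemma updated_spin_cong:
  assumes "s x = s' x" "\<And>y. y \<in> nbrs x \<Longrightarrow> s y = s' y"
  shows "updated_spin s x b = updated_spin s' x b"
proof -
  have "disagreements s x = disagreements s' x"
    unfolding disagreements_eq using assms by (intro arg_cong[where f=card]) auto
  then show ?thesis by (simp add: updated_spin_def assms)
qed

subsection \<open>Marks of a clock\<close>

text \<open>The indices are forgotten because splicing renumbers the rings, whereas a trajectory
  sees only their times and coins.\<close>

definition marks :: "clock \<Rightarrow> (real \<times> bool) set" where
  "marks c = range (\<lambda>n. (ring_time c n, ring_coin c n))"

definition regular_clock :: "clock \<Rightarrow> bool" where
  "regular_clock c \<longleftrightarrow> (\<forall>n. fst (c n) > 0) \<and> (\<forall>t. \<exists>n. ring_time c n > t)"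

lemma ring_time_Suc: "ring_time c (Suc n) = ring_time c n + fst (c (Suc n))"
  by (simp add: ring_time_def)

lemma ring_time_Suc_shift: "ring_time c (Suc n) = fst (c 0) + ring_time (\<lambda>k. c (Suc k)) n"
  unfolding ring_time_def by (rule sum.atMost_Suc_shift)

lemma regular_ring_time_strict_mono: "regular_clock c \<Longrightarrow> strict_mono (ring_time c)"
  by (rule strict_monoI_Suc) (simp add: ring_time_Suc regular_clock_def)

lemma marks_pos: "regular_clock c \<Longrightarrow> (r, b) \<in> marks c \<Longrightarrow> r > 0"
  by (auto simp: marks_def ring_time_def regular_clock_def intro!: sum_pos)

lemma finite_marks:
  assumes "regular_clock c"
  shows "finite {m \<in> marks c. fst m \<le> t}"
proof -
  obtain N where N: "ring_time c N > t" using assms by (auto simp: regular_clock_def)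
  have "n < N" if "ring_time c n \<le> t" for n
    using that N strict_mono_less[OF regular_ring_time_strict_mono[OF assms], of n N] by simp
  then have "{m \<in> marks c. fst m \<le> t} \<subseteq> (\<lambda>n. (ring_time c n, ring_coin c n)) ` {..<N}"
    by (auto simp: marks_def)
  then show ?thesis by (rule finite_subset) simp
qed

lemma marks_eq_insert:
  "marks c = insert (c 0) ((\<lambda>(r, b). (fst (c 0) + r, b)) ` marks (\<lambda>k. c (Suc k)))"
proof -
  have "range h = insert (h 0) (range (\<lambda>n. h (Suc n)))" for h :: "nat \<Rightarrow> real \<times> bool"
    by (auto simp: image_iff) (metis not0_implies_Suc)
  then have "marks c = insert (ring_time c 0, ring_coin c 0) (range (\<lambda>n. (ring_time c (Suc n), ring_coin c (Suc n))))"
    unfolding marks_def .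
  then show ?thesis
    by (simp add: marks_def ring_time_Suc_shift ring_coin_def image_image ring_time_def[of c 0])
qed

lemma regular_clock_tl:
  assumes "regular_clock c"
  shows "regular_clock (\<lambda>k. c (Suc k))"
  unfolding regular_clock_def
proof (intro conjI allI)
  fix t
  obtain n where n: "ring_time c n > fst (c 0) + max t 0" using assms by (auto simp: regular_clock_def)
  then obtain m where "n = Suc m" by (cases n) (auto simp: ring_time_def)
  then have "ring_time (\<lambda>k. c (Suc k)) m > t" using n by (simp add: ring_time_Suc_shift)
  then show "\<exists>n. ring_time (\<lambda>k. c (Suc k)) n > t" by blast
qed (use assms in \<open>simp add: regular_clock_def\<close>)

lemma marks_splice:
  assumes "regular_clock c" "t \<ge> 0"
  shows "marks (splice_clock t c c') = {m \<in> marks c. fst m \<le> t} \<union> (\<lambda>(r, b). (t + r, b)) ` marks c'"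
proof -
  \<comment> \<open>The recursion of \<open>splice_clock\<close> consumes at most \<open>N\<close>
    waiting times before the remaining time is exceeded, so the induction runs on \<open>N\<close>
    while \<open>c\<close> and \<open>t\<close> vary.\<close>
  obtain N where "ring_time c N > t" using assms by (auto simp: regular_clock_def)
  then show ?thesis using assms
  proof (induction N arbitrary: c t)
    case (0 c t)
    then have gt: "\<not> fst (c 0) \<le> t" by (simp add: ring_time_def)
    have "{m \<in> marks c. fst m \<le> t} = {}"
      using gt marks_pos[OF regular_clock_tl[OF 0(2)]] unfolding marks_eq_insert[of c] by fastforce
    moreover have "marks (splice_clock t c c') = (\<lambda>(r, b). (t + r, b)) ` marks c'"
      using gt unfolding marks_eq_insert[of "splice_clock t c c'"] marks_eq_insert[of c']
      by (simp add: image_image case_prod_beta' add.assoc)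
    ultimately show ?case by (simp only: Un_empty_left)
  next
    case (Suc N c t)
    show ?case
    proof (cases "fst (c 0) \<le> t")
      case gt: False
      have "{m \<in> marks c. fst m \<le> t} = {}"
        using gt marks_pos[OF regular_clock_tl[OF Suc.prems(2)]] unfolding marks_eq_insert[of c] by fastforce
      moreover have "marks (splice_clock t c c') = (\<lambda>(r, b). (t + r, b)) ` marks c'"
        using gt unfolding marks_eq_insert[of "splice_clock t c c'"] marks_eq_insert[of c']
        by (simp add: image_image case_prod_beta' add.assoc)
      ultimately show ?thesis by (simp only: Un_empty_left)
    next
      case True
      let ?c = "\<lambda>k. c (Suc k)"
      have "marks (splice_clock t c c') = insert (c 0) ((\<lambda>(r, b). (fst (c 0) + r, b)) ` marks (splice_clock (t - fst (c 0)) ?c c'))"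
        using True by (subst marks_eq_insert) simp
      also have "marks (splice_clock (t - fst (c 0)) ?c c') = 
          {m \<in> marks ?c. fst m \<le> t - fst (c 0)} \<union> (\<lambda>(r, b). (t - fst (c 0) + r, b)) ` marks c'"
        using Suc.prems True by (intro Suc.IH regular_clock_tl) (auto simp: ring_time_Suc_shift)
      finally show ?thesis using True
        unfolding marks_eq_insert[of c] by (auto simp: image_Un image_image case_prod_beta' image_iff algebra_simps)
    qed
  qed
qed

subsection \<open>Trajectories\<close>

lemma ising_path_0: "ising_path s0 w \<sigma> \<Longrightarrow> \<sigma> 0 = s0"
  by (simp add: ising_path_def)

lemma ising_path_const:
  assumes "ising_path s0 w \<sigma>" "0 \<le> s" "s \<le> t" "\<And>m. m \<in> marks (w x) \<Longrightarrow> \<not> (s < fst m \<and> fst m \<le> t)"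
  shows "\<sigma> t x = \<sigma> s x"
proof -
  have "\<forall>n. ring_time (w x) n \<notin> {s<..t}"
    using assms(4) unfolding marks_def by fastforce
  then show ?thesis using assms(1-3) unfolding ising_path_def by blast
qed

lemma ising_path_mark:
  assumes "ising_path s0 w \<sigma>" "(r, b) \<in> marks (w x)"
  shows "\<forall>\<^sub>F s in at_left r. \<sigma> r x = updated_spin (\<sigma> s) x b"
  using assms unfolding ising_path_def marks_def by (auto simp: image_iff)

lemma ising_path_mark_obtain:
  assumes "ising_path s0 w \<sigma>" "(r, b) \<in> marks (w x)" "a < r"
  obtains s where "a < s" "s < r" "\<sigma> r x = updated_spin (\<sigma> s) x b"
proof -
  have "\<forall>\<^sub>F s in at_left r. s \<in> {a<..<r}" using eventually_at_left_real[OF assms(3)] .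
  then have "\<forall>\<^sub>F s in at_left r. s \<in> {a<..<r} \<and> \<sigma> r x = updated_spin (\<sigma> s) x b"
    using ising_path_mark[OF assms(1,2)] by (rule eventually_conj)
  then obtain s where "s \<in> {a<..<r} \<and> \<sigma> r x = updated_spin (\<sigma> s) x b"
    using eventually_happens'[OF trivial_limit_at_left_real] by blast
  then show thesis using that by auto
qed

text \<open>No spin at \<open>x\<close> or its neighbours changes between \<open>s\<close> and the
  ring at \<open>r\<close>, so the left limit read by the update agrees there with the configuration
  at \<open>s\<close>; after \<open>r\<close> the spin at \<open>x\<close> rests until
  \<open>t\<close>.\<close>

lemma ising_path_single_mark:
  assumes "ising_path s0 w \<sigma>" "0 \<le> s" "s < r" "r \<le> t" "(r, b) \<in> marks (w x)"
    "\<And>m. m \<in> marks (w x) \<Longrightarrow> s < fst m \<Longrightarrow> fst m \<le> t \<Longrightarrow> fst m = r"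
    "\<And>y m. y \<in> nbrs x \<Longrightarrow> m \<in> marks (w y) \<Longrightarrow> \<not> (s < fst m \<and> fst m \<le> t)"
  shows "\<sigma> t x = updated_spin (\<sigma> s) x b"
proof -
  obtain u where u: "s < u" "u < r" "\<sigma> r x = updated_spin (\<sigma> u) x b"
    using ising_path_mark_obtain[OF assms(1,5,3)] by blast
  have "\<sigma> t x = \<sigma> r x"
    using assms(2-4,6) by (intro ising_path_const[OF assms(1)]) fastforce+
  also have "\<dots> = updated_spin (\<sigma> s) x b"
    unfolding u(3)
  proof (rule updated_spin_cong)
    show "\<sigma> u x = \<sigma> s x"
      using assms(2,4,6) u(1,2) by (intro ising_path_const[OF assms(1)]) fastforce+
    show "\<sigma> u y = \<sigma> s y" if "y \<in> nbrs x" for y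
      using assms(2,4) assms(7)[OF that] u(1,2) by (intro ising_path_const[OF assms(1)]) fastforce+
  qed
  finally show ?thesis .
qed

lemma last_mark:
  assumes "regular_clock c" "m \<in> marks c" "a < fst m" "fst m \<le> t"
  obtains r b where "(r, b) \<in> marks c" "a < r" "r \<le> t"
    "\<And>m. m \<in> marks c \<Longrightarrow> \<not> (r < fst m \<and> fst m \<le> t)"
proof -
  let ?S = "fst ` {m \<in> marks c. fst m \<le> t}"
  have fin: "finite ?S" using finite_marks[OF assms(1)] by simp
  have ne: "fst m \<in> ?S" using assms by auto
  have "Max ?S \<in> ?S" using fin ne by (intro Max_in) auto
  then obtain m' where m': "m' \<in> marks c" "fst m' \<le> t" "fst m' = Max ?S" by auto
  have "a < fst m'" using Max_ge[OF fin ne] assms(3) m'(3) by simp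
  moreover have "\<not> (fst m' < fst m'' \<and> fst m'' \<le> t)" if "m'' \<in> marks c" for m''
    using Max_ge[OF fin, of "fst m''"] that m'(3) by auto
  ultimately show thesis using m'(1,2) by (intro that[of "fst m'" "snd m'"]) auto
qed

text \<open>An update keeps or negates the spin whatever the neighbours do, so induction on the
  number of rings at \<open>x\<close> alone is enough.\<close>

lemma ising_path_spin_values:
  assumes "ising_path s0 w \<sigma>" "regular_clock (w x)" "s0 x \<in> {-1, 1}" "t \<ge> 0"
  shows "\<sigma> t x \<in> {-1, 1}"
  using assms(4)
proof (induction "card {m \<in> marks (w x). fst m \<le> t}" arbitrary: t rule: less_induct)
  case less
  show ?case
  proof (cases "\<exists>m\<in>marks (w x). 0 < fst m \<and> fst m \<le> t")
    case False
    then have "\<sigma> t x = \<sigma> 0 x" using less.prems by (intro ising_path_const[OF assms(1)]) auto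
    then show ?thesis using assms(3) ising_path_0[OF assms(1)] by simp
  next
    case True
    then obtain m where "m \<in> marks (w x)" "0 < fst m" "fst m \<le> t" by blast
    then obtain r b where r: "(r, b) \<in> marks (w x)" "0 < r" "r \<le> t"
      "\<And>m. m \<in> marks (w x) \<Longrightarrow> \<not> (r < fst m \<and> fst m \<le> t)"
      using last_mark[OF assms(2)] by metis
    obtain u where u: "0 < u" "u < r" "\<sigma> r x = updated_spin (\<sigma> u) x b"
      using ising_path_mark_obtain[OF assms(1) r(1,2)] by blast
    have "\<sigma> t x = \<sigma> r x" using r by (intro ising_path_const[OF assms(1)]) auto
    moreover have "{m \<in> marks (w x). fst m \<le> u} \<subset> {m \<in> marks (w x). fst m \<le> t}"
      using r(1,3) u by force
    then have "card {m \<in> marks (w x). fst m \<le> u} < card {m \<in> marks (w x). fst m \<le> t}"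
      by (rule psubset_card_mono[OF finite_marks[OF assms(2)]])
    then have "\<sigma> u x \<in> {-1, 1}" using less.hyps u(1) by simp
    ultimately show ?thesis using u(3) by (auto simp: updated_spin_def)
  qed
qed

lemma marks_up_to_eqD:
  "{m \<in> A. fst m \<le> T} = {m \<in> B. fst m \<le> T} \<Longrightarrow> fst m \<le> T \<Longrightarrow> m \<in> A \<longleftrightarrow> m \<in> B"
  by blast

section \<open>Pathwise uniqueness of trajectories\<close>

definition rung :: "('n::finite site \<Rightarrow> clock) \<Rightarrow> real \<Rightarrow> real \<Rightarrow> 'n site \<Rightarrow> bool" where
  "rung w a b x \<longleftrightarrow> (\<exists>m\<in>marks (w x). a < fst m \<and> fst m \<le> b)"

text \<open>Within the interval a spin changes only when its site rings. It then reads its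
  neighbours, and those that have not rung are still in the state they had at time \<open>a\<close>.
  Influence therefore travels only along edges both of whose ends ring.\<close>

definition ring_graph :: "('n::finite site \<Rightarrow> clock) \<Rightarrow> real \<Rightarrow> real \<Rightarrow> ('n site \<times> 'n site) set" where
  "ring_graph w a b = {(x, y). y \<in> nbrs x \<and> rung w a b x \<and> rung w a b y}"

text \<open>Harris's argument: the component of \<open>x\<close> in the ring graph is finite, and
  whatever its ringing sites read outside it rests at its value at time \<open>a\<close>. So only
  finitely many rings matter, and they can be treated in order of time.\<close>

lemma ising_path_unique_step:
  assumes path: "ising_path s0 w \<sigma>" "ising_path s0' w' \<sigma>'"
    and reg: "\<And>x. regular_clock (w x)"
    and eq: "\<And>x. {m \<in> marks (w x). fst m \<le> b} = {m \<in> marks (w' x). fst m \<le> b}"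
    and a: "0 \<le> a" "\<sigma> a = \<sigma>' a"
    and fin: "\<And>x. finite ((ring_graph w a b)\<^sup>* `` {x})"
    and s: "a \<le> s" "s \<le> b"
  shows "\<sigma> s = \<sigma>' s"
proof
  fix x
  have still: "\<sigma> s y = \<sigma> a y \<and> \<sigma>' s y = \<sigma> a y" if "\<forall>m\<in>marks (w y). \<not> (a < fst m \<and> fst m \<le> s)" "a \<le> s" "s \<le> b" for s y
  proof
    show "\<sigma> s y = \<sigma> a y" using that a by (intro ising_path_const[OF path(1)]) auto
    have "\<forall>m\<in>marks (w' y). \<not> (a < fst m \<and> fst m \<le> s)"
      using that marks_up_to_eqD[OF eq[of y]] by (meson order_trans)
    then show "\<sigma>' s y = \<sigma> a y" using that a by (subst a) (intro ising_path_const[OF path(2)], auto)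
  qed
  define K where "K = (ring_graph w a b)\<^sup>* `` {x}"
  \<comment> \<open>The rings in the component up to time \<open>s\<close>. Their number is the
    induction measure: the configuration read by the last ring before \<open>s\<close> belongs to an
    earlier time with fewer rings behind it.\<close>
  define F where "F s = (SIGMA y:K. {m \<in> marks (w y). fst m \<le> s})" for s
  have finF: "finite (F s)" for s
    unfolding F_def K_def using fin finite_marks[OF reg] by (intro finite_SigmaI) auto
  have "\<forall>y\<in>K. \<sigma> s y = \<sigma>' s y" using s
  proof (induction "card (F s)" arbitrary: s rule: less_induct)
    case less
    show ?case
    proof
      fix y assume y: "y \<in> K"
      show "\<sigma> s y = \<sigma>' s y"
      proof (cases "\<exists>m\<in>marks (w y). a < fst m \<and> fst m \<le> s")
        case False
        then show ?thesis using still[of y s] less.prems by auto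
      next
        case True
        then obtain m where "m \<in> marks (w y)" "a < fst m" "fst m \<le> s" by blast
        then obtain r c where r: "(r, c) \<in> marks (w y)" "a < r" "r \<le> s"
          "\<And>m. m \<in> marks (w y) \<Longrightarrow> \<not> (r < fst m \<and> fst m \<le> s)"
          using last_mark[OF reg[of y]] by metis
        have iff: "m \<in> marks (w y) \<longleftrightarrow> m \<in> marks (w' y)" if "fst m \<le> s" for m
          using marks_up_to_eqD[OF eq[of y]] that less.prems by auto
        have r': "(r, c) \<in> marks (w' y)" "\<And>m. m \<in> marks (w' y) \<Longrightarrow> \<not> (r < fst m \<and> fst m \<le> s)"
          using r iff by fastforce+
        have "\<forall>\<^sub>F u in at_left r. u \<in> {a<..<r}" using eventually_at_left_real[OF r(2)] .
        then have "\<forall>\<^sub>F u in at_left r. u \<in> {a<..<r} \<and> \<sigma> r y = updated_spin (\<sigma> u) y c \<and> \<sigma>' r y = updated_spin (\<sigma>' u) y c"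
          using ising_path_mark[OF path(1) r(1)] ising_path_mark[OF path(2) r'(1)]
          by (intro eventually_conj)
        then obtain u where u: "u \<in> {a<..<r} \<and> \<sigma> r y = updated_spin (\<sigma> u) y c \<and> \<sigma>' r y = updated_spin (\<sigma>' u) y c"
          using eventually_happens'[OF trivial_limit_at_left_real] by blast
        have "F u \<subset> F s" using y r(1,3) u by (force simp: F_def)
        then have "card (F u) < card (F s)" by (rule psubset_card_mono[OF finF])
        then have IH: "\<forall>y\<in>K. \<sigma> u y = \<sigma>' u y" using u r less.prems by (intro less.hyps) auto
        have "updated_spin (\<sigma> u) y c = updated_spin (\<sigma>' u) y c"
        proof (rule updated_spin_cong)
          fix z assume z: "z \<in> nbrs y"
          show "\<sigma> u z = \<sigma>' u z"
          proof (cases "rung w a b z")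
            case True
            moreover have "rung w a b y" using r less.prems by (auto simp: rung_def intro!: bexI[of _ "(r, c)"])
            ultimately have "(y, z) \<in> ring_graph w a b" using z by (simp add: ring_graph_def)
            then have "z \<in> K" using y by (auto simp: K_def intro: rtrancl_into_rtrancl)
            then show ?thesis using IH by simp
          next
            case False
            have "u \<le> b" "a \<le> u" using u r less.prems by auto
            then have "\<forall>m\<in>marks (w z). \<not> (a < fst m \<and> fst m \<le> u)"
              using False unfolding rung_def by fastforce
            then show ?thesis using still[of z u] \<open>u \<le> b\<close> \<open>a \<le> u\<close> by simp
          qed
        qed (use IH y in auto)
        moreover have "\<sigma> s y = \<sigma> r y" using r a by (intro ising_path_const[OF path(1)]) auto
        moreover have "\<sigma>' s y = \<sigma>' r y" using r r' a by (intro ising_path_const[OF path(2)]) auto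
        ultimately show ?thesis using u by simp
      qed
    qed
  qed
  then show "\<sigma> s x = \<sigma>' s x" by (simp add: K_def)
qed

text \<open>One step length \<open>\<delta>\<close> must serve all intervals and all sites at once,
  so that uniqueness can be iterated along the whole time axis.\<close>

definition good_clocks :: "('n::finite site \<Rightarrow> clock) \<Rightarrow> bool" where
  "good_clocks w \<longleftrightarrow> (\<forall>x. regular_clock (w x)) \<and>
     (\<exists>\<delta>>0. \<forall>k x. finite ((ring_graph w (real k * \<delta>) (real (Suc k) * \<delta>))\<^sup>* `` {x}))"

lemma ising_path_unique:
  assumes path: "ising_path s0 w \<sigma>" "ising_path s0 w' \<sigma>'"
    and good: "good_clocks w"
    and eq: "\<And>x. {m \<in> marks (w x). fst m \<le> T} = {m \<in> marks (w' x). fst m \<le> T}"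
    and s: "0 \<le> s" "s \<le> T"
  shows "\<sigma> s = \<sigma>' s"
proof -
  obtain \<delta> where \<delta>: "\<delta> > 0" "\<And>k x. finite ((ring_graph w (real k * \<delta>) (real (Suc k) * \<delta>))\<^sup>* `` {x})"
    using good unfolding good_clocks_def by blast
  have reg: "regular_clock (w x)" for x using good by (simp add: good_clocks_def)
  have "\<forall>s. 0 \<le> s \<and> s \<le> min T (real k * \<delta>) \<longrightarrow> \<sigma> s = \<sigma>' s" for k
  proof (induction k)
    case 0
    show ?case
    proof (intro allI impI)
      fix s assume "0 \<le> s \<and> s \<le> min T (real 0 * \<delta>)"
      then have "s = 0" by simp
      then show "\<sigma> s = \<sigma>' s" using ising_path_0[OF path(1)] ising_path_0[OF path(2)] by simp
    qed
  next
    case (Suc k)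
    show ?case
    proof (intro allI impI)
      fix s assume s: "0 \<le> s \<and> s \<le> min T (real (Suc k) * \<delta>)"
      show "\<sigma> s = \<sigma>' s"
      proof (cases "s \<le> real k * \<delta>")
        case True
        then show ?thesis using Suc s by auto
      next
        case False
        show ?thesis
        proof (rule ising_path_unique_step[OF path reg])
          show "{m \<in> marks (w x). fst m \<le> s} = {m \<in> marks (w' x). fst m \<le> s}" for x
            using marks_up_to_eqD[OF eq[of x]] s by (auto dest: order_trans)
          show "0 \<le> real k * \<delta>" using \<delta> by simp
          then show "\<sigma> (real k * \<delta>) = \<sigma>' (real k * \<delta>)" using Suc s False by auto
          show "real k * \<delta> \<le> s" "s \<le> s" using False by auto
          fix x
          \<comment> \<open>The last interval is cut at \<open>s\<close>; a shorter interval has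
            fewer rings and hence a smaller ring graph.\<close>
          have "ring_graph w (real k * \<delta>) s \<subseteq> ring_graph w (real k * \<delta>) (real (Suc k) * \<delta>)"
            using s by (force simp: ring_graph_def rung_def)
          then have "(ring_graph w (real k * \<delta>) s)\<^sup>* \<subseteq> (ring_graph w (real k * \<delta>) (real (Suc k) * \<delta>))\<^sup>*"
            by (rule rtrancl_mono)
          then show "finite ((ring_graph w (real k * \<delta>) s)\<^sup>* `` {x})"
            using \<delta>(2)[of k x] by (meson Image_mono finite_subset subset_refl)
        qed
      qed
    qed
  qed
  moreover obtain k :: nat where "s / \<delta> \<le> real k" using real_arch_simple by blast
  then have "s \<le> real k * \<delta>" using \<delta> by (simp add: field_simps)
  ultimately show ?thesis using s by auto
qed

lemma Collect_in_sets: "space M = UNIV \<Longrightarrow> Measurable.pred M P \<Longrightarrow> {x. P x} \<in> sets M"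
  by (simp add: pred_def)

subsection \<open>Almost sure properties of the clocks\<close>

text \<open>A block of \<open>n\<close> waiting times all at most 1 has probability (1 - exp
  (-1))^n, so infinitely many waiting times exceed 1 almost surely. Bounded ring times would make
  the waiting times summable and thus tend to 0.\<close>

lemma AE_regular_clock: "AE c in clock_law. regular_clock c"
proof -
  have pos: "AE c in clock_law. fst (c n) > 0" for n
  proof -
    have "AE x in step_law. fst x > 0"
      using step_law_gt(2)[of 0]
      by (intro AE_I[of _ _ "{x. fst x \<le> 0}"]) (auto simp: sets_step_law_half_space)
    then show ?thesis unfolding clock_law_eq by (intro clock.AE_component) auto
  qed
  have late: "AE c in clock_law. \<exists>k\<ge>m. fst (c k) > 1" for m
  proof -
    let ?A = "\<lambda>n. {c. \<forall>k\<in>{m..<m + n}. c k \<in> {x. fst x \<le> 1}}"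
    have em: "emeasure clock_law (?A n) = ennreal ((1 - exp (-1)) ^ n)" for n
    proof -
      have "emeasure clock_law (?A n) = (\<Prod>k\<in>{m..<m + n}. emeasure step_law {x. fst x \<le> 1})"
        using clock.emeasure_PiM_Collect[of "{m..<m + n}" "\<lambda>_. {x. fst x \<le> 1}"]
        by (simp add: clock_law_eq[symmetric] space_PiM sets_step_law_half_space)
      then show ?thesis by (simp add: step_law_gt ennreal_power)
    qed
    have Am: "?A n \<in> sets clock_law" for n
      unfolding mem_Collect_eq by (rule Collect_in_sets) measurable
    let ?B = "{c. \<forall>k\<ge>m. fst (c k) \<le> 1}"
    have B: "?B = (\<Inter>n. ?A n)"
      by (auto, metis add_diff_inverse_nat lessI less_diff_conv2 linorder_not_le add.commute add_Suc_right atLeastLessThan_iff)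
    have "emeasure clock_law ?B \<le> ennreal ((1 - exp (-1)) ^ n)" for n
      unfolding em[symmetric] using Am by (intro emeasure_mono) auto
    moreover have "(\<lambda>n. ennreal ((1 - exp (-1)) ^ n)) \<longlonglongrightarrow> ennreal 0"
      by (intro tendsto_ennrealI LIMSEQ_power_zero) auto
    ultimately have "emeasure clock_law ?B \<le> 0"
      using LIMSEQ_le_const[of "\<lambda>n. ennreal ((1 - exp (-1)) ^ n)" "ennreal 0"] by auto
    moreover have "?B \<in> sets clock_law" unfolding B using Am by (intro sets.countable_INT) auto
    ultimately show ?thesis by (intro AE_I[of _ _ ?B]) (auto simp: not_less)
  qed
  have "AE c in clock_law. (\<forall>n. fst (c n) > 0) \<and> (\<forall>m. \<exists>k\<ge>m. fst (c k) > 1)"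
    using pos late by (simp add: AE_all_countable)
  then show ?thesis
  proof eventually_elim
    case (elim c)
    have "\<exists>n. ring_time c n > t" for t
    proof (rule ccontr)
      assume "\<not> (\<exists>n. ring_time c n > t)"
      then have "summable (\<lambda>n. fst (c n))"
        using elim by (intro bounded_imp_summable[of _ t]) (auto simp: ring_time_def not_less less_imp_le)
      then have "(\<lambda>n. fst (c n)) \<longlonglongrightarrow> 0" by (rule summable_LIMSEQ_zero)
      then have "\<forall>\<^sub>F n in sequentially. fst (c n) < 1" by (rule order_tendstoD) simp
      then obtain N where "\<forall>n\<ge>N. fst (c n) < 1" by (auto simp: eventually_sequentially)
      then show False using elim by (metis less_asym)
    qed
    then show ?case using elim by (simp add: regular_clock_def)
  qed
qed

lemma sets_mark_between[measurable]:
  "{c. \<exists>m\<in>marks c. a < fst m \<and> fst m \<le> b} \<in> sets clock_law"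
proof -
  have "{c. \<exists>n. a < ring_time c n \<and> ring_time c n \<le> b} \<in> sets clock_law"
    by (rule Collect_in_sets) measurable
  then show ?thesis by (simp add: marks_def)
qed

lemma first_mark_le:
  assumes "regular_clock c" "m \<in> marks c"
  shows "fst (c 0) \<le> fst m"
proof -
  obtain n where "fst m = ring_time c n" using assms(2) by (auto simp: marks_def)
  moreover have "ring_time c 0 \<le> ring_time c n"
    using strict_mono_less_eq[OF regular_ring_time_strict_mono[OF assms(1)], of 0 n] by simp
  ultimately show ?thesis by (simp add: ring_time_def)
qed

lemma emeasure_step_component:
  assumes "A \<in> sets step_law"
  shows "emeasure clock_law {c. c n \<in> A} = emeasure step_law A"
  using clock.emeasure_PiM_Collect_single[of n A] assms by (simp add: clock_law_eq[symmetric])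

lemma AE_pair_fst: 
  assumes "prob_space N" "AE x in M. P x"
  shows "AE p in M \<Otimes>\<^sub>M N. P (fst p)"
proof -
  have "AE x in distr (M \<Otimes>\<^sub>M N) M fst. P x"
    by (subst prob_space.distr_pair_fst[OF assms(1)]) (rule assms(2))
  then show ?thesis by (rule AE_distrD[OF measurable_fst])
qed

lemma AE_pair_snd: 
  assumes "prob_space M" "prob_space N" "AE x in N. P x"
  shows "AE p in M \<Otimes>\<^sub>M N. P (snd p)"
proof -
  interpret M: prob_space M by fact
  interpret N: prob_space N by fact
  interpret NM: pair_prob_space N M ..
  have "AE p in N \<Otimes>\<^sub>M M. P (fst p)" by (rule AE_pair_fst[OF assms(1,3)])
  then have "AE p in distr (M \<Otimes>\<^sub>M N) (N \<Otimes>\<^sub>M M) (\<lambda>(x, y). (y, x)). P (fst p)"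
    by (subst NM.distr_pair_swap[symmetric])
  from AE_distrD[OF measurable_pair_swap' this] show ?thesis by (simp add: case_prod_beta')
qed

text \<open>Restarting the clock at \<open>a\<close> keeps its law, and a ring in the window must
  come from the restarted clock, whose first waiting time is then at most \<open>\<delta>\<close>.
  This has probability 1 - exp (- \<delta>), which is at most \<delta>.\<close>

lemma emeasure_mark_between:
  assumes "a \<ge> 0" "\<delta> \<ge> 0"
  shows "emeasure clock_law {c. \<exists>m\<in>marks c. a < fst m \<and> fst m \<le> a + \<delta>} \<le> ennreal \<delta>"
proof -
  let ?E = "{c. \<exists>m\<in>marks c. a < fst m \<and> fst m \<le> a + \<delta>}"
  let ?S = "\<lambda>p. splice_clock a (fst p) (snd p)"
  have S[measurable]: "?S \<in> measurable (clock_law \<Otimes>\<^sub>M clock_law) clock_law" by measurable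
  let ?F = "{c. c 0 \<in> {x. fst x \<le> \<delta>}}"
  have F: "?F \<in> sets clock_law"
    unfolding mem_Collect_eq by (rule Collect_in_sets) measurable
  have "emeasure clock_law ?E = emeasure (distr (clock_law \<Otimes>\<^sub>M clock_law) clock_law ?S) ?E"
    using distr_splice_clock[OF assms(1)] by (simp add: case_prod_beta')
  also have "\<dots> = emeasure (clock_law \<Otimes>\<^sub>M clock_law) (?S -` ?E \<inter> space (clock_law \<Otimes>\<^sub>M clock_law))"
    by (rule emeasure_distr) measurable
  also have "\<dots> \<le> emeasure (clock_law \<Otimes>\<^sub>M clock_law) (snd -` ?F \<inter> space (clock_law \<Otimes>\<^sub>M clock_law))"
  proof (rule emeasure_mono_AE)
    have "AE p in clock_law \<Otimes>\<^sub>M clock_law. regular_clock (fst p)"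
      "AE p in clock_law \<Otimes>\<^sub>M clock_law. regular_clock (snd p)"
      by (intro AE_pair_fst AE_pair_snd AE_regular_clock clock_law.prob_space_axioms)+
    then show "AE p in clock_law \<Otimes>\<^sub>M clock_law. p \<in> ?S -` ?E \<inter> space (clock_law \<Otimes>\<^sub>M clock_law)
      \<longrightarrow> p \<in> snd -` ?F \<inter> space (clock_law \<Otimes>\<^sub>M clock_law)"
    proof eventually_elim
      case (elim p)
      show ?case
      proof
        assume "p \<in> ?S -` ?E \<inter> space (clock_law \<Otimes>\<^sub>M clock_law)"
        then obtain m where "m \<in> marks (?S p)" "a < fst m" "fst m \<le> a + \<delta>" by auto
        then obtain m' where "m' \<in> marks (snd p)" "fst m' \<le> \<delta>"
          using marks_splice[OF elim(1) assms(1)] by auto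
        then have "fst (snd p 0) \<le> \<delta>" using first_mark_le[OF elim(2)] by fastforce
        then show "p \<in> snd -` ?F \<inter> space (clock_law \<Otimes>\<^sub>M clock_law)" by (simp add: space_pair_measure)
      qed
    qed
    show "snd -` ?F \<inter> space (clock_law \<Otimes>\<^sub>M clock_law) \<in> sets (clock_law \<Otimes>\<^sub>M clock_law)"
      using F by (intro measurable_sets[OF measurable_snd])
  qed
  also have "snd -` ?F \<inter> space (clock_law \<Otimes>\<^sub>M clock_law) = UNIV \<times> ?F"
    by (auto simp: space_pair_measure)
  also have "emeasure (clock_law \<Otimes>\<^sub>M clock_law) (UNIV \<times> ?F) = emeasure clock_law ?F"
    using F sets.top[of clock_law] by (subst clock_law.emeasure_pair_measure_Times) auto
  also have "\<dots> = ennreal (1 - exp (- \<delta>))"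
    using assms by (subst emeasure_step_component) (auto simp: step_law_gt sets_step_law_half_space)
  also have "\<dots> \<le> ennreal \<delta>"
    using exp_ge_add_one_self[of "- \<delta>"] by (intro ennreal_leI) simp
  finally show ?thesis .
qed

text \<open>A list holds the starting points of \<open>n\<close> consecutive steps; the final end
  point is not recorded, so the list has exactly \<open>n\<close> entries.\<close>

primrec walks :: "nat \<Rightarrow> ('n::finite) site \<Rightarrow> 'n site list set" where
  "walks 0 x = {[]}"
| "walks (Suc n) x = (\<Union>y\<in>nbrs x. (#) x ` walks n y)"

lemma finite_walks: "finite (walks n x)"
  by (induction n arbitrary: x) auto

lemma card_walks: "card (walks n (x :: 'n::finite site)) \<le> (2 * CARD('n)) ^ n"
proof (induction n arbitrary: x)
  case (Suc n)
  have "card (walks (Suc n) x) \<le> (\<Sum>y\<in>nbrs x. card ((#) x ` walks n y))"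
    by (simp add: card_UN_le)
  also have "\<dots> \<le> (\<Sum>y\<in>nbrs x. (2 * CARD('n)) ^ n)"
    using Suc by (intro sum_mono) (meson card_image_le finite_walks order_trans)
  finally show ?case by (simp add: card_nbrs)
qed simp

lemma length_walks: "p \<in> walks n x \<Longrightarrow> length p = n"
  by (induction n arbitrary: x p) auto

lemma map_in_walks: "(\<And>i. i < n \<Longrightarrow> f (Suc i) \<in> nbrs (f i)) \<Longrightarrow> map f [0..<n] \<in> walks n (f 0)"
proof (induction n arbitrary: f)
  case (Suc n)
  have "map f [0..<Suc n] = f 0 # map (\<lambda>i. f (Suc i)) [0..<n]"
    by (simp add: map_upt_Suc del: upt_Suc)
  moreover have "map (\<lambda>i. f (Suc i)) [0..<n] \<in> walks n (f (Suc 0))"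
    using Suc.prems by (intro Suc.IH) auto
  ultimately show ?case using Suc.prems[of 0] by auto
qed simp

text \<open>A shortest path to a far away point is self-avoiding.\<close>

lemma infinite_reachable_imp_walk:
  fixes x :: "'n::finite site"
  assumes R: "\<And>x y. (x, y) \<in> R \<Longrightarrow> y \<in> nbrs x" and inf: "infinite (R\<^sup>* `` {x})"
  obtains p where "p \<in> walks n x" "distinct p" "set p \<subseteq> Domain R"
proof -
  have fin: "finite {y. (x, y) \<in> R ^^ i}" for i
  proof (induction i)
    case (Suc i)
    have "{y. (x, y) \<in> R ^^ Suc i} \<subseteq> (\<Union>z\<in>{y. (x, y) \<in> R ^^ i}. nbrs z)"
      using R by auto
    then show ?case by (rule finite_subset) (use Suc in auto)
  qed simp
  \<comment> \<open>Fewer than \<open>n\<close> steps reach only finitely many sites, so an infinite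
    component contains a site at distance at least \<open>n\<close>.\<close>
  have "finite (\<Union>i<n. {y. (x, y) \<in> R ^^ i})" using fin by blast
  then obtain y where y: "(x, y) \<in> R\<^sup>*" "y \<notin> (\<Union>i<n. {y. (x, y) \<in> R ^^ i})"
    using inf by (metis Image_singleton_iff finite_subset subsetI)
  define m where "m = (LEAST m. (x, y) \<in> R ^^ m)"
  have m: "(x, y) \<in> R ^^ m"
    using y(1) unfolding m_def rtrancl_power by (rule LeastI_ex)
  have min: "(x, y) \<notin> R ^^ k" if "k < m" for k
    using that not_less_Least unfolding m_def by blast
  have nm: "n \<le> m" using m y(2) by (meson UN_I lessThan_iff mem_Collect_eq not_le)
  obtain f where f: "f 0 = x" "f m = y" "\<And>i. i < m \<Longrightarrow> (f i, f (Suc i)) \<in> R"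
    using m unfolding relpow_fun_conv by blast
  have neq: "f i \<noteq> f j" if "i < j" "j \<le> m" for i j
  proof
    assume eq: "f i = f j"
    have "(x, f i) \<in> R ^^ i" using f that unfolding relpow_fun_conv by (intro exI[of _ f]) auto
    moreover have "(f i, y) \<in> R ^^ (m - j)"
      unfolding relpow_fun_conv using f that eq by (intro exI[of _ "\<lambda>k. f (j + k)"]) auto
    ultimately have "(x, y) \<in> R ^^ (i + (m - j))" by (auto simp: relpow_add)
    moreover have "i + (m - j) < m" using that by arith
    ultimately show False using min by blast
  qed
  have "inj_on f {0..<n}"
    using neq nm by (intro inj_onI) (metis atLeastLessThan_iff less_imp_le_nat linorder_neqE_nat order_trans)
  then have "distinct (map f [0..<n])" by (simp add: distinct_map)
  moreover have "map f [0..<n] \<in> walks n x"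
    using map_in_walks[of n f] f nm R by auto
  moreover have "set (map f [0..<n]) \<subseteq> Domain R"
  proof
    fix z assume "z \<in> set (map f [0..<n])"
    then obtain i where "i < n" "z = f i" by auto
    then show "z \<in> Domain R" using f(3)[of i] nm by (simp add: Domain.DomainI)
  qed
  ultimately show thesis using that by blast
qed

text \<open>First-moment bound: an infinite component yields, for every \<open>n\<close>, a
  self-avoiding walk of \<open>n\<close> sites that all ring. There are at most (2d)^n such walks,
  each with probability at most \<delta>^n, and \<delta> = 1/(4d) makes the product 2^(-n).\<close>

lemma AE_finite_ring_cluster:
  fixes x :: "'n::finite site"
  assumes "a \<ge> 0"
  defines "\<delta> \<equiv> 1 / (4 * real CARD('n))"
  shows "AE w in dyn_law. finite ((ring_graph w a (a + \<delta>))\<^sup>* `` {x})"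
proof -
  let ?X = "{c. \<exists>m\<in>marks c. a < fst m \<and> fst m \<le> a + \<delta>}"
  let ?A = "\<lambda>p. {w :: 'n site \<Rightarrow> clock. \<forall>z\<in>set p. w z \<in> ?X}"
  define B where "B n = (\<Union>p\<in>{p \<in> walks n x. distinct p}. ?A p)" for n
  have d: "\<delta> \<ge> 0" by (simp add: \<delta>_def)
  have A: "?A p \<in> sets dyn_law" for p
  proof (rule Collect_in_sets)
    have [measurable]: "?X \<in> sets clock_law" by (rule sets_mark_between)
    show "Measurable.pred dyn_law (\<lambda>w. \<forall>z\<in>set p. w z \<in> ?X)"
      by (intro pred_intros_finite(3) pred_sets2[OF _ measurable_dyn_component]) (auto simp: sets_mark_between)
  qed simp
  have mA: "emeasure dyn_law (?A p) \<le> ennreal (\<delta> ^ n)" if "p \<in> walks n x" "distinct p" for p n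
  proof -
    have "emeasure dyn_law (?A p) = (\<Prod>z\<in>set p. emeasure clock_law ?X)"
      using dyn.emeasure_PiM_Collect[of "set p" "\<lambda>_. ?X"]
      by (simp add: dyn_law_def[symmetric] sets_mark_between)
    also have "\<dots> \<le> (\<Prod>z\<in>set p. ennreal \<delta>)"
      using emeasure_mark_between[OF assms(1) d] by (intro prod_mono_ennreal) auto
    also have "\<dots> = ennreal (\<delta> ^ n)"
      using length_walks[OF that(1)] distinct_card[OF that(2)] d by (simp add: ennreal_power)
    finally show ?thesis .
  qed
  have fin: "finite {p \<in> walks n x. distinct p}" for n
    by (rule finite_subset[OF _ finite_walks[of n x]]) auto
  have "emeasure dyn_law (B n) \<le> ennreal ((1/2) ^ n)" for n
  proof -
    have "emeasure dyn_law (B n) \<le> (\<Sum>p\<in>{p \<in> walks n x. distinct p}. emeasure dyn_law (?A p))"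
      unfolding B_def using A fin by (intro emeasure_subadditive_finite) auto
    also have "\<dots> \<le> (\<Sum>p\<in>{p \<in> walks n x. distinct p}. ennreal (\<delta> ^ n))"
      using mA by (intro sum_mono) auto
    also have "\<dots> = ennreal (real (card {p \<in> walks n x. distinct p}) * \<delta> ^ n)"
      using d by (simp add: ennreal_mult ennreal_of_nat_eq_real_of_nat)
    also have "\<dots> \<le> ennreal (real ((2 * CARD('n)) ^ n) * \<delta> ^ n)"
    proof -
      have "card {p \<in> walks n x. distinct p} \<le> (2 * CARD('n)) ^ n"
        using card_mono[of "walks n x" "{p \<in> walks n x. distinct p}"] finite_walks[of n x] card_walks[of n x] by auto
      then show ?thesis using d by (intro ennreal_leI mult_right_mono) (auto simp only: of_nat_le_iff zero_le_power)
    qed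
    also have "real ((2 * CARD('n)) ^ n) * \<delta> ^ n = (1/2) ^ n"
    proof -
      have "real ((2 * CARD('n)) ^ n) * \<delta> ^ n = (real (2 * CARD('n)) * \<delta>) ^ n"
        by (simp add: power_mult_distrib)
      moreover have "real (2 * CARD('n)) * \<delta> = 1 / 2" by (simp add: \<delta>_def)
      ultimately show ?thesis by presburger
    qed
    finally show ?thesis .
  qed
  moreover have B: "B n \<in> sets dyn_law" for n
    unfolding B_def by (rule sets.finite_UN[OF fin A])
  moreover have "(\<Inter>n. B n) \<subseteq> B n" for n by blast
  ultimately have "emeasure dyn_law (\<Inter>n. B n) \<le> ennreal ((1/2) ^ n)" for n
    by (meson emeasure_mono order_trans)
  moreover have "(\<lambda>n. ennreal ((1/2) ^ n)) \<longlonglongrightarrow> ennreal 0"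
    by (intro tendsto_ennrealI LIMSEQ_power_zero) auto
  ultimately have 0: "emeasure dyn_law (\<Inter>n. B n) \<le> 0"
    using LIMSEQ_le_const[of "\<lambda>n. ennreal ((1/2) ^ n)" "ennreal 0"] by auto
  show ?thesis
  proof (rule AE_I[of _ _ "\<Inter>n. B n"])
    show "{w \<in> space dyn_law. \<not> finite ((ring_graph w a (a + \<delta>))\<^sup>* `` {x})} \<subseteq> (\<Inter>n. B n)"
    proof (intro subsetI INT_I)
      fix w n
      assume "w \<in> {w \<in> space dyn_law. \<not> finite ((ring_graph w a (a + \<delta>))\<^sup>* `` {x})}"
      then have "infinite ((ring_graph w a (a + \<delta>))\<^sup>* `` {x})" by simp
      then obtain p where p: "p \<in> walks n x" "distinct p" "set p \<subseteq> Domain (ring_graph w a (a + \<delta>))"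
        by (rule infinite_reachable_imp_walk[rotated]) (auto simp: ring_graph_def)
      have "Domain (ring_graph w a (a + \<delta>)) \<subseteq> {z. rung w a (a + \<delta>) z}"
        by (auto simp: ring_graph_def)
      with p(3) have "set p \<subseteq> {z. rung w a (a + \<delta>) z}" by (rule subset_trans)
      then have "w \<in> ?A p" unfolding rung_def by blast
      then show "w \<in> B n" using p(1,2) unfolding B_def by blast
    qed
    show "(\<Inter>n. B n) \<in> sets dyn_law"
      using B by (intro sets.countable_INT) auto
    show "emeasure dyn_law (\<Inter>n. B n) = 0"
      using 0 by (simp only: le_zero_eq)
  qed
qed

lemma AE_good_clocks: "AE w in dyn_law. good_clocks (w :: 'n::finite site \<Rightarrow> clock)"
proof -
  let ?d = "1 / (4 * real CARD('n))"
  have "AE w in dyn_law. regular_clock (w (x :: 'n site))" for x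
    unfolding dyn_law_def by (intro dyn.AE_component AE_regular_clock) simp
  then have "AE w in dyn_law. \<forall>x :: 'n site. regular_clock (w x)" by (simp add: AE_all_countable)
  moreover have "AE w in dyn_law. \<forall>(k::nat) (x :: 'n site). finite ((ring_graph w (real k * ?d) (real k * ?d + ?d))\<^sup>* `` {x})"
    unfolding AE_all_countable by (intro allI AE_finite_ring_cluster) simp
  ultimately show ?thesis
  proof eventually_elim
    case (elim w)
    then show ?case unfolding good_clocks_def by (intro conjI exI[of _ ?d]) (auto simp: algebra_simps add_divide_distrib)
  qed
qed

subsection \<open>Resampling the future and translations\<close>

interpretation initial_law: prob_space "initial_law :: ('n::finite) config measure"
  unfolding initial_law_def
  by (rule prob_space_PiM, rule prob_space_uniform_count_measure) simp_all

interpretation ising_law: prob_space "ising_law :: ('n::finite config \<times> ('n site \<Rightarrow> clock)) measure"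
  by (rule prob_space_ising_law)

lemma sets_ising_law[measurable_cong]: "sets ising_law = sets (initial_law \<Otimes>\<^sub>M dyn_law)"
  by (simp add: ising_law_def)

lemma measurable_splice_dyn:
  "(\<lambda>p x. splice_clock t (fst p x) (snd p x)) \<in> measurable (dyn_law \<Otimes>\<^sub>M dyn_law) dyn_law"
proof -
  have *: "(\<lambda>p. splice_clock t (fst p x) (snd p x)) \<in> measurable (dyn_law \<Otimes>\<^sub>M dyn_law) clock_law" for x :: "'n::finite site"
  proof -
  have "(\<lambda>p. fst p x) \<in> measurable (dyn_law \<Otimes>\<^sub>M dyn_law) clock_law"
    "(\<lambda>p. snd p x) \<in> measurable (dyn_law \<Otimes>\<^sub>M dyn_law) clock_law"
    by (auto intro: measurable_compose[OF measurable_fst measurable_dyn_component]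
        measurable_compose[OF measurable_snd measurable_dyn_component])
  then show ?thesis by (intro measurable_splice) auto
  qed
  show ?thesis
    by (subst (3) dyn_law_def, rule measurable_PiM_single') (use * in auto)
qed

text \<open>The indicator of a finite cylinder factors over the sites, so integrating over the two
  families of clocks reduces the claim site by site to \<open>distr_splice_clock\<close>.\<close>

lemma distr_splice_dyn:
  assumes "t \<ge> 0"
  shows "distr (dyn_law \<Otimes>\<^sub>M dyn_law) dyn_law (\<lambda>p (x :: 'n::finite site). splice_clock t (fst p x) (snd p x)) = dyn_law"
    (is "distr _ _ ?S = _")
proof -
  have S: "?S \<in> measurable (dyn_law \<Otimes>\<^sub>M dyn_law) dyn_law" by (rule measurable_splice_dyn)
  have "distr (dyn_law \<Otimes>\<^sub>M dyn_law) dyn_law ?S = PiM UNIV (\<lambda>_. clock_law)"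
  proof (rule dyn.PiM_eq)
    show "sets (distr (dyn_law \<Otimes>\<^sub>M dyn_law) dyn_law ?S) = sets (PiM UNIV (\<lambda>_. clock_law))"
      by (simp add: dyn_law_def)
    fix J :: "'n site set" and F assume J: "finite J" and F: "\<And>j. j \<in> J \<Longrightarrow> F j \<in> sets clock_law"
    let ?E = "prod_emb UNIV (\<lambda>_. clock_law) J (Pi\<^sub>E J F)"
    have Em: "?E \<in> sets dyn_law"
      unfolding dyn_law_def using J F by (intro sets_PiM_I) auto
    have i: "indicator ?E w = (\<Prod>x\<in>J. indicator (F x) (w x) :: ennreal)" for w
      using J by (induction J rule: finite_induct) (auto simp: indicator_def prod_emb_def space_PiM)
    have m2: "(\<lambda>c'. indicator (F x) (splice_clock t c c') :: ennreal) \<in> borel_measurable clock_law" if "x \<in> J" for x c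
      using F[OF that] by (intro measurable_compose[OF _ borel_measurable_indicator] measurable_splice) auto
    have m1: "(\<lambda>c. \<integral>\<^sup>+c'. indicator (F x) (splice_clock t c c') \<partial>clock_law) \<in> borel_measurable clock_law" if "x \<in> J" for x
    proof (rule clock_law.borel_measurable_nn_integral)
      show "(\<lambda>(c, c'). indicator (F x) (splice_clock t c c') :: ennreal) \<in> borel_measurable (clock_law \<Otimes>\<^sub>M clock_law)"
        unfolding case_prod_beta'
        using F[OF that] by (intro measurable_compose[OF _ borel_measurable_indicator] measurable_splice) auto
    qed
    have "emeasure (distr (dyn_law \<Otimes>\<^sub>M dyn_law) dyn_law ?S) ?E
      = (\<integral>\<^sup>+p. indicator ?E (?S p) \<partial>(dyn_law \<Otimes>\<^sub>M dyn_law))"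
      using Em S by (subst nn_integral_indicator[symmetric], simp, subst nn_integral_distr) auto
    also have "\<dots> = (\<integral>\<^sup>+w. \<integral>\<^sup>+w'. indicator ?E (?S (w, w')) \<partial>dyn_law \<partial>dyn_law)"
      by (rule dyn_law.nn_integral_fst[symmetric])
        (rule measurable_compose[OF S borel_measurable_indicator[OF Em]])
    also have "\<dots> = (\<integral>\<^sup>+w. (\<Prod>x\<in>J. \<integral>\<^sup>+c'. indicator (F x) (splice_clock t (w x) c') \<partial>clock_law) \<partial>dyn_law)"
      unfolding i dyn_law_def fst_conv snd_conv using J m2
      by (intro nn_integral_cong nn_integral_PiM_prod clock_law.prob_space_axioms) auto
    also have "\<dots> = (\<Prod>x\<in>J. \<integral>\<^sup>+c. \<integral>\<^sup>+c'. indicator (F x) (splice_clock t c c') \<partial>clock_law \<partial>clock_law)"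
      unfolding dyn_law_def using J m1
      by (intro nn_integral_PiM_prod clock_law.prob_space_axioms) auto
    also have "\<dots> = (\<Prod>x\<in>J. emeasure clock_law (F x))"
    proof (rule prod.cong)
      fix x assume x: "x \<in> J"
      have "(\<integral>\<^sup>+c. \<integral>\<^sup>+c'. indicator (F x) (splice_clock t c c') \<partial>clock_law \<partial>clock_law)
        = (\<integral>\<^sup>+p. indicator (F x) (splice_clock t (fst p) (snd p)) \<partial>(clock_law \<Otimes>\<^sub>M clock_law))"
        using F[OF x] by (subst clock_law.nn_integral_fst[symmetric])
          (auto intro!: measurable_compose[OF _ borel_measurable_indicator] measurable_splice)
      also have "\<dots> = (\<integral>\<^sup>+c. indicator (F x) c \<partial>distr (clock_law \<Otimes>\<^sub>M clock_law) clock_law (\<lambda>p. splice_clock t (fst p) (snd p)))"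
        using F[OF x] by (subst nn_integral_distr) (auto intro!: borel_measurable_indicator measurable_splice)
      also have "\<dots> = emeasure clock_law (F x)"
        using F[OF x] distr_splice_clock[OF assms] by (simp add: case_prod_beta')
      finally show "(\<integral>\<^sup>+c. \<integral>\<^sup>+c'. indicator (F x) (splice_clock t c c') \<partial>clock_law \<partial>clock_law) = emeasure clock_law (F x)" .
    qed simp
    finally show "emeasure (distr (dyn_law \<Otimes>\<^sub>M dyn_law) dyn_law ?S) ?E = (\<Prod>x\<in>J. emeasure clock_law (F x))" .
  qed
  then show ?thesis by (simp add: dyn_law_def)
qed

definition resample :: "real \<Rightarrow> ('n::finite config \<times> ('n site \<Rightarrow> clock)) \<times> ('n site \<Rightarrow> clock) \<Rightarrow> 'n config \<times> ('n site \<Rightarrow> clock)" where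
  "resample t p = (fst (fst p), \<lambda>x. splice_clock t (snd (fst p) x) (snd p x))"

lemma measurable_resample: "resample t \<in> measurable (ising_law \<Otimes>\<^sub>M dyn_law) ising_law"
proof -
  have "(\<lambda>p. (\<lambda>q x. splice_clock t (fst q x) (snd q x)) (snd (fst p), snd p)) 
      \<in> measurable ((initial_law \<Otimes>\<^sub>M dyn_law) \<Otimes>\<^sub>M dyn_law) dyn_law"
    by (rule measurable_compose[OF _ measurable_splice_dyn]) simp
  then show ?thesis
    unfolding resample_def ising_law_def by (intro measurable_Pair) simp_all
qed

text \<open>The initial configuration is left alone, so for each fixed one the claim is the
  corresponding one for the clocks.\<close>

lemma distr_resample:
  assumes "t \<ge> 0"
  shows "distr (ising_law \<Otimes>\<^sub>M dyn_law) ising_law (resample t) = (ising_law :: ('n::finite config \<times> _) measure)"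
proof (rule measure_eqI)
  fix A assume "A \<in> sets (distr (ising_law \<Otimes>\<^sub>M dyn_law) ising_law (resample t) :: ('n config \<times> _) measure)"
  then have A: "A \<in> sets (ising_law :: ('n config \<times> _) measure)" by simp
  have iA: "indicator A \<in> borel_measurable (ising_law :: ('n config \<times> _) measure)" using A by simp
  let ?D = "dyn_law :: ('n site \<Rightarrow> clock) measure"
  let ?S = "\<lambda>p x. splice_clock t (fst p x) (snd p x)"
  have mr: "(\<lambda>p. indicator A (resample t p) :: ennreal) \<in> borel_measurable (ising_law \<Otimes>\<^sub>M dyn_law)"
    by (rule measurable_compose[OF measurable_resample iA])
  have "emeasure (distr (ising_law \<Otimes>\<^sub>M ?D) ising_law (resample t)) A
     = (\<integral>\<^sup>+p. indicator A (resample t p) \<partial>(ising_law \<Otimes>\<^sub>M ?D))"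
    using A measurable_resample
    by (subst nn_integral_indicator[symmetric], simp, subst nn_integral_distr) auto
  also have "\<dots> = (\<integral>\<^sup>+\<omega>. \<integral>\<^sup>+w'. indicator A (resample t (\<omega>, w')) \<partial>?D \<partial>ising_law)"
    by (rule dyn_law.nn_integral_fst[symmetric, OF mr])
  also have "\<dots> = (\<integral>\<^sup>+s. \<integral>\<^sup>+w. \<integral>\<^sup>+w'. indicator A (resample t ((s, w), w')) \<partial>?D \<partial>?D \<partial>initial_law)"
  proof -
    have "(\<lambda>\<omega>. \<integral>\<^sup>+w'. indicator A (resample t (\<omega>, w')) \<partial>?D) \<in> borel_measurable (initial_law \<Otimes>\<^sub>M ?D)"
      using dyn_law.borel_measurable_nn_integral_fst[OF mr] by (simp add: ising_law_def)
    from dyn_law.nn_integral_fst[OF this] show ?thesis by (simp add: ising_law_def)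
  qed
  also have "\<dots> = (\<integral>\<^sup>+s. \<integral>\<^sup>+w. indicator A (s, w) \<partial>?D \<partial>initial_law)"
  proof (rule nn_integral_cong)
    fix s :: "'n config" assume s: "s \<in> space initial_law"
    have As: "(\<lambda>w. indicator A (s, w) :: ennreal) \<in> borel_measurable ?D"
      using A s by (intro measurable_compose[OF measurable_Pair1' borel_measurable_indicator]) (auto simp: ising_law_def)
    have "(\<integral>\<^sup>+w. \<integral>\<^sup>+w'. indicator A (resample t ((s, w), w')) \<partial>?D \<partial>?D)
      = (\<integral>\<^sup>+p. indicator A (s, ?S p) \<partial>(?D \<Otimes>\<^sub>M ?D))"
      using dyn_law.nn_integral_fst[OF measurable_compose[OF measurable_splice_dyn As]]
      by (simp add: resample_def)
    also have "\<dots> = (\<integral>\<^sup>+w. indicator A (s, w) \<partial>distr (?D \<Otimes>\<^sub>M ?D) ?D ?S)"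
      using As measurable_splice_dyn by (subst nn_integral_distr) auto
    also have "\<dots> = (\<integral>\<^sup>+w. indicator A (s, w) \<partial>?D)" by (subst distr_splice_dyn[OF assms]) (rule refl)
    finally show "(\<integral>\<^sup>+w. \<integral>\<^sup>+w'. indicator A (resample t ((s, w), w')) \<partial>?D \<partial>?D) = (\<integral>\<^sup>+w. indicator A (s, w) \<partial>?D)" .
  qed
  also have "\<dots> = (\<integral>\<^sup>+\<omega>. indicator A \<omega> \<partial>ising_law)"
    using dyn_law.nn_integral_fst[of "indicator A" initial_law] iA by (simp add: ising_law_def)
  also have "\<dots> = emeasure ising_law A" using A by simp
  finally show "emeasure (distr (ising_law \<Otimes>\<^sub>M ?D) ising_law (resample t)) A = emeasure ising_law A" .
qed simp

section \<open>Translation invariance of the law and of the dynamics\<close>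

definition shift :: "'n::finite site \<Rightarrow> 'n config \<times> ('n site \<Rightarrow> clock) \<Rightarrow> 'n config \<times> ('n site \<Rightarrow> clock)" where
  "shift z \<omega> = (\<lambda>x. fst \<omega> (x + z), \<lambda>x. snd \<omega> (x + z))"

lemma distr_shift_PiM:
  fixes z :: "'n::finite site"
  assumes "prob_space M"
  shows "distr (PiM UNIV (\<lambda>_. M)) (PiM UNIV (\<lambda>_. M)) (\<lambda>w x. w (x + z)) = PiM UNIV (\<lambda>_. M)"
  using distr_PiM_reindex[of UNIV "\<lambda>_. M" "\<lambda>x. x + z" UNIV] assms by (simp add: inj_on_def restrict_def)

lemma measurable_shift_PiM:
  fixes z :: "'n::finite site"
  shows "(\<lambda>w x. w (x + z)) \<in> measurable (PiM UNIV (\<lambda>_. M)) (PiM UNIV (\<lambda>_. M))"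
  by (rule measurable_PiM_single') (auto simp: space_PiM)

lemma measurable_shift_dyn: "(\<lambda>w x. w (x + z)) \<in> measurable dyn_law dyn_law"
  unfolding dyn_law_def by (rule measurable_shift_PiM)

lemma distr_shift_dyn: "distr dyn_law dyn_law (\<lambda>w x. w (x + z)) = dyn_law"
  unfolding dyn_law_def by (rule distr_shift_PiM) (rule clock_law.prob_space_axioms)

lemma measurable_shift: "shift z \<in> measurable ising_law ising_law"
proof -
  have "(\<lambda>w x. w (x + z)) \<in> measurable initial_law initial_law"
    unfolding initial_law_def by (rule measurable_shift_PiM)
  then show ?thesis
    unfolding shift_def ising_law_def
    by (intro measurable_Pair measurable_compose[OF measurable_fst] measurable_compose[OF measurable_snd measurable_shift_dyn])
qed

lemma distr_shift: "distr ising_law ising_law (shift z) = ising_law"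
proof -
  have m: "(\<lambda>w x. w (x + z)) \<in> measurable initial_law initial_law"
    unfolding initial_law_def by (rule measurable_shift_PiM)
  have d: "distr initial_law initial_law (\<lambda>w x. w (x + z)) = initial_law"
    unfolding initial_law_def by (rule distr_shift_PiM) (rule prob_space_uniform_count_measure, simp_all)
  have "distr initial_law initial_law (\<lambda>w x. w (x + z)) \<Otimes>\<^sub>M distr dyn_law dyn_law (\<lambda>w x. w (x + z))
    = distr (initial_law \<Otimes>\<^sub>M dyn_law) (initial_law \<Otimes>\<^sub>M dyn_law) (\<lambda>(s, w). (\<lambda>x. s (x + z), \<lambda>x. w (x + z)))"
    by (rule pair_measure_distr[OF m measurable_shift_dyn])
      (simp add: distr_shift_dyn dyn_law.sigma_finite_measure_axioms)
  then show ?thesis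
    by (simp add: d distr_shift_dyn ising_law_def shift_def[abs_def] case_prod_beta')
qed

text \<open>The fresh clocks are translated together with the sample point, because the energy
  estimate integrates over both.\<close>

lemma distr_shift_pair:
  "distr (ising_law \<Otimes>\<^sub>M dyn_law) (ising_law \<Otimes>\<^sub>M dyn_law) (\<lambda>p. (shift z (fst p), \<lambda>x. snd p (x + z)))
    = ising_law \<Otimes>\<^sub>M dyn_law"
proof -
  have "distr ising_law ising_law (shift z) \<Otimes>\<^sub>M distr dyn_law dyn_law (\<lambda>w x. w (x + z))
    = distr (ising_law \<Otimes>\<^sub>M dyn_law) (ising_law \<Otimes>\<^sub>M dyn_law) (\<lambda>(\<omega>, w). (shift z \<omega>, \<lambda>x. w (x + z)))"
    by (rule pair_measure_distr[OF measurable_shift measurable_shift_dyn])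
      (simp add: distr_shift_dyn dyn_law.sigma_finite_measure_axioms)
  then show ?thesis
    by (simp add: distr_shift distr_shift_dyn case_prod_beta')
qed

lemma disagreements_translate: "disagreements (\<lambda>x. s (x + z)) x = disagreements s (x + z)"
proof -
  have "{y \<in> nbrs (x + z). s y \<noteq> s (x + z)} = (\<lambda>y. y + z) ` {y \<in> nbrs x. s (y + z) \<noteq> s (x + z)}"
    unfolding nbrs_translate_image by auto
  then show ?thesis unfolding disagreements_eq by (simp add: card_image)
qed

lemma ising_path_translate:
  assumes "ising_path s0 w \<sigma>"
  shows "ising_path (\<lambda>x. s0 (x + z)) (\<lambda>x. w (x + z)) (\<lambda>t x. \<sigma> t (x + z))"
  unfolding ising_path_def
proof (intro conjI allI impI)
  show "(\<lambda>x. \<sigma> 0 (x + z)) = (\<lambda>x. s0 (x + z))" using assms by (simp add: ising_path_def)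
next
  fix x s t
  assume "0 \<le> s \<and> s \<le> t \<and> (\<forall>n. ring_time (w (x + z)) n \<notin> {s<..t})"
  then show "\<sigma> t (x + z) = \<sigma> s (x + z)" using assms unfolding ising_path_def by blast
next
  fix x n
  have "updated_spin (\<lambda>x. \<sigma> s (x + z)) x b = updated_spin (\<sigma> s) (x + z) b" for s b
    by (simp add: updated_spin_def disagreements_translate)
  then show "\<forall>\<^sub>F s in at_left (ring_time (w (x + z)) n). \<sigma> (ring_time (w (x + z)) n) (x + z)
      = updated_spin (\<lambda>x. \<sigma> s (x + z)) x (ring_coin (w (x + z)) n)"
    using assms unfolding ising_path_def by simp
qed

subsection \<open>Clock events\<close>

lemma measure_clock_two:
  assumes "A \<in> sets step_law" "B \<in> sets step_law"
  shows "measure clock_law {c. c 0 \<in> A \<and> c 1 \<in> B} = measure step_law A * measure step_law B"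
proof -
  have "{c \<in> space clock_law. \<forall>i\<in>{0, 1}. c i \<in> (if i = 0 then A else B)} = {c. c 0 \<in> A \<and> c 1 \<in> B}"
    by auto
  then have "emeasure clock_law {c. c 0 \<in> A \<and> c 1 \<in> B} = emeasure step_law A * emeasure step_law B"
    using clock.emeasure_PiM_Collect[of "{0, 1}" "\<lambda>i. if i = 0 then A else B"] assms
    by (simp add: clock_law_eq[symmetric])
  then show ?thesis by (simp add: measure_def enn2real_mult)
qed

lemma measure_dyn_All:
  assumes "finite J" "\<And>x. x \<in> J \<Longrightarrow> A x \<in> sets clock_law"
  shows "measure dyn_law {w. \<forall>x\<in>J. w x \<in> A x} = (\<Prod>x\<in>J. measure clock_law (A x))"
proof -
  have "emeasure dyn_law {w. \<forall>x\<in>J. w x \<in> A x} = (\<Prod>x\<in>J. emeasure clock_law (A x))"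
    using dyn.emeasure_PiM_Collect[of J A] assms by (simp add: dyn_law_def[symmetric])
  also have "\<dots> = ennreal (\<Prod>x\<in>J. measure clock_law (A x))"
    by (simp add: clock_law.emeasure_eq_measure prod_ennreal)
  finally show ?thesis
    by (intro measure_eq_emeasure_eq_ennreal prod_nonneg) simp_all
qed

lemma sets_dyn_All:
  assumes "finite J" "\<And>x. x \<in> J \<Longrightarrow> A x \<in> sets clock_law"
  shows "{w. \<forall>x\<in>J. w x \<in> A x} \<in> sets dyn_law"
proof (rule Collect_in_sets)
  show "Measurable.pred dyn_law (\<lambda>w. \<forall>x\<in>J. w x \<in> A x)"
    using assms by (intro pred_intros_finite(3) pred_sets2[OF _ measurable_dyn_component]) auto
qed simp

definition first_ring_by :: "real \<Rightarrow> clock set" where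
  "first_ring_by \<delta> = {c. fst (c 0) \<le> \<delta>}"

text \<open>The wait between the first two rings rather than the second ring time, because it is
  independent of the first wait. For a regular clock, a second ring by time \<open>\<delta>\<close>
  forces this wait to be at most \<open>\<delta>\<close>.\<close>

definition second_wait_by :: "real \<Rightarrow> clock set" where
  "second_wait_by \<delta> = {c. fst (c 1) \<le> \<delta>}"

definition heads_first :: "clock set" where
  "heads_first = {c. snd (c 0)}"

lemma sets_ring_events[measurable]:
  "first_ring_by \<delta> \<in> sets clock_law" "second_wait_by \<delta> \<in> sets clock_law" "heads_first \<in> sets clock_law"
proof -
  have "Measurable.pred clock_law (\<lambda>c. fst (c n) \<le> \<delta>)" for n by measurable
  then show "first_ring_by \<delta> \<in> sets clock_law" "second_wait_by \<delta> \<in> sets clock_law"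
    unfolding first_ring_by_def second_wait_by_def by (auto intro: Collect_in_sets)
  have "Measurable.pred clock_law (\<lambda>c. snd (c 0))"
    by (rule measurable_compose[OF measurable_clock_component measurable_snd])
  then show "heads_first \<in> sets clock_law"
    unfolding heads_first_def by (auto intro: Collect_in_sets)
qed

lemma measure_first_ring_by: "\<delta> \<ge> 0 \<Longrightarrow> measure clock_law (first_ring_by \<delta>) = 1 - exp (- \<delta>)"
  using emeasure_step_component[of "{x. fst x \<le> \<delta>}" 0] step_law_gt(2)[of \<delta>] sets_step_law_half_space[of \<delta>]
  by (simp add: first_ring_by_def measure_def)

lemma measure_not_first_ring_by: "\<delta> \<ge> 0 \<Longrightarrow> measure clock_law (- first_ring_by \<delta>) = exp (- \<delta>)"
  using clock_law.prob_compl[of "first_ring_by \<delta>"] sets_ring_events(1)[of \<delta>]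
  by (simp add: measure_first_ring_by Compl_eq_Diff_UNIV)

lemma measure_two_rings_by:
  assumes "\<delta> \<ge> 0" shows "measure clock_law (first_ring_by \<delta> \<inter> second_wait_by \<delta>) = (1 - exp (- \<delta>))\<^sup>2"
proof -
  have "first_ring_by \<delta> \<inter> second_wait_by \<delta> = {c. c 0 \<in> {x. fst x \<le> \<delta>} \<and> c 1 \<in> {x. fst x \<le> \<delta>}}"
    by (auto simp: first_ring_by_def second_wait_by_def)
  moreover have "measure step_law {x. fst x \<le> \<delta>} = 1 - exp (- \<delta>)"
    using step_law_gt(2)[OF assms] assms by (simp add: measure_def)
  ultimately show ?thesis
    using measure_clock_two[of "{x. fst x \<le> \<delta>}" "{x. fst x \<le> \<delta>}"] sets_step_law_half_space[of \<delta>]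
    by (simp add: power2_eq_square)
qed

lemma measure_single_heads_pos:
  "measure clock_law (first_ring_by 1 \<inter> heads_first - second_wait_by 1) > 0"
proof -
  let ?E = "density lborel (exponential_density 1)" and ?B = "measure_pmf (bernoulli_pmf (1 / 2))"
  have A: "{x. fst x \<le> 1 \<and> snd x} = {..1} \<times> {True}" "{x. fst x \<le> 1} = {..1::real} \<times> (UNIV :: bool set)" by auto
  have eA: "emeasure step_law ({..1} \<times> Z) = emeasure ?E {..1} * emeasure ?B Z" for Z
    unfolding step_law_def by (rule measure_pmf.emeasure_pair_measure_Times) auto
  have "emeasure step_law {x. fst x \<le> 1} > 0"
    using step_law_gt(2)[of 1] by simp
  then have "emeasure ?E {..1} > 0" unfolding A(2) eA using measure_pmf.emeasure_space_1[of "bernoulli_pmf (1/2)"] by simp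
  then have "emeasure step_law {x. fst x \<le> 1 \<and> snd x} > 0"
    unfolding A(1) eA by (auto simp: emeasure_pmf_single zero_less_iff_neq_zero)
  then have p1: "measure step_law {x. fst x \<le> 1 \<and> snd x} > 0"
    by (simp add: step.emeasure_eq_measure)
  have p2: "measure step_law {x. fst x > 1} > 0"
    using step_law_gt(1)[of 1] by (simp add: step.emeasure_eq_measure)
  have "{x. fst x \<le> 1 \<and> snd x} \<in> sets step_law"
    unfolding A(1) sets_step_law by auto
  then have "measure clock_law {c. c 0 \<in> {x. fst x \<le> 1 \<and> snd x} \<and> c 1 \<in> {x. fst x > 1}} > 0"
    using p1 p2 sets_step_law_half_space[of 1] by (subst measure_clock_two) auto
  moreover have "{c. c 0 \<in> {x. fst x \<le> 1 \<and> snd x} \<and> c 1 \<in> {x. fst x > 1}} = first_ring_by 1 \<inter> heads_first - second_wait_by 1"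
    by (auto simp: first_ring_by_def second_wait_by_def heads_first_def)
  ultimately show ?thesis by simp
qed

lemma no_mark_splice:
  assumes "regular_clock c" "regular_clock c'" "t \<ge> 0" "c' \<notin> first_ring_by \<delta>" "m \<in> marks (splice_clock t c c')"
  shows "\<not> (t < fst m \<and> fst m \<le> t + \<delta>)"
proof
  assume m: "t < fst m \<and> fst m \<le> t + \<delta>"
  then obtain m' where "m' \<in> marks c'" "fst m' \<le> \<delta>"
    using assms(5) marks_splice[OF assms(1,3)] by auto
  then show False using first_mark_le[OF assms(2)] assms(4) by (fastforce simp: first_ring_by_def)
qed

lemma single_mark_splice:
  assumes "regular_clock c" "regular_clock c'" "t \<ge> 0" "c' \<in> first_ring_by \<delta>" "c' \<notin> second_wait_by \<delta>"
  shows "(t + fst (c' 0), snd (c' 0)) \<in> marks (splice_clock t c c')" "t < t + fst (c' 0)" "t + fst (c' 0) \<le> t + \<delta>"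
    and "m \<in> marks (splice_clock t c c') \<Longrightarrow> t < fst m \<Longrightarrow> fst m \<le> t + \<delta> \<Longrightarrow> fst m = t + fst (c' 0)"
proof -
  have "c' 0 \<in> marks c'" unfolding marks_eq_insert[of c'] by simp
  then show "(t + fst (c' 0), snd (c' 0)) \<in> marks (splice_clock t c c')"
    unfolding marks_splice[OF assms(1,3)] by (auto simp: case_prod_beta' intro!: image_eqI[of _ _ "c' 0"])
  show "t < t + fst (c' 0)" using assms(2) by (simp add: regular_clock_def)
  show "t + fst (c' 0) \<le> t + \<delta>" using assms(4) by (simp add: first_ring_by_def)
  assume m: "m \<in> marks (splice_clock t c c')" "t < fst m" "fst m \<le> t + \<delta>"
  then obtain m' where m': "m' \<in> marks c'" "fst m = t + fst m'"
    using marks_splice[OF assms(1,3)] by auto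
  have "m' \<notin> (\<lambda>(r, b). (fst (c' 0) + r, b)) ` marks (\<lambda>k. c' (Suc k))"
  proof
    assume "m' \<in> (\<lambda>(r, b). (fst (c' 0) + r, b)) ` marks (\<lambda>k. c' (Suc k))"
    then obtain m'' where "m'' \<in> marks (\<lambda>k. c' (Suc k))" "fst m' = fst (c' 0) + fst m''" by auto
    then have "fst (c' 0) + fst (c' 1) \<le> fst m'"
      using first_mark_le[OF regular_clock_tl[OF assms(2)]] by fastforce
    moreover have "fst (c' 0) > 0" using assms(2) by (simp add: regular_clock_def)
    ultimately show False using m m' assms(5) by (simp add: second_wait_by_def)
  qed
  then show "fst m = t + fst (c' 0)" using m' unfolding marks_eq_insert[of c'] by simp
qed

subsection \<open>The process\<close>

locale ising_trajectory =
  fixes \<sigma> :: "('n::finite) config \<times> ('n site \<Rightarrow> clock) \<Rightarrow> real \<Rightarrow> 'n config"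
  assumes measurable_spin: "\<And>t x. t \<ge> 0 \<Longrightarrow> (\<lambda>\<omega>. \<sigma> \<omega> t x) \<in> measurable ising_law (count_space UNIV)"
    and path: "AE (s0, w) in ising_law. ising_path s0 w (\<sigma> (s0, w))"
begin

definition typical :: "'n config \<times> ('n site \<Rightarrow> clock) \<Rightarrow> bool" where
  "typical \<omega> \<longleftrightarrow> good_clocks (snd \<omega>) \<and> ising_path (fst \<omega>) (snd \<omega>) (\<sigma> \<omega>) \<and> (\<forall>x. fst \<omega> x \<in> {-1, 1})"

lemma AE_typical: "AE \<omega> in ising_law. typical \<omega>"
proof -
  have "AE \<omega> in ising_law. good_clocks (snd \<omega> :: 'n site \<Rightarrow> clock)"
    unfolding ising_law_def
    by (intro AE_pair_snd AE_good_clocks initial_law.prob_space_axioms dyn_law.prob_space_axioms)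
  moreover have "AE \<omega> in ising_law. \<forall>x :: 'n site. fst \<omega> x \<in> {-1, 1}"
    by (intro AE_I2) (auto simp: ising_law_def space_pair_measure space_initial_law)
  ultimately show ?thesis
    using path by eventually_elim (auto simp: typical_def case_prod_beta')
qed

lemma typicalD:
  assumes "typical \<omega>"
  shows "good_clocks (snd \<omega>)" "regular_clock (snd \<omega> x)" "ising_path (fst \<omega>) (snd \<omega>) (\<sigma> \<omega>)"
    "t \<ge> 0 \<Longrightarrow> \<sigma> \<omega> t x \<in> {-1, 1}"
  using assms ising_path_spin_values[of "fst \<omega>" "snd \<omega>" "\<sigma> \<omega>" x t]
  unfolding typical_def good_clocks_def by auto

text \<open>Collects the almost sure facts that allow a sample point and its resampled version to be
  compared path by path, so that later arguments are deterministic.\<close>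

definition resampled_ok :: "real \<Rightarrow> ('n config \<times> ('n site \<Rightarrow> clock)) \<times> ('n site \<Rightarrow> clock) \<Rightarrow> bool" where
  "resampled_ok t p \<longleftrightarrow> typical (fst p) \<and> typical (resample t p) \<and> (\<forall>x. regular_clock (snd p x)) \<and>
     (\<forall>s. 0 \<le> s \<and> s \<le> t \<longrightarrow> \<sigma> (resample t p) s = \<sigma> (fst p) s)"

text \<open>Resampling preserves the law, so the resampled point is almost surely typical. Its
  clocks have the same marks up to \<open>t\<close>, because fresh marks are positive and land
  strictly after \<open>t\<close>; uniqueness then identifies the two trajectories up to
  \<open>t\<close>.\<close>

lemma AE_resampled_ok:
  assumes "t \<ge> 0"
  shows "AE p in ising_law \<Otimes>\<^sub>M dyn_law. resampled_ok t p"
proof -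
  have "AE p in ising_law \<Otimes>\<^sub>M dyn_law. typical (fst p)"
    by (intro AE_pair_fst AE_typical dyn_law.prob_space_axioms)
  moreover have "AE p in ising_law \<Otimes>\<^sub>M dyn_law. good_clocks (snd p :: 'n site \<Rightarrow> clock)"
    by (intro AE_pair_snd AE_good_clocks ising_law.prob_space_axioms dyn_law.prob_space_axioms)
  moreover have "AE p in ising_law \<Otimes>\<^sub>M dyn_law. typical (resample t p)"
    using AE_distrD[OF measurable_resample[of t]] distr_resample[OF assms] AE_typical by metis
  ultimately show ?thesis
  proof eventually_elim
    case (elim p)
    have reg: "regular_clock (snd p x)" for x using elim(2) by (simp add: good_clocks_def)
    have "\<sigma> (fst p) s = \<sigma> (resample t p) s" if s: "0 \<le> s" "s \<le> t" for s
    proof (rule ising_path_unique[OF _ _ typicalD(1)[OF elim(1)] _ s])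
      show "ising_path (fst (fst p)) (snd (fst p)) (\<sigma> (fst p))" by (rule typicalD(3)[OF elim(1)])
      show "ising_path (fst (fst p)) (snd (resample t p)) (\<sigma> (resample t p))"
        using typicalD(3)[OF elim(3)] by (simp add: resample_def)
      show "{m \<in> marks (snd (fst p) x). fst m \<le> t} = {m \<in> marks (snd (resample t p) x). fst m \<le> t}" for x
        using marks_splice[OF typicalD(2)[OF elim(1)] assms] marks_pos[OF reg[of x]]
        by (fastforce simp: resample_def)
    qed
    then show ?case using elim reg by (auto simp: resampled_ok_def)
  qed
qed

text \<open>The translated trajectory solves the dynamics for the translated data. So does, almost
  surely by invariance of the law, the value of \<open>\<sigma>\<close> at the shifted sample point,
  and uniqueness makes the two equal.\<close>

lemma AE_shift:
  "AE \<omega> in ising_law. typical \<omega> \<and> (\<forall>t\<ge>0. \<sigma> (shift z \<omega>) t = (\<lambda>x. \<sigma> \<omega> t (x + z)))"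
proof -
  have "AE \<omega> in ising_law. typical (shift z \<omega>)"
    using AE_distrD[OF measurable_shift[of z]] distr_shift[of z] AE_typical by metis
  then show ?thesis using AE_typical
  proof eventually_elim
    case (elim \<omega>)
    have "\<sigma> (shift z \<omega>) t = (\<lambda>x. \<sigma> \<omega> t (x + z))" if "t \<ge> 0" for t
    proof (rule ising_path_unique[OF typicalD(3)[OF elim(1)] _ typicalD(1)[OF elim(1)] _ that order_refl, of "snd (shift z \<omega>)"
        "\<lambda>t x. \<sigma> \<omega> t (x + z)", simplified])
      show "ising_path (fst (shift z \<omega>)) (snd (shift z \<omega>)) (\<lambda>t x. \<sigma> \<omega> t (x + z))"
        using ising_path_translate[OF typicalD(3)[OF elim(2)], of z] by (simp add: shift_def)
    qed
    then show ?case using elim by simp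
  qed
qed

lemma spin_stay:
  assumes "resampled_ok t p" "t \<ge> 0" "s \<ge> 0" "s \<le> \<delta>" "snd p x \<notin> first_ring_by \<delta>"
  shows "\<sigma> (resample t p) (t + s) x = \<sigma> (fst p) t x"
proof -
  have "\<sigma> (resample t p) (t + s) x = \<sigma> (resample t p) t x"
  proof (rule ising_path_const[of "fst (resample t p)" "snd (resample t p)"])
    show "ising_path (fst (resample t p)) (snd (resample t p)) (\<sigma> (resample t p))"
      using assms(1) typicalD(3) by (simp add: resampled_ok_def)
    fix m assume "m \<in> marks (snd (resample t p) x)"
    then have "\<not> (t < fst m \<and> fst m \<le> t + \<delta>)"
      using assms typicalD(2) by (intro no_mark_splice[of "snd (fst p) x" "snd p x"]) (auto simp: resampled_ok_def resample_def)
    then show "\<not> (t < fst m \<and> fst m \<le> t + s)" using assms by auto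
  qed (use assms in auto)
  then show ?thesis using assms by (simp add: resampled_ok_def)
qed

lemma spin_flip:
  assumes "resampled_ok t p" "t \<ge> 0" "snd p x \<in> first_ring_by \<delta>" "snd p x \<notin> second_wait_by \<delta>"
    "\<And>y. y \<in> nbrs x \<Longrightarrow> snd p y \<notin> first_ring_by \<delta>"
  shows "\<sigma> (resample t p) (t + \<delta>) x = updated_spin (\<sigma> (fst p) t) x (snd (snd p x 0))"
proof -
  have reg: "regular_clock (snd (fst p) y)" "regular_clock (snd p y)" for y
    using assms(1) typicalD(2) by (auto simp: resampled_ok_def)
  note single = single_mark_splice[OF reg assms(2-4)]
  have "\<sigma> (resample t p) (t + \<delta>) x = updated_spin (\<sigma> (resample t p) t) x (snd (snd p x 0))"
  proof (rule ising_path_single_mark[of "fst (resample t p)" "snd (resample t p)", OF _ assms(2)])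
    show "ising_path (fst (resample t p)) (snd (resample t p)) (\<sigma> (resample t p))"
      using assms(1) typicalD(3) by (simp add: resampled_ok_def)
    show "(t + fst (snd p x 0), snd (snd p x 0)) \<in> marks (snd (resample t p) x)"
      using single(1) by (simp add: resample_def)
    show "t < t + fst (snd p x 0)" "t + fst (snd p x 0) \<le> t + \<delta>" by (rule single)+
    show "fst m = t + fst (snd p x 0)"
      if "m \<in> marks (snd (resample t p) x)" "t < fst m" "fst m \<le> t + \<delta>" for m
      using single(4) that by (simp add: resample_def)
    show "\<not> (t < fst m \<and> fst m \<le> t + \<delta>)" if "y \<in> nbrs x" "m \<in> marks (snd (resample t p) y)" for y m
      using no_mark_splice[OF reg assms(2) assms(5)[OF that(1)]] that(2) by (simp add: resample_def)
  qed
  then show ?thesis using assms by (simp add: resampled_ok_def)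
qed

lemma measurable_disagreements:
  assumes "t \<ge> 0"
  shows "(\<lambda>\<omega>. disagreements (\<sigma> \<omega> t) x) \<in> measurable ising_law (count_space UNIV)"
proof -
  note measurable_spin[OF assms, measurable]
  have "disagreements s x = (\<Sum>y\<in>nbrs x. if s y \<noteq> s x then 1 else 0)" for s
    unfolding disagreements_eq by (simp add: sum.If_cases Int_def)
  then show ?thesis by simp
qed

abbreviation pr :: "('n config \<times> ('n site \<Rightarrow> clock) \<Rightarrow> bool) \<Rightarrow> real" where
  "pr E \<equiv> measure ising_law {\<omega> \<in> space ising_law. E \<omega>}"

lemma prob_pair:
  assumes "Measurable.pred ising_law E" "W \<in> sets dyn_law"
  shows "measure (ising_law \<Otimes>\<^sub>M dyn_law) {p \<in> space (ising_law \<Otimes>\<^sub>M dyn_law). E (fst p) \<and> snd p \<in> W}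
    = pr E * measure dyn_law W"
proof -
  have "{p \<in> space (ising_law \<Otimes>\<^sub>M dyn_law). E (fst p) \<and> snd p \<in> W} = {\<omega> \<in> space ising_law. E \<omega>} \<times> W"
    by (auto simp: space_pair_measure)
  then show ?thesis
    using assms by (simp add: measure_def dyn_law.emeasure_pair_measure_Times enn2real_mult pred_def)
qed

text \<open>The Markov property, as an inequality.\<close>

lemma resample_prob_le:
  assumes "t \<ge> 0" "Measurable.pred ising_law E" "W \<in> sets dyn_law" "Measurable.pred ising_law F"
    and imp: "\<And>p. resampled_ok t p \<Longrightarrow> E (fst p) \<Longrightarrow> snd p \<in> W \<Longrightarrow> F (resample t p)"
  shows "pr E * measure dyn_law W \<le> pr F"
proof -
  let ?MD = "ising_law \<Otimes>\<^sub>M dyn_law :: (('n config \<times> ('n site \<Rightarrow> clock)) \<times> ('n site \<Rightarrow> clock)) measure"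
  interpret MD: prob_space ?MD
    by (intro prob_space_pair ising_law.prob_space_axioms dyn_law.prob_space_axioms)
  have F: "{\<omega> \<in> space ising_law. F \<omega>} \<in> sets ising_law" using assms(4) by (simp add: pred_def)
  have "pr E * measure dyn_law W = measure ?MD {p \<in> space ?MD. E (fst p) \<and> snd p \<in> W}"
    using prob_pair[OF assms(2,3)] by simp
  also have "\<dots> \<le> measure ?MD (resample t -` {\<omega> \<in> space ising_law. F \<omega>} \<inter> space ?MD)"
  proof (rule MD.finite_measure_mono_AE)
    show "AE p in ?MD. p \<in> {p \<in> space ?MD. E (fst p) \<and> snd p \<in> W} \<longrightarrow>
        p \<in> resample t -` {\<omega> \<in> space ising_law. F \<omega>} \<inter> space ?MD"
      using AE_resampled_ok[OF assms(1)]
      by eventually_elim (use imp measurable_space[OF measurable_resample[of t]] in auto)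
    show "resample t -` {\<omega> \<in> space ising_law. F \<omega>} \<inter> space ?MD \<in> sets ?MD"
      by (rule measurable_sets[OF measurable_resample F])
  qed
  also have "\<dots> = measure (distr ?MD ising_law (resample t)) {\<omega> \<in> space ising_law. F \<omega>}"
    by (rule measure_distr[symmetric, OF measurable_resample F])
  also have "\<dots> = pr F" by (subst distr_resample[OF assms(1)]) (rule refl)
  finally show ?thesis .
qed

end

subsection \<open>Energy dissipation\<close>

definition unstable :: "('n::finite) config \<Rightarrow> 'n site \<Rightarrow> bool" where
  "unstable s x \<longleftrightarrow> disagreements s x > CARD('n)"

definition edge_change :: "('n::finite) config \<Rightarrow> 'n site \<Rightarrow> bool \<Rightarrow> 'n site \<Rightarrow> real" where
  "edge_change s x b y = of_bool (updated_spin s x b \<noteq> s y) - of_bool (s x \<noteq> s y)"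

lemma of_nat_disagreements: "real (disagreements s x) = (\<Sum>y\<in>nbrs x. of_bool (s x \<noteq> s y))"
  unfolding disagreements_eq of_bool_def by (simp add: sum.If_cases Int_def conj_commute eq_commute)

lemma abs_edge_change: "\<bar>edge_change s x b y\<bar> \<le> 1"
  by (simp add: edge_change_def)

text \<open>Flipping a site with k disagreements leaves 2d - k of them, a change of 2d - 2k: zero
  for a tie and at most -2 when k > d. An update at an unstable site negates the spin, and this is a
  genuine change because the spin is nonzero.\<close>

lemma sum_edge_change:
  fixes s :: "'n::finite config"
  assumes "\<And>y. s y \<in> {-1, 1}"
  shows "(\<Sum>y\<in>nbrs x. edge_change s x b y) \<le> - 2 * of_bool (unstable s x)"
proof (cases "updated_spin s x b = s x")
  case True
  have "\<not> unstable s x"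
    using True assms[of x] by (auto simp: updated_spin_def unstable_def split: if_splits)
  then show ?thesis using True by (simp add: edge_change_def)
next
  case False
  then have D: "disagreements s x \<ge> CARD('n)" and u: "updated_spin s x b = - s x"
    by (auto simp: updated_spin_def split: if_splits)
  have "edge_change s x b y = 1 - 2 * of_bool (s x \<noteq> s y)" for y
    using assms[of x] assms[of y] by (auto simp: edge_change_def u)
  then have "(\<Sum>y\<in>nbrs x. edge_change s x b y) = 2 * real CARD('n) - 2 * real (disagreements s x)"
    by (simp add: sum_subtractf sum_distrib_left[symmetric] of_nat_disagreements card_nbrs)
  also have "\<dots> \<le> - 2 * of_bool (unstable s x)"
    using D by (auto simp: unstable_def)
  finally show ?thesis .
qed

text \<open>The exceptional event of the expansion over a time step. Both kinds of coincidence are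
  expressed through independent waiting times, whence a probability of order \<delta>^2.\<close>

definition two_rings :: "('n::finite) site set \<Rightarrow> real \<Rightarrow> ('n site \<Rightarrow> clock) set" where
  "two_rings S \<delta> = (\<Union>x\<in>S. {w. w x \<in> first_ring_by \<delta> \<inter> second_wait_by \<delta>}) \<union>
     (\<Union>(x, y)\<in>{(x, y) \<in> S \<times> S. x \<noteq> y}. {w. w x \<in> first_ring_by \<delta> \<and> w y \<in> first_ring_by \<delta>})"

lemma sets_two_rings_aux:
  "{w. w x \<in> first_ring_by \<delta> \<inter> second_wait_by \<delta>} \<in> sets dyn_law"
  "{w. w x \<in> first_ring_by \<delta> \<and> w y \<in> first_ring_by \<delta>} \<in> sets dyn_law"
  using sets_dyn_All[of "{x}" "\<lambda>_. first_ring_by \<delta> \<inter> second_wait_by \<delta>"] sets_dyn_All[of "{x, y}" "\<lambda>_. first_ring_by \<delta>"]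
    sets_ring_events by auto

lemma sets_two_rings:
  assumes "finite S" shows "two_rings S \<delta> \<in> sets dyn_law"
proof -
  have "finite {(x, y) \<in> S \<times> S. x \<noteq> y}" using assms by (rule_tac finite_subset[of _ "S \<times> S"]) auto
  then show ?thesis
    unfolding two_rings_def using assms sets_two_rings_aux
    by (intro sets.Un sets.finite_UN) (auto simp: case_prod_beta')
qed

lemma measure_two_rings:
  assumes S: "finite S" and \<delta>: "\<delta> \<ge> 0"
  shows "measure dyn_law (two_rings S \<delta>) \<le> (real (card S) + real (card S * card S)) * \<delta>\<^sup>2"
proof -
  have e: "0 \<le> 1 - exp (- \<delta>)" "1 - exp (- \<delta>) \<le> \<delta>" using \<delta> exp_ge_add_one_self[of "- \<delta>"] by auto
  have le: "(1 - exp (- \<delta>))\<^sup>2 \<le> \<delta>\<^sup>2" using e by (intro power_mono) auto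
  let ?P = "{(x, y) \<in> S \<times> S. x \<noteq> y}"
  have fP: "finite ?P" using S by (rule_tac finite_subset[of _ "S \<times> S"]) auto
  have cP: "card ?P \<le> card S * card S"
    using card_mono[of "S \<times> S" ?P] S by (auto simp: card_cartesian_product)
  have 1: "measure dyn_law {w. w x \<in> first_ring_by \<delta> \<inter> second_wait_by \<delta>} \<le> \<delta>\<^sup>2" for x
  proof -
    have "measure dyn_law {w. w x \<in> first_ring_by \<delta> \<inter> second_wait_by \<delta>} = (1 - exp (- \<delta>))\<^sup>2"
      using measure_dyn_All[of "{x}" "\<lambda>_. first_ring_by \<delta> \<inter> second_wait_by \<delta>"] sets_ring_events measure_two_rings_by[OF \<delta>]
      by simp
    then show ?thesis using le by simp
  qed
  have 2: "measure dyn_law {w. w x \<in> first_ring_by \<delta> \<and> w y \<in> first_ring_by \<delta>} \<le> \<delta>\<^sup>2" if "x \<noteq> y" for x y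
  proof -
    have "measure dyn_law {w. w x \<in> first_ring_by \<delta> \<and> w y \<in> first_ring_by \<delta>} = (1 - exp (- \<delta>))\<^sup>2"
      using measure_dyn_All[of "{x, y}" "\<lambda>_. first_ring_by \<delta>"] sets_ring_events measure_first_ring_by[OF \<delta>] that
      by (simp add: power2_eq_square)
    then show ?thesis using le by simp
  qed
  have "measure dyn_law (two_rings S \<delta>) \<le> measure dyn_law (\<Union>x\<in>S. {w. w x \<in> first_ring_by \<delta> \<inter> second_wait_by \<delta>}) +
     measure dyn_law (\<Union>p\<in>?P. {w. w (fst p) \<in> first_ring_by \<delta> \<and> w (snd p) \<in> first_ring_by \<delta>})"
    unfolding two_rings_def case_prod_beta' using S fP sets_two_rings_aux
    by (intro measure_Un_le sets.finite_UN) auto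
  also have "\<dots> \<le> (\<Sum>x\<in>S. measure dyn_law {w. w x \<in> first_ring_by \<delta> \<inter> second_wait_by \<delta>}) +
     (\<Sum>p\<in>?P. measure dyn_law {w. w (fst p) \<in> first_ring_by \<delta> \<and> w (snd p) \<in> first_ring_by \<delta>})"
    using S fP sets_two_rings_aux by (intro add_mono dyn_law.finite_measure_subadditive_finite) auto
  also have "\<dots> \<le> (\<Sum>x\<in>S. \<delta>\<^sup>2) + (\<Sum>p\<in>?P. \<delta>\<^sup>2)"
    using 1 2 by (intro add_mono sum_mono) auto
  also have "\<dots> = (real (card S) + real (card ?P)) * \<delta>\<^sup>2" by (simp add: algebra_simps)
  also have "\<dots> \<le> (real (card S) + real (card S * card S)) * \<delta>\<^sup>2"
    using cP by (intro mult_right_mono add_left_mono) (auto simp only: of_nat_le_iff zero_le_power2)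
  finally show ?thesis .
qed

context ising_trajectory
begin

definition energy :: "real \<Rightarrow> real" where
  "energy t = (\<integral>\<omega>. real (disagreements (\<sigma> \<omega> t) 0) \<partial>ising_law)"

lemma pred_unstable: "t \<ge> 0 \<Longrightarrow> Measurable.pred ising_law (\<lambda>\<omega>. unstable (\<sigma> \<omega> t) x)"
  using measurable_disagreements[of t x] unfolding unstable_def by measurable

lemma prob_unstable_translate:
  assumes "t \<ge> 0"
  shows "pr (\<lambda>\<omega>. unstable (\<sigma> \<omega> t) x) = pr (\<lambda>\<omega>. unstable (\<sigma> \<omega> t) 0)"
proof -
  let ?E = "{\<omega> \<in> space ising_law. unstable (\<sigma> \<omega> t) 0}"
  have E: "?E \<in> sets ising_law" using pred_unstable[OF assms] by (simp add: pred_def)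
  have "pr (\<lambda>\<omega>. unstable (\<sigma> \<omega> t) 0) = measure (distr ising_law ising_law (shift x)) ?E"
    by (subst distr_shift) (rule refl)
  also have "\<dots> = measure ising_law (shift x -` ?E \<inter> space ising_law)"
    by (rule measure_distr[OF measurable_shift E])
  also have "\<dots> = pr (\<lambda>\<omega>. unstable (\<sigma> \<omega> t) x)"
  proof (rule measure_eq_AE)
    show "AE \<omega> in ising_law. \<omega> \<in> shift x -` ?E \<inter> space ising_law \<longleftrightarrow> \<omega> \<in> {\<omega> \<in> space ising_law. unstable (\<sigma> \<omega> t) x}"
      using AE_shift[of x]
    proof eventually_elim
      case (elim \<omega>)
      then have "unstable (\<sigma> (shift x \<omega>) t) 0 \<longleftrightarrow> unstable (\<sigma> \<omega> t) x"
        using assms disagreements_translate[of "\<sigma> \<omega> t" x 0] by (simp add: unstable_def)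
      then show ?case using measurable_space[OF measurable_shift[of x], of \<omega>] by auto
    qed
    show "shift x -` ?E \<inter> space ising_law \<in> sets ising_law" by (rule measurable_sets[OF measurable_shift E])
    show "{\<omega> \<in> space ising_law. unstable (\<sigma> \<omega> t) x} \<in> sets ising_law"
      using pred_unstable[OF assms] by (simp add: pred_def)
  qed
  finally show ?thesis by simp
qed

abbreviation MD :: "(('n config \<times> ('n site \<Rightarrow> clock)) \<times> ('n site \<Rightarrow> clock)) measure" where
  "MD \<equiv> ising_law \<Otimes>\<^sub>M dyn_law"

sublocale MD: prob_space MD
  by (intro prob_space_pair ising_law.prob_space_axioms dyn_law.prob_space_axioms)

text \<open>The first-order effect of a ring at \<open>x\<close> on the edge between
  \<open>x\<close> and \<open>y\<close>: the configuration is frozen at time \<open>t\<close>, while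
  the ring and its coin come from the fresh clocks, independent of the past.\<close>

definition ring_change :: "real \<Rightarrow> real \<Rightarrow> 'n site \<Rightarrow> 'n site \<Rightarrow> ('n config \<times> ('n site \<Rightarrow> clock)) \<times> ('n site \<Rightarrow> clock) \<Rightarrow> real" where
  "ring_change t \<delta> x y p = (if snd p x \<in> first_ring_by \<delta> then edge_change (\<sigma> (fst p) t) x (snd (snd p x 0)) y else 0)"

lemma abs_ring_change: "\<bar>ring_change t \<delta> x y p\<bar> \<le> 1"
  by (simp add: ring_change_def abs_edge_change)

lemma pred_first_ring: "Measurable.pred MD (\<lambda>p. snd p x \<in> first_ring_by \<delta>)"
  by (rule pred_sets2[OF sets_ring_events(1) measurable_compose[OF measurable_snd measurable_dyn_component]])

lemma measurable_ring_change:
  assumes "t \<ge> 0"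
  shows "ring_change t \<delta> x y \<in> borel_measurable MD"
proof -
  have [measurable]: "(\<lambda>p. \<sigma> (fst p) t x) \<in> measurable MD (count_space UNIV)" for x
    by (rule measurable_compose[OF measurable_fst measurable_spin[OF assms]])
  have [measurable]: "(\<lambda>p. - \<sigma> (fst p) t x) \<in> measurable MD (count_space UNIV)" for x
    by (rule measurable_compose[of _ _ "count_space UNIV" uminus]) measurable
  have [measurable]: "(\<lambda>p. disagreements (\<sigma> (fst p) t) x) \<in> measurable MD (count_space UNIV)"
    by (rule measurable_compose[OF measurable_fst measurable_disagreements[OF assms]])
  have [measurable]: "Measurable.pred MD (\<lambda>p. snd (snd p x 0))"
    by (rule measurable_compose[OF measurable_compose[OF measurable_compose[OF measurable_snd measurable_dyn_component] measurable_clock_component] measurable_snd])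
  note pred_first_ring[measurable]
  have "ring_change t \<delta> x y = (\<lambda>p. if snd p x \<in> first_ring_by \<delta> then 
      (if (if disagreements (\<sigma> (fst p) t) x > CARD('n) \<or> disagreements (\<sigma> (fst p) t) x = CARD('n) \<and> snd (snd p x 0)
         then - \<sigma> (fst p) t x \<noteq> \<sigma> (fst p) t y else \<sigma> (fst p) t x \<noteq> \<sigma> (fst p) t y) then 1 else 0) 
        - (if \<sigma> (fst p) t x \<noteq> \<sigma> (fst p) t y then 1 else 0) else 0)"
    by (auto simp: fun_eq_iff ring_change_def edge_change_def updated_spin_def)
  then show ?thesis by simp
qed

lemma integrable_ring_change: "t \<ge> 0 \<Longrightarrow> integrable MD (ring_change t \<delta> x y)"
  using abs_ring_change by (intro MD.integrable_const_bound[of _ 1] measurable_ring_change) auto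

text \<open>Mass transport: translating by \<open>y\<close> turns the effect of a ring at
  \<open>y\<close> on its edge to the origin into the effect of a ring at the origin on its edge to
  \<open>- y\<close>. Summed over all neighbours, rings at the neighbours count as much as rings at
  the origin.\<close>

lemma integral_ring_change_translate:
  assumes "t \<ge> 0"
  shows "(\<integral>p. ring_change t \<delta> y 0 p \<partial>MD) = (\<integral>p. ring_change t \<delta> 0 (- y) p \<partial>MD)"
proof -
  let ?s = "\<lambda>p. (shift y (fst p), \<lambda>x. snd p (x + y))"
  have ms: "?s \<in> measurable MD MD"
    by (intro measurable_Pair measurable_compose[OF measurable_fst measurable_shift] measurable_compose[OF measurable_snd measurable_shift_dyn])
  have "(\<integral>p. ring_change t \<delta> 0 (- y) p \<partial>MD) = (\<integral>p. ring_change t \<delta> 0 (- y) p \<partial>distr MD MD ?s)"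
    by (subst distr_shift_pair) (rule refl)
  also have "\<dots> = (\<integral>p. ring_change t \<delta> 0 (- y) (?s p) \<partial>MD)"
    by (rule integral_distr[OF ms measurable_ring_change[OF assms]])
  also have "\<dots> = (\<integral>p. ring_change t \<delta> y 0 p \<partial>MD)"
  proof (rule integral_cong_AE)
    show "(\<lambda>p. ring_change t \<delta> 0 (- y) (?s p)) \<in> borel_measurable MD"
      by (rule measurable_compose[OF ms measurable_ring_change[OF assms]])
    have "AE p in MD. typical (fst p) \<and> (\<forall>t\<ge>0. \<sigma> (shift y (fst p)) t = (\<lambda>x. \<sigma> (fst p) t (x + y)))"
      by (intro AE_pair_fst AE_shift dyn_law.prob_space_axioms)
    then show "AE p in MD. ring_change t \<delta> 0 (- y) (?s p) = ring_change t \<delta> y 0 p"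
    proof eventually_elim
      case (elim p)
      have "updated_spin (\<lambda>x. \<sigma> (fst p) t (x + y)) 0 b = updated_spin (\<sigma> (fst p) t) y b" for b
        using disagreements_translate[of "\<sigma> (fst p) t" y 0] by (simp add: updated_spin_def)
      then show ?case using elim assms by (simp add: ring_change_def edge_change_def)
    qed
  qed (rule measurable_ring_change[OF assms])
  finally show ?thesis by simp
qed

text \<open>The sites whose rings can disturb the first-order expansion: the origin and its
  neighbours, whose spins are compared, and the neighbours of these, which their updates
  read.\<close>

definition influence :: "'n site set" where
  "influence = (\<Union>y\<in>insert 0 (nbrs 0). insert y (nbrs y))"

lemma finite_influence: "finite influence"
  by (simp add: influence_def)

text \<open>Without two rings nearby the first-order expansion is exact. Otherwise the left side is
  at most 2d and each of the two sums is at least -2d, so a correction of 6d is enough.\<close>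

lemma disagreements_resample_le:
  assumes ok: "resampled_ok t p" and t: "t \<ge> 0" "\<delta> \<ge> 0"
  shows "real (disagreements (\<sigma> (resample t p) (t + \<delta>)) 0) \<le> real (disagreements (\<sigma> (fst p) t) 0)
    + ((\<Sum>y\<in>nbrs 0. ring_change t \<delta> 0 y p) + (\<Sum>y\<in>nbrs 0. ring_change t \<delta> y 0 p))
    + 6 * real CARD('n) * indicator (two_rings influence \<delta>) (snd p)"
proof (cases "snd p \<in> two_rings influence \<delta>")
  case True
  have b: "(\<Sum>y\<in>nbrs 0. f y) \<ge> - (2 * real CARD('n))" if "\<And>y. \<bar>f y\<bar> \<le> 1" for f :: "'n site \<Rightarrow> real"
  proof -
    have "(\<Sum>y\<in>nbrs 0. f y) \<ge> (\<Sum>y\<in>nbrs (0 :: 'n site). - 1)"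
      using that by (intro sum_mono) (simp add: abs_le_iff minus_le_iff)
    then show ?thesis by (simp add: card_nbrs)
  qed
  have "real (disagreements (\<sigma> (resample t p) (t + \<delta>)) 0) \<le> 2 * real CARD('n)"
    using disagreements_le[of "\<sigma> (resample t p) (t + \<delta>)" 0] by (metis of_nat_le_iff of_nat_mult of_nat_numeral)
  then show ?thesis
    using True b[of "\<lambda>y. ring_change t \<delta> 0 y p"] b[of "\<lambda>y. ring_change t \<delta> y 0 p"] abs_ring_change by simp
next
  case False
  define s where "s = \<sigma> (fst p) t"
  define s' where "s' = \<sigma> (resample t p) (t + \<delta>)"
  have one: "\<not> (snd p x \<in> first_ring_by \<delta> \<and> snd p x \<in> second_wait_by \<delta>)" if "x \<in> influence" for x
    using False that by (auto simp: two_rings_def)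
  have two: "snd p y \<notin> first_ring_by \<delta>" if "x \<in> influence" "y \<in> influence" "x \<noteq> y" "snd p x \<in> first_ring_by \<delta>" for x y
    using False that by (auto simp: two_rings_def)
  have stay: "s' x = s x" if "snd p x \<notin> first_ring_by \<delta>" for x
    unfolding s_def s'_def using that t by (intro spin_stay[OF ok]) auto
  have flip: "s' x = updated_spin s x (snd (snd p x 0))" 
    if "x \<in> insert 0 (nbrs 0)" "snd p x \<in> first_ring_by \<delta>" for x
    unfolding s_def s'_def
  proof (rule spin_flip[OF ok t(1) that(2)])
    have x: "x \<in> influence" "nbrs x \<subseteq> influence" using that(1) by (auto simp: influence_def)
    then show "snd p x \<notin> second_wait_by \<delta>" using one that(2) by blast
    show "snd p y \<notin> first_ring_by \<delta>" if "y \<in> nbrs x" for y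
      using two[of x y] x that \<open>snd p x \<in> first_ring_by \<delta>\<close> nbrs_irrefl[of x] by blast
  qed
  have "of_bool (s' 0 \<noteq> s' y) = of_bool (s 0 \<noteq> s y) + (ring_change t \<delta> 0 y p + ring_change t \<delta> y 0 p)"
    if y: "y \<in> nbrs 0" for y
  proof -
    have inf: "0 \<in> influence" "y \<in> influence" "0 \<noteq> y"
      using y nbrs_irrefl[of y] by (auto simp: influence_def)
    consider (zero) "snd p 0 \<in> first_ring_by \<delta>" "snd p y \<notin> first_ring_by \<delta>"
      | (y) "snd p 0 \<notin> first_ring_by \<delta>" "snd p y \<in> first_ring_by \<delta>"
      | (none) "snd p 0 \<notin> first_ring_by \<delta>" "snd p y \<notin> first_ring_by \<delta>"
      using two[OF inf] by blast
    then show ?thesis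
    proof cases
      case zero
      then show ?thesis using stay[of y] flip[of 0] by (simp add: ring_change_def edge_change_def s_def[symmetric])
    next
      case y: y
      then show ?thesis using stay[of 0] flip[of y] \<open>y \<in> nbrs 0\<close>
        by (simp add: ring_change_def edge_change_def s_def[symmetric] eq_commute[of "s 0"])
    next
      case none
      then show ?thesis using stay[of 0] stay[of y] by (simp add: ring_change_def)
    qed
  qed
  then have "real (disagreements s' 0) = real (disagreements s 0) 
      + (\<Sum>y\<in>nbrs 0. ring_change t \<delta> 0 y p + ring_change t \<delta> y 0 p)"
    unfolding of_nat_disagreements by (simp add: sum.distrib cong: sum.cong)
  then show ?thesis using False by (simp add: s_def s'_def sum.distrib)
qed

text \<open>The ring at the origin comes from the fresh clocks and is independent of instability at
  time \<open>t\<close>, so the bound of \<open>sum_edge_change\<close> integrates to a product of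
  probabilities.\<close>

lemma sum_integral_ring_change_le:
  assumes "t \<ge> 0" "\<delta> \<ge> 0"
  shows "(\<Sum>y\<in>nbrs 0. \<integral>p. ring_change t \<delta> 0 y p \<partial>MD) \<le> - 2 * ((1 - exp (- \<delta>)) * pr (\<lambda>\<omega>. unstable (\<sigma> \<omega> t) 0))"
proof -
  let ?W = "{w. w 0 \<in> first_ring_by \<delta>} :: ('n site \<Rightarrow> clock) set"
  have W: "?W \<in> sets dyn_law" "measure dyn_law ?W = 1 - exp (- \<delta>)"
    using sets_dyn_All[of "{0}" "\<lambda>_. first_ring_by \<delta>"] measure_dyn_All[of "{0}" "\<lambda>_. first_ring_by \<delta>"]
      sets_ring_events measure_first_ring_by[OF assms(2)] by auto
  let ?A = "{p \<in> space MD. unstable (\<sigma> (fst p) t) 0 \<and> snd p \<in> ?W}"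
  have mA: "?A \<in> sets MD"
  proof -
    have "Measurable.pred MD (\<lambda>p. unstable (\<sigma> (fst p) t) 0)"
      by (rule measurable_compose[OF measurable_fst pred_unstable[OF assms(1)]])
    then have "Measurable.pred MD (\<lambda>p. unstable (\<sigma> (fst p) t) 0 \<and> snd p 0 \<in> first_ring_by \<delta>)"
      using pred_first_ring[of 0 \<delta>] by measurable
    then show ?thesis by (simp add: pred_def)
  qed
  have "(\<Sum>y\<in>nbrs 0. \<integral>p. ring_change t \<delta> 0 y p \<partial>MD) = (\<integral>p. (\<Sum>y\<in>nbrs 0. ring_change t \<delta> 0 y p) \<partial>MD)"
    by (rule Bochner_Integration.integral_sum[symmetric]) (rule integrable_ring_change[OF assms(1)])
  also have "\<dots> \<le> (\<integral>p. - 2 * indicator ?A p \<partial>MD)"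
  proof (rule integral_mono_AE)
    show "integrable MD (\<lambda>p. \<Sum>y\<in>nbrs 0. ring_change t \<delta> 0 y p)"
      by (intro Bochner_Integration.integrable_sum integrable_ring_change assms)
    show "integrable MD (\<lambda>p. - 2 * indicator ?A p :: real)"
      using mA by (intro integrable_mult_right integrable_real_indicator) (auto simp: MD.emeasure_eq_measure)
    show "AE p in MD. (\<Sum>y\<in>nbrs 0. ring_change t \<delta> 0 y p) \<le> - 2 * indicator ?A p"
      using AE_resampled_ok[OF assms(1)] AE_space
    proof eventually_elim
      case (elim p)
      then have "\<sigma> (fst p) t y \<in> {-1, 1}" for y using typicalD(4) assms(1) by (simp add: resampled_ok_def)
      from sum_edge_change[of "\<sigma> (fst p) t" 0 "snd (snd p 0 0)", OF this] show ?case
        using elim(2) by (cases "snd p 0 \<in> first_ring_by \<delta>") (auto simp: ring_change_def indicator_def)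
    qed
  qed
  also have "\<dots> = - 2 * measure MD ?A" using mA by simp
  also have "measure MD ?A = pr (\<lambda>\<omega>. unstable (\<sigma> \<omega> t) 0) * (1 - exp (- \<delta>))"
    using prob_pair[OF pred_unstable[OF assms(1)] W(1)] W(2) by simp
  finally show ?thesis by (simp add: mult.commute)
qed

text \<open>The correction 6d paid on a coincidence, times the constant in
  \<open>measure_two_rings\<close>.\<close>

definition dissipation_error :: real where
  "dissipation_error = 6 * real CARD('n) * (real (card influence) + real (card influence * card influence))"

text \<open>The factor 4 is twice 2: a ring at an unstable site removes at least two disagreements
  around it, and by translation the rings at the neighbours contribute as much as those at the
  origin.\<close>

lemma energy_step:
  assumes t: "t \<ge> 0" and \<delta>: "\<delta> \<ge> 0"
  shows "energy (t + \<delta>) \<le> energy t - 4 * ((1 - exp (- \<delta>)) * pr (\<lambda>\<omega>. unstable (\<sigma> \<omega> t) 0)) + dissipation_error * \<delta>\<^sup>2"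
proof -
  let ?Q = "two_rings influence \<delta>"
  have mD: "(\<lambda>\<omega>. real (disagreements (\<sigma> \<omega> u) 0)) \<in> borel_measurable ising_law" if "u \<ge> 0" for u
    using measurable_disagreements[OF that, of 0] by measurable
  have dle: "\<bar>real (disagreements s (0 :: 'n site))\<bar> \<le> 2 * real CARD('n)" for s
    using disagreements_le[of s 0] by (metis abs_of_nat of_nat_le_iff of_nat_mult of_nat_numeral)
  have m1: "(\<lambda>p. real (disagreements (\<sigma> (resample t p) (t + \<delta>)) 0)) \<in> borel_measurable MD"
    by (rule measurable_compose[OF measurable_resample mD]) (use t \<delta> in simp)
  have m2: "(\<lambda>p. real (disagreements (\<sigma> (fst p) t) 0)) \<in> borel_measurable MD"
    by (rule measurable_compose[OF measurable_fst mD[OF t]])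
  have mQ: "snd -` ?Q \<inter> space MD \<in> sets MD"
    by (rule measurable_sets[OF measurable_snd sets_two_rings[OF finite_influence]])
  have iQ: "integrable MD (\<lambda>p. indicator ?Q (snd p) :: real)"
    using sets_two_rings[OF finite_influence, of \<delta>]
    by (intro MD.integrable_const_bound[of _ 1] measurable_compose[OF measurable_snd borel_measurable_indicator]) auto
  note i = integrable_ring_change[OF t]
  have i1: "integrable MD (\<lambda>p. \<Sum>y\<in>nbrs 0. ring_change t \<delta> 0 y p)" "integrable MD (\<lambda>p. \<Sum>y\<in>nbrs 0. ring_change t \<delta> y 0 p)"
    by (intro Bochner_Integration.integrable_sum i)+
  have i2: "integrable MD (\<lambda>p. real (disagreements (\<sigma> (fst p) t) 0))"
    using dle by (intro MD.integrable_const_bound[OF _ m2, of "2 * real CARD('n)"]) auto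
  have i3: "integrable MD (\<lambda>p. real (disagreements (\<sigma> (resample t p) (t + \<delta>)) 0))"
    using dle by (intro MD.integrable_const_bound[OF _ m1, of "2 * real CARD('n)"]) auto
  have "energy (t + \<delta>) = (\<integral>\<omega>. real (disagreements (\<sigma> \<omega> (t + \<delta>)) 0) \<partial>distr MD ising_law (resample t))"
    unfolding energy_def by (subst distr_resample[OF t]) (rule refl)
  also have "\<dots> = (\<integral>p. real (disagreements (\<sigma> (resample t p) (t + \<delta>)) 0) \<partial>MD)"
    by (rule integral_distr[OF measurable_resample mD]) (use t \<delta> in simp)
  also have "\<dots> \<le> (\<integral>p. real (disagreements (\<sigma> (fst p) t) 0)
    + ((\<Sum>y\<in>nbrs 0. ring_change t \<delta> 0 y p) + (\<Sum>y\<in>nbrs 0. ring_change t \<delta> y 0 p))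
    + 6 * real CARD('n) * indicator ?Q (snd p) \<partial>MD)"
    using AE_resampled_ok[OF t] disagreements_resample_le[OF _ t \<delta>] i1 i2 iQ
    by (intro integral_mono_AE i3 Bochner_Integration.integrable_add integrable_mult_right) auto
  also have "\<dots> = (\<integral>p. real (disagreements (\<sigma> (fst p) t) 0) \<partial>MD)
     + ((\<integral>p. (\<Sum>y\<in>nbrs 0. ring_change t \<delta> 0 y p) \<partial>MD) + (\<integral>p. (\<Sum>y\<in>nbrs 0. ring_change t \<delta> y 0 p) \<partial>MD))
     + 6 * real CARD('n) * (\<integral>p. indicator ?Q (snd p) \<partial>MD)"
    using i1 i2 iQ by simp
  also have "(\<integral>p. real (disagreements (\<sigma> (fst p) t) 0) \<partial>MD) = energy t"
  proof -
    have "energy t = (\<integral>\<omega>. real (disagreements (\<sigma> \<omega> t) 0) \<partial>distr MD ising_law fst)"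
      unfolding energy_def by (subst dyn_law.distr_pair_fst) (rule refl)
    also have "\<dots> = (\<integral>p. real (disagreements (\<sigma> (fst p) t) 0) \<partial>MD)"
      by (rule integral_distr[OF measurable_fst mD[OF t]])
    finally show ?thesis by simp
  qed
  also have "(\<integral>p. (\<Sum>y\<in>nbrs 0. ring_change t \<delta> 0 y p) \<partial>MD) = (\<Sum>y\<in>nbrs 0. \<integral>p. ring_change t \<delta> 0 y p \<partial>MD)"
    by (rule Bochner_Integration.integral_sum[OF i])
  also have "(\<integral>p. (\<Sum>y\<in>nbrs 0. ring_change t \<delta> y 0 p) \<partial>MD) = (\<Sum>y\<in>nbrs 0. \<integral>p. ring_change t \<delta> 0 y p \<partial>MD)"
  proof -
    have "(\<integral>p. (\<Sum>y\<in>nbrs 0. ring_change t \<delta> y 0 p) \<partial>MD) = (\<Sum>y\<in>nbrs 0. \<integral>p. ring_change t \<delta> y 0 p \<partial>MD)"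
      by (rule Bochner_Integration.integral_sum[OF i])
    also have "\<dots> = (\<Sum>y\<in>nbrs 0. \<integral>p. ring_change t \<delta> 0 (- y) p \<partial>MD)"
      by (simp only: integral_ring_change_translate[OF t])
    also have "\<dots> = (\<Sum>y\<in>nbrs 0. \<integral>p. ring_change t \<delta> 0 y p \<partial>MD)"
      by (rule sum.reindex_bij_witness[of _ uminus uminus]) (auto intro: nbrs_0_minus)
    finally show ?thesis .
  qed
  also have "(\<integral>p. indicator ?Q (snd p) \<partial>MD) = measure dyn_law ?Q"
  proof -
    have "(\<integral>p. indicator ?Q (snd p) \<partial>MD) = (\<integral>p. indicator (space ising_law \<times> ?Q) p \<partial>MD)"
      by (intro Bochner_Integration.integral_cong) (auto simp: space_pair_measure indicator_def)
    also have "\<dots> = measure MD (space ising_law \<times> ?Q)"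
      using sets_two_rings[OF finite_influence, of \<delta>] sets.sets_into_space[of "space ising_law \<times> ?Q" MD]
      by (subst Bochner_Integration.integral_indicator) (auto simp: inf.absorb1)
    also have "\<dots> = measure dyn_law ?Q"
      using sets_two_rings[OF finite_influence, of \<delta>]
      by (simp add: measure_def dyn_law.emeasure_pair_measure_Times ising_law.emeasure_space_1)
    finally show ?thesis .
  qed
  also have "energy t + ((\<Sum>y\<in>nbrs 0. \<integral>p. ring_change t \<delta> 0 y p \<partial>MD) + (\<Sum>y\<in>nbrs 0. \<integral>p. ring_change t \<delta> 0 y p \<partial>MD))
     + 6 * real CARD('n) * measure dyn_law ?Q
    \<le> energy t - 4 * ((1 - exp (- \<delta>)) * pr (\<lambda>\<omega>. unstable (\<sigma> \<omega> t) 0)) + dissipation_error * \<delta>\<^sup>2"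
  proof -
    have "6 * real CARD('n) * measure dyn_law ?Q \<le> 6 * real CARD('n) * ((real (card influence) + real (card influence * card influence)) * \<delta>\<^sup>2)"
      by (intro mult_left_mono measure_two_rings finite_influence \<delta>) simp
    then show ?thesis
      using sum_integral_ring_change_le[OF t \<delta>] unfolding dissipation_error_def mult.assoc by linarith
  qed
  finally show ?thesis .
qed

end

subsection \<open>Isolated sets\<close>

text \<open>Connectedness is left out because removing a site may disconnect a cluster and the
  induction has to stay in one class of sets. The empty set qualifies vacuously, so nonemptiness is
  carried along separately.\<close>

definition isolated :: "('n::finite) config \<Rightarrow> 'n site set \<Rightarrow> bool" where
  "isolated s C \<longleftrightarrow> (\<forall>x\<in>C. \<forall>y\<in>C. s x = s y) \<and> (\<forall>x\<in>C. \<forall>y\<in>nbrs x - C. s y \<noteq> s x)"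

definition closed_nbhd :: "('n::finite) site set \<Rightarrow> 'n site set" where
  "closed_nbhd C = C \<union> (\<Union>x\<in>C. nbrs x)"

lemma finite_closed_nbhd: "finite C \<Longrightarrow> finite (closed_nbhd C)"
  by (simp add: closed_nbhd_def)

lemma isolatedD:
  assumes "isolated s C" "x \<in> C"
  shows "y \<in> C \<Longrightarrow> s y = s x" "y \<in> nbrs x \<Longrightarrow> y \<notin> C \<Longrightarrow> s y \<noteq> s x"
  using assms unfolding isolated_def by blast+

lemma isolated_cong:
  fixes s s' :: "'n::finite config"
  assumes "\<And>y. y \<in> closed_nbhd C \<Longrightarrow> s y = s' y"
  shows "isolated s C \<longleftrightarrow> isolated s' C"
proof -
  have "isolated s' C" if s: "isolated s C" and eq: "\<And>y. y \<in> closed_nbhd C \<Longrightarrow> s y = s' y" for s s' :: "'n config"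
  proof -
    have in_C: "s' x = s x" if "x \<in> C" for x using eq[of x] that by (simp add: closed_nbhd_def)
    have "s' y = s y" if "x \<in> C" "y \<in> nbrs x" for x y
    proof -
      have "y \<in> closed_nbhd C" using that by (auto simp: closed_nbhd_def)
      then show ?thesis by (simp add: eq)
    qed
    note nb = this
    show ?thesis
      unfolding isolated_def
    proof (intro conjI ballI)
      fix x y assume xy: "x \<in> C" "y \<in> C"
      then have "s x = s y" using s unfolding isolated_def by blast
      then show "s' x = s' y" by (simp only: in_C xy)
    next
      fix x y assume xy: "x \<in> C" "y \<in> nbrs x - C"
      then have "s y \<noteq> s x" using s unfolding isolated_def by blast
      then show "s' y \<noteq> s' x" using xy in_C[of x] nb[of x y] by simp
    qed
  qed
  then show ?thesis using assms by metis
qed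

lemma unstable_cong:
  assumes "\<And>y. y \<in> insert x (nbrs x) \<Longrightarrow> s y = s' y"
  shows "unstable s x \<longleftrightarrow> unstable s' x"
proof -
  have "{y \<in> nbrs x. s y \<noteq> s x} = {y \<in> nbrs x. s' y \<noteq> s' x}" using assms by auto
  then show ?thesis by (simp add: unstable_def disagreements_eq)
qed

lemma isolated_disagreements:
  assumes "isolated s C" "x \<in> C"
  shows "disagreements s x = card (nbrs x - C)"
proof -
  have "{y \<in> nbrs x. s y \<noteq> s x} = nbrs x - C"
    using isolatedD[OF assms] by blast
  then show ?thesis by (simp add: disagreements_eq)
qed

text \<open>After its flip \<open>x\<close> carries the sign opposite to the rest of
  \<open>C\<close> and joins the outer boundary. The spin must be nonzero for its negation to differ
  from it.\<close>

lemma isolated_remove: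
  assumes "isolated s C" "x \<in> C" "s x \<noteq> 0" "s' x = - s x"
    and "\<And>y. y \<in> closed_nbhd C \<Longrightarrow> y \<noteq> x \<Longrightarrow> s' y = s y"
  shows "isolated s' (C - {x})"
  unfolding isolated_def
proof (intro conjI ballI)
  fix y z assume "y \<in> C - {x}" "z \<in> C - {x}"
  then show "s' y = s' z"
    using isolatedD(1)[OF assms(1), of z y] assms(5)[of y] assms(5)[of z] by (simp add: closed_nbhd_def)
next
  fix y z assume y: "y \<in> C - {x}" and z: "z \<in> nbrs y - (C - {x})"
  have "s' y = s y" using y assms(5)[of y] by (simp add: closed_nbhd_def)
  show "s' z \<noteq> s' y"
  proof (cases "z = x")
    case True
    have "s y = s x" using isolatedD(1)[OF assms(1,2)] y by simp
    then show ?thesis using True assms(3,4) \<open>s' y = s y\<close> by simp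
  next
    case False
    have "z \<in> closed_nbhd C" using y z by (auto simp: closed_nbhd_def)
    then have "s' z = s z" using False by (rule assms(5))
    moreover have "s z \<noteq> s y" using isolatedD(2)[OF assms(1), of y z] y z False by simp
    ultimately show ?thesis using \<open>s' y = s y\<close> by simp
  qed
qed

definition quiet :: "('n::finite) site set \<Rightarrow> ('n site \<Rightarrow> clock) set" where
  "quiet B = {w. \<forall>x\<in>B. w x \<in> - first_ring_by 1}"

lemma sets_not_first_ring_by: "- first_ring_by \<delta> \<in> sets clock_law"
  using sets.compl_sets[OF sets_ring_events(1)[of \<delta>]] by (simp add: Compl_eq_Diff_UNIV)

lemma quiet:
  assumes "finite B"
  shows "quiet B \<in> sets dyn_law" "measure dyn_law (quiet B) > 0"
proof -
  show "quiet B \<in> sets dyn_law"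
    unfolding quiet_def by (intro sets_dyn_All assms sets_not_first_ring_by)
  have "measure dyn_law (quiet B) = (\<Prod>x\<in>B. measure clock_law (- first_ring_by 1))"
    unfolding quiet_def by (intro measure_dyn_All assms sets_not_first_ring_by)
  then show "measure dyn_law (quiet B) > 0" by (simp add: measure_not_first_ring_by)
qed

text \<open>Heads decides the tie at \<open>x\<close>, the long second wait prevents a flip back,
  and silence on the rest of \<open>B\<close> keeps the surroundings fixed.\<close>

definition lone_flip :: "('n::finite) site set \<Rightarrow> 'n site \<Rightarrow> ('n site \<Rightarrow> clock) set" where
  "lone_flip B x = {w. \<forall>y\<in>B. w y \<in> (if y = x then first_ring_by 1 \<inter> heads_first - second_wait_by 1 else - first_ring_by 1)}"

lemma lone_flip:
  assumes "finite B"
  shows "lone_flip B x \<in> sets dyn_law" "measure dyn_law (lone_flip B x) > 0"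
proof -
  let ?A = "\<lambda>y. if y = x then first_ring_by 1 \<inter> heads_first - second_wait_by 1 else - first_ring_by 1"
  have A: "?A y \<in> sets clock_law" for y
    using sets_not_first_ring_by sets_ring_events by auto
  show "lone_flip B x \<in> sets dyn_law"
    unfolding lone_flip_def by (intro sets_dyn_All assms A)
  have "measure dyn_law (lone_flip B x) = (\<Prod>y\<in>B. measure clock_law (?A y))"
    unfolding lone_flip_def by (intro measure_dyn_All assms A)
  also have "\<dots> > 0"
    using measure_single_heads_pos by (intro prod_pos) (auto simp: measure_not_first_ring_by)
  finally show "measure dyn_law (lone_flip B x) > 0" .
qed

context ising_trajectory
begin

text \<open>Bounds instability throughout a unit interval from below by its value at the left end,
  so that the dissipation over the interval is controlled by one integer time.\<close>

lemma prob_unstable_persists: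
  assumes "t \<ge> 0" "0 \<le> s" "s \<le> 1"
  shows "pr (\<lambda>\<omega>. unstable (\<sigma> \<omega> t) x) * measure dyn_law (quiet (insert x (nbrs x))) \<le> pr (\<lambda>\<omega>. unstable (\<sigma> \<omega> (t + s)) x)"
proof (rule resample_prob_le[OF assms(1)])
  fix p assume p: "resampled_ok t p" "unstable (\<sigma> (fst p) t) x" "snd p \<in> quiet (insert x (nbrs x))"
  have "\<sigma> (resample t p) (t + s) y = \<sigma> (fst p) t y" if "y \<in> insert x (nbrs x)" for y
    using p(3) that assms by (intro spin_stay[OF p(1), of s 1]) (auto simp: quiet_def)
  then show "unstable (\<sigma> (resample t p) (t + s)) x" using p(2) unstable_cong[of x "\<sigma> (resample t p) (t + s)" "\<sigma> (fst p) t"] by simp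
qed (use assms in \<open>auto intro: pred_unstable quiet(1)\<close>)

text \<open>Iterates \<open>energy_step\<close> over \<open>n\<close> steps of length 1/n: the
  losses of energy add up to order one, while the errors total \<open>dissipation_error\<close> / n
  and disappear as \<open>n\<close> grows.\<close>

lemma energy_drop:
  "energy (real k + 1) \<le> energy (real k) - 2 * measure dyn_law (quiet (insert 0 (nbrs (0 :: 'n site)))) * pr (\<lambda>\<omega>. unstable (\<sigma> \<omega> (real k)) 0)"
    (is "_ \<le> _ - 2 * ?q * ?u (real k)")
proof -
  let ?K = dissipation_error
  have q: "?q > 0" by (rule quiet) simp
  have step: "energy (real k + 1) \<le> energy (real k) - 2 * ?q * ?u (real k) + ?K / real n" if n: "n \<ge> 1" for n
  proof -
    define \<delta> where "\<delta> = 1 / real n"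
    have \<delta>: "0 < \<delta>" "\<delta> \<le> 1" using n by (auto simp: \<delta>_def)
    \<comment> \<open>The lower bound \<delta> / 2 for 1 - exp (- \<delta>) on (0, 1] is what halves
      the constant 4 of a single step to 2.\<close>
    have "exp (- \<delta>) \<le> 1 - \<delta> / 2"
    proof -
      have "exp (- \<delta>) = 1 / exp \<delta>" by (simp add: exp_minus divide_inverse)
      also have "\<dots> \<le> 1 / (1 + \<delta>)" using \<delta> by (intro divide_left_mono) auto
      also have "\<dots> \<le> 1 - \<delta> / 2" using \<delta> by (simp add: field_simps)
      finally show ?thesis .
    qed
    then have e: "\<delta> / 2 \<le> 1 - exp (- \<delta>)" by simp
    have "energy (real k + real j * \<delta>) \<le> energy (real k) - real j * (2 * \<delta> * ?q * ?u (real k) - ?K * \<delta>\<^sup>2)" if "j \<le> n" for j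
      using that
    proof (induction j)
      case (Suc j)
      have j: "0 \<le> real j * \<delta>" "real j * \<delta> \<le> 1" using Suc.prems n \<delta> by (auto simp: \<delta>_def)
      have "?u (real k) * ?q \<le> ?u (real k + real j * \<delta>)"
        by (rule prob_unstable_persists) (use j in auto)
      then have "\<delta> / 2 * (?u (real k) * ?q) \<le> (1 - exp (- \<delta>)) * ?u (real k + real j * \<delta>)"
        using e \<delta> q by (intro mult_mono) auto
      moreover have "energy (real k + real j * \<delta> + \<delta>) \<le> energy (real k + real j * \<delta>)
          - 4 * ((1 - exp (- \<delta>)) * ?u (real k + real j * \<delta>)) + ?K * \<delta>\<^sup>2"
        by (rule energy_step) (use j \<delta> in auto)
      moreover have "energy (real k + real j * \<delta>) \<le> energy (real k) - real j * (2 * \<delta> * ?q * ?u (real k) - ?K * \<delta>\<^sup>2)"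
        using Suc by simp
      ultimately have "energy (real k + real j * \<delta> + \<delta>) \<le> energy (real k) - real j * (2 * \<delta> * ?q * ?u (real k) - ?K * \<delta>\<^sup>2)
          - 4 * (\<delta> / 2 * (?u (real k) * ?q)) + ?K * \<delta>\<^sup>2"
        by linarith
      then show ?case by (simp add: algebra_simps)
    qed simp
    from this[of n] have "energy (real k + 1) \<le> energy (real k) - real n * (2 * \<delta> * ?q * ?u (real k) - ?K * \<delta>\<^sup>2)"
      using n by (simp add: \<delta>_def)
    also have "real n * (2 * \<delta> * ?q * ?u (real k) - ?K * \<delta>\<^sup>2) = 2 * ?q * ?u (real k) - ?K / real n"
      using n by (simp add: \<delta>_def field_simps power2_eq_square)
    finally show ?thesis by simp
  qed
  have "(\<lambda>n. energy (real k) - 2 * ?q * ?u (real k) + ?K / real n) \<longlonglongrightarrow> energy (real k) - 2 * ?q * ?u (real k) + 0"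
    by (intro tendsto_add tendsto_const lim_const_over_n)
  moreover have "\<forall>n\<ge>1. energy (real k + 1) \<le> energy (real k) - 2 * ?q * ?u (real k) + ?K / real n"
    using step by blast
  ultimately have "energy (real k + 1) \<le> energy (real k) - 2 * ?q * ?u (real k) + 0"
    by (intro LIMSEQ_le_const) blast+
  then show ?thesis by simp
qed

text \<open>The drops over unit intervals telescope and the energy is nonnegative, so their sum is
  at most the energy at time 0. Translation passes from the origin to \<open>x\<close>.\<close>

lemma summable_unstable: "summable (\<lambda>k. pr (\<lambda>\<omega>. unstable (\<sigma> \<omega> (real k)) x))"
proof -
  let ?q = "measure dyn_law (quiet (insert 0 (nbrs (0 :: 'n site))))"
  let ?u = "\<lambda>k. pr (\<lambda>\<omega>. unstable (\<sigma> \<omega> (real k)) 0)"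
  have q: "?q > 0" by (rule quiet) simp
  have nonneg: "energy t \<ge> 0" for t unfolding energy_def by (rule Bochner_Integration.integral_nonneg) simp
  have "(\<Sum>k<n. 2 * ?q * ?u k) \<le> energy 0 - energy (real n)" for n
  proof (induction n)
    case (Suc n)
    show ?case using Suc energy_drop[of n] by (simp add: add.commute)
  qed simp
  then have "(\<Sum>k<n. 2 * ?q * ?u k) \<le> energy 0" for n
    using nonneg[of "real n"] by (smt (verit))
  then have "summable (\<lambda>k. 2 * ?q * ?u k)"
    by (intro summableI_nonneg_bounded) (use q in auto)
  then have "summable ?u" using q by (subst (asm) summable_cmult_iff) auto
  then show ?thesis by (simp only: prob_unstable_translate[of "real _" x] of_nat_0_le_iff)
qed

lemma pred_isolated:
  assumes "t \<ge> 0" "finite C"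
  shows "Measurable.pred ising_law (\<lambda>\<omega>. isolated (\<sigma> \<omega> t) C)"
proof -
  note measurable_spin[OF assms(1), measurable]
  show ?thesis
    unfolding isolated_def using assms(2) by (intro pred_intros_logic pred_intros_finite) auto
qed

text \<open>Which alternative holds depends only on the shape of \<open>C\<close>: on an isolated
  \<open>C\<close> the disagreeing neighbours of \<open>x\<close> are exactly those outside
  \<open>C\<close>, which are more than d or exactly d. Hence one \<open>x\<close> and one
  \<open>p\<close> serve all times.\<close>

lemma prob_isolated_le:
  assumes "finite C" "C \<noteq> {}"
  obtains x where "x \<in> C" and 
    "(\<forall>t\<ge>0. pr (\<lambda>\<omega>. isolated (\<sigma> \<omega> t) C) \<le> pr (\<lambda>\<omega>. unstable (\<sigma> \<omega> t) x)) \<or>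
     C - {x} \<noteq> {} \<and> (\<exists>p>0. \<forall>t\<ge>0. pr (\<lambda>\<omega>. isolated (\<sigma> \<omega> t) C) * p \<le> pr (\<lambda>\<omega>. isolated (\<sigma> \<omega> (t + 1)) (C - {x})))"
proof -
  obtain x where x: "x \<in> C" "card (nbrs x - C) \<ge> CARD('n)"
    using exists_exposed_site[OF assms] by blast
  show thesis
  proof (cases "card (nbrs x - C) > CARD('n)")
    case True
    have "pr (\<lambda>\<omega>. isolated (\<sigma> \<omega> t) C) \<le> pr (\<lambda>\<omega>. unstable (\<sigma> \<omega> t) x)" if "t \<ge> 0" for t
    proof (rule ising_law.finite_measure_mono)
      show "{\<omega> \<in> space ising_law. isolated (\<sigma> \<omega> t) C} \<subseteq> {\<omega> \<in> space ising_law. unstable (\<sigma> \<omega> t) x}"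
        using True isolated_disagreements[OF _ x(1)] by (auto simp: unstable_def)
      show "{\<omega> \<in> space ising_law. unstable (\<sigma> \<omega> t) x} \<in> sets ising_law"
        using pred_unstable[OF that] by (simp add: pred_def)
    qed
    then show thesis using that[OF x(1)] by blast
  next
    case False
    then have D: "card (nbrs x - C) = CARD('n)" using x by simp
    let ?B = "closed_nbhd C"
    note fB = finite_closed_nbhd[OF assms(1)]
    \<comment> \<open>A one-point set has all 2d neighbours outside, which is not a tie because d is
      positive.\<close>
    have "C - {x} \<noteq> {}"
    proof
      assume "C - {x} = {}"
      then have "nbrs x - C = nbrs x" using x nbrs_irrefl[of x] by auto
      then show False using D card_nbrs[of x] by simp
    qed
    moreover have "pr (\<lambda>\<omega>. isolated (\<sigma> \<omega> t) C) * measure dyn_law (lone_flip ?B x) \<le> pr (\<lambda>\<omega>. isolated (\<sigma> \<omega> (t + 1)) (C - {x}))"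
      if t: "t \<ge> 0" for t
    proof (rule resample_prob_le[OF t])
      fix p assume p: "resampled_ok t p" "isolated (\<sigma> (fst p) t) C" "snd p \<in> lone_flip ?B x"
      have xB: "x \<in> ?B" "nbrs x \<subseteq> ?B" using x by (auto simp: closed_nbhd_def)
      have px: "snd p x \<in> first_ring_by 1" "snd p x \<notin> second_wait_by 1" "snd (snd p x 0)"
        using p(3) xB(1) by (auto simp: lone_flip_def heads_first_def)
      have py: "snd p y \<notin> first_ring_by 1" if "y \<in> ?B" "y \<noteq> x" for y
        using p(3) that by (auto simp: lone_flip_def)
      show "isolated (\<sigma> (resample t p) (t + 1)) (C - {x})"
      proof (rule isolated_remove[OF p(2) x(1)])
        show "\<sigma> (fst p) t x \<noteq> 0" using typicalD(4)[of "fst p" t x] p(1) t by (auto simp: resampled_ok_def)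
        have "\<sigma> (resample t p) (t + 1) x = updated_spin (\<sigma> (fst p) t) x (snd (snd p x 0))"
          using py xB nbrs_irrefl[of x] by (intro spin_flip[OF p(1) t px(1,2)]) blast
        then show "\<sigma> (resample t p) (t + 1) x = - \<sigma> (fst p) t x"
          using isolated_disagreements[OF p(2) x(1)] D px(3) by (simp add: updated_spin_def)
        show "\<sigma> (resample t p) (t + 1) y = \<sigma> (fst p) t y" if "y \<in> ?B" "y \<noteq> x" for y
          using py[OF that] by (intro spin_stay[OF p(1) t, of 1 1]) auto
      qed
    qed (use t assms(1) in \<open>auto intro!: pred_isolated lone_flip fB\<close>)
    ultimately show thesis using that[OF x(1)] lone_flip(2)[OF fB] by blast
  qed
qed

text \<open>In the tie case the series for \<open>C\<close> is dominated by the shifted series for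
  the smaller set \<open>C - {x}\<close>, divided by \<open>p\<close>; the unstable case needs no
  smaller set and closes the induction.\<close>

lemma summable_isolated:
  assumes "finite C" "C \<noteq> {}"
  shows "summable (\<lambda>k. pr (\<lambda>\<omega>. isolated (\<sigma> \<omega> (real k)) C))"
  using assms
proof (induction C rule: finite_psubset_induct)
  case (psubset C)
  obtain x where x: "x \<in> C" and 
    "(\<forall>t\<ge>0. pr (\<lambda>\<omega>. isolated (\<sigma> \<omega> t) C) \<le> pr (\<lambda>\<omega>. unstable (\<sigma> \<omega> t) x)) \<or>
     C - {x} \<noteq> {} \<and> (\<exists>p>0. \<forall>t\<ge>0. pr (\<lambda>\<omega>. isolated (\<sigma> \<omega> t) C) * p \<le> pr (\<lambda>\<omega>. isolated (\<sigma> \<omega> (t + 1)) (C - {x})))"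
    using prob_isolated_le[OF psubset.hyps psubset.prems] by blast
  then show ?case
  proof (elim disjE conjE exE)
    assume "\<forall>t\<ge>0. pr (\<lambda>\<omega>. isolated (\<sigma> \<omega> t) C) \<le> pr (\<lambda>\<omega>. unstable (\<sigma> \<omega> t) x)"
    then show ?thesis
      by (intro summable_comparison_test'[OF summable_unstable[of x], of 0]) simp
  next
    fix p assume ne: "C - {x} \<noteq> {}" and p: "p > 0"
      "\<forall>t\<ge>0. pr (\<lambda>\<omega>. isolated (\<sigma> \<omega> t) C) * p \<le> pr (\<lambda>\<omega>. isolated (\<sigma> \<omega> (t + 1)) (C - {x}))"
    have "summable (\<lambda>k. pr (\<lambda>\<omega>. isolated (\<sigma> \<omega> (real k)) (C - {x})))"
      using psubset.IH[of "C - {x}"] x ne by blast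
    then have "summable (\<lambda>k. pr (\<lambda>\<omega>. isolated (\<sigma> \<omega> (real (Suc k))) (C - {x})))"
      by (subst summable_Suc_iff)
    then have s: "summable (\<lambda>k. pr (\<lambda>\<omega>. isolated (\<sigma> \<omega> (real k + 1)) (C - {x})) / p)"
      by (intro summable_divide) (simp add: add.commute)
    have "norm (pr (\<lambda>\<omega>. isolated (\<sigma> \<omega> (real k)) C)) \<le> pr (\<lambda>\<omega>. isolated (\<sigma> \<omega> (real k + 1)) (C - {x})) / p" for k
      using p(1) p(2)[rule_format, of "real k"] by (simp add: pos_le_divide_eq)
    then show ?thesis by (intro summable_comparison_test'[OF s, of 0])
  qed
qed

text \<open>Decompose according to the first time in \<open>F\<close> at which \<open>C\<close> is isolated, and let all clocks
  near \<open>C\<close> be silent from then on until time \<open>k + 1\<close>.\<close>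

lemma prob_isolated_at_some_time:
  assumes C: "finite C" and F: "finite F" "F \<subseteq> {real k..real k + 1}"
  shows "pr (\<lambda>\<omega>. \<exists>t\<in>F. isolated (\<sigma> \<omega> t) C) * measure dyn_law (quiet (closed_nbhd C))
    \<le> pr (\<lambda>\<omega>. isolated (\<sigma> \<omega> (real k + 1)) C)"
proof -
  let ?q = "measure dyn_law (quiet (closed_nbhd C))"
  note Q = quiet[OF finite_closed_nbhd[OF C]]
  define E where "E t \<omega> \<longleftrightarrow> isolated (\<sigma> \<omega> t) C \<and> (\<forall>s\<in>{s \<in> F. s < t}. \<not> isolated (\<sigma> \<omega> s) C)" for t \<omega>
  have F0: "0 \<le> t" "t \<le> real k + 1" "real k \<le> t" if "t \<in> F" for t using F(2) that by auto
  have mI: "Measurable.pred ising_law (\<lambda>\<omega>. isolated (\<sigma> \<omega> t) C)" if "t \<ge> 0" for t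
    using pred_isolated[OF that C] .
  have mE: "Measurable.pred ising_law (E t)" if "t \<in> F" for t
    unfolding E_def using F that F0 by (intro pred_intros_logic pred_intros_finite mI) auto
  have mG: "Measurable.pred ising_law (\<lambda>\<omega>. E t \<omega> \<and> isolated (\<sigma> \<omega> (real k + 1)) C)" if "t \<in> F" for t
    using mE[OF that] mI[of "real k + 1"] by (intro pred_intros_logic) auto
  have one: "pr (E t) * ?q \<le> pr (\<lambda>\<omega>. E t \<omega> \<and> isolated (\<sigma> \<omega> (real k + 1)) C)" if t: "t \<in> F" for t
  proof (rule resample_prob_le[OF F0(1)[OF t] mE[OF t] Q(1) mG[OF t]])
    fix p assume p: "resampled_ok t p" "E t (fst p)" "snd p \<in> quiet (closed_nbhd C)"
    have same: "\<sigma> (resample t p) s = \<sigma> (fst p) s" if "s \<in> F" "s \<le> t" for s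
      using p(1) F0[OF that(1)] that(2) by (simp add: resampled_ok_def)
    then have "E t (resample t p)" using p(2) t by (auto simp: E_def)
    moreover have "\<sigma> (resample t p) (t + (real k + 1 - t)) y = \<sigma> (fst p) t y" if "y \<in> closed_nbhd C" for y
      using p(3) that F0[OF t] by (intro spin_stay[OF p(1), of _ 1]) (auto simp: quiet_def)
    then have "isolated (\<sigma> (resample t p) (real k + 1)) C \<longleftrightarrow> isolated (\<sigma> (fst p) t) C"
      by (intro isolated_cong) simp
    ultimately show "E t (resample t p) \<and> isolated (\<sigma> (resample t p) (real k + 1)) C"
      using p(2) by (simp add: E_def)
  qed
  have "{\<omega> \<in> space ising_law. \<exists>t\<in>F. isolated (\<sigma> \<omega> t) C} \<subseteq> (\<Union>t\<in>F. {\<omega> \<in> space ising_law. E t \<omega>})"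
  proof
    fix \<omega> assume "\<omega> \<in> {\<omega> \<in> space ising_law. \<exists>t\<in>F. isolated (\<sigma> \<omega> t) C}"
    then have \<omega>: "\<omega> \<in> space ising_law" and ne: "{t \<in> F. isolated (\<sigma> \<omega> t) C} \<noteq> {}" by auto
    have fin: "finite {t \<in> F. isolated (\<sigma> \<omega> t) C}" using F by simp
    define m where "m = Min {t \<in> F. isolated (\<sigma> \<omega> t) C}"
    have "m \<in> {t \<in> F. isolated (\<sigma> \<omega> t) C}" unfolding m_def using fin ne by (rule Min_in)
    moreover have "\<not> isolated (\<sigma> \<omega> s) C" if "s \<in> F" "s < m" for s
      using Min_le[OF fin, of s] that by (auto simp: m_def)
    ultimately have "m \<in> F" "E m \<omega>" by (auto simp: E_def)
    then show "\<omega> \<in> (\<Union>t\<in>F. {\<omega> \<in> space ising_law. E t \<omega>})" using \<omega> by auto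
  qed
  then have "pr (\<lambda>\<omega>. \<exists>t\<in>F. isolated (\<sigma> \<omega> t) C) \<le> measure ising_law (\<Union>t\<in>F. {\<omega> \<in> space ising_law. E t \<omega>})"
    using mE F(1) by (intro ising_law.finite_measure_mono sets.finite_UN) (auto simp: pred_def)
  also have "\<dots> \<le> (\<Sum>t\<in>F. pr (E t))"
    using mE F(1) by (intro ising_law.finite_measure_subadditive_finite) (auto simp: pred_def)
  finally have "pr (\<lambda>\<omega>. \<exists>t\<in>F. isolated (\<sigma> \<omega> t) C) * ?q \<le> (\<Sum>t\<in>F. pr (E t)) * ?q"
    using Q(2) by (intro mult_right_mono) auto
  also have "\<dots> \<le> (\<Sum>t\<in>F. pr (\<lambda>\<omega>. E t \<omega> \<and> isolated (\<sigma> \<omega> (real k + 1)) C))"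
    unfolding sum_distrib_right by (rule sum_mono[OF one])
  \<comment> \<open>Distinct first times exclude each other. This keeps the sum over
    \<open>F\<close> below a single probability, independently of the size of
    \<open>F\<close>.\<close>
  also have "\<dots> = measure ising_law (\<Union>t\<in>F. {\<omega> \<in> space ising_law. E t \<omega> \<and> isolated (\<sigma> \<omega> (real k + 1)) C})"
  proof (rule ising_law.finite_measure_finite_Union[symmetric])
    show "disjoint_family_on (\<lambda>t. {\<omega> \<in> space ising_law. E t \<omega> \<and> isolated (\<sigma> \<omega> (real k + 1)) C}) F"
    proof (unfold disjoint_family_on_def, intro ballI impI)
      fix t u assume "t \<in> F" "u \<in> F" "t \<noteq> u"
      then have "\<not> (E t \<omega> \<and> E u \<omega>)" for \<omega> by (cases "t < u") (auto simp: E_def)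
      then show "{\<omega> \<in> space ising_law. E t \<omega> \<and> isolated (\<sigma> \<omega> (real k + 1)) C} \<inter>
        {\<omega> \<in> space ising_law. E u \<omega> \<and> isolated (\<sigma> \<omega> (real k + 1)) C} = {}" by auto
    qed
  qed (use mG F(1) in \<open>auto simp: pred_def\<close>)
  also have "\<dots> \<le> pr (\<lambda>\<omega>. isolated (\<sigma> \<omega> (real k + 1)) C)"
    using mI[of "real k + 1"] by (intro ising_law.finite_measure_mono) (auto simp: pred_def)
  finally show ?thesis .
qed

text \<open>Rings at the finitely many sites of \<open>B\<close> are locally finite and take effect
  at their own time, so the spins on \<open>B\<close> rest on a short interval starting at
  \<open>t\<close>. A rational \<open>r\<close> in it reduces all real times to countably
  many.\<close>

lemma spin_right_constant:
  assumes "typical \<omega>" "finite B" "t \<ge> 0" "t < T"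
  obtains r where "r \<in> \<rat>" "t < r" "r < T" "\<And>y. y \<in> B \<Longrightarrow> \<sigma> \<omega> r y = \<sigma> \<omega> t y"
proof -
  let ?M = "(\<Union>y\<in>B. fst ` {m \<in> marks (snd \<omega> y). fst m \<le> T}) \<inter> {t<..}"
  have fin: "finite (insert T ?M)" using assms(2) finite_marks[OF typicalD(2)[OF assms(1)]] by auto
  define \<tau> where "\<tau> = Min (insert T ?M)"
  have "\<tau> \<in> insert T ?M" unfolding \<tau>_def using fin by (intro Min_in) auto
  then have "t < \<tau>" using assms(4) by auto
  have "\<tau> \<le> T" unfolding \<tau>_def using fin by (intro Min_le) auto
  have none: "\<not> (t < fst m \<and> fst m < \<tau>)" if "y \<in> B" "m \<in> marks (snd \<omega> y)" for y m
  proof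
    assume m: "t < fst m \<and> fst m < \<tau>"
    then have "m \<in> {m \<in> marks (snd \<omega> y). fst m \<le> T}" "fst m \<in> {t<..}"
      using that \<open>\<tau> \<le> T\<close> by auto
    then have "fst m \<in> ?M" using that(1) by blast
    then have "\<tau> \<le> fst m" unfolding \<tau>_def using fin by (intro Min_le) auto
    then show False using m by simp
  qed
  obtain r where r: "r \<in> \<rat>" "t < r" "r < \<tau>" using Rats_dense_in_real[OF \<open>t < \<tau>\<close>] by blast
  show thesis
  proof (rule that[OF r(1,2)])
    show "r < T" using r \<open>\<tau> \<le> T\<close> by simp
    show "\<sigma> \<omega> r y = \<sigma> \<omega> t y" if "y \<in> B" for y
      using none[OF that] r assms(3) by (intro ising_path_const[OF typicalD(3)[OF assms(1)]]) fastforce+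
  qed
qed

text \<open>Summability along integer times says nothing about sets isolated only between them.
  Borel-Cantelli is therefore applied to isolation at some rational time of [k, k + 1], whose
  probability is at most a constant times that of isolation at time k + 1.\<close>

lemma AE_eventually_not_isolated:
  assumes C: "finite C" "C \<noteq> {}"
  shows "AE \<omega> in ising_law. \<forall>\<^sub>F t in at_top. \<not> isolated (\<sigma> \<omega> t) C"
proof -
  let ?q = "measure dyn_law (quiet (closed_nbhd C))"
  note Q = quiet[OF finite_closed_nbhd[OF C(1)]]
  define R where "R k = \<rat> \<inter> {real k..real k + 1}" for k
  define A where "A k = {\<omega> \<in> space ising_law. \<exists>t\<in>R k. isolated (\<sigma> \<omega> t) C}" for k
  have Rne: "R k \<noteq> {}" "countable (R k)" for k
  proof -
    have "real k \<in> R k" by (simp add: R_def)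
    then show "R k \<noteq> {}" by blast
    show "countable (R k)" unfolding R_def by (intro countable_Int1 countable_rat)
  qed
  have R0: "t \<ge> 0" if "t \<in> R k" for t k using that by (auto simp: R_def)
  have S: "{\<omega> \<in> space ising_law. isolated (\<sigma> \<omega> t) C} \<in> sets ising_law" if "t \<ge> 0" for t
    using pred_isolated[OF that C(1)] by (simp add: pred_def)
  have mA: "A k \<in> sets ising_law" and le: "measure ising_law (A k) * ?q \<le> pr (\<lambda>\<omega>. isolated (\<sigma> \<omega> (real k + 1)) C)" for k
  proof -
    \<comment> \<open>Finite sets of times exhausting the rationals of the interval; the bound for
      finite sets is uniform in \<open>n\<close> and passes to the increasing union.\<close>
    define F where "F n = from_nat_into (R k) ` {..n}" for n
    define A' where "A' n = {\<omega> \<in> space ising_law. \<exists>t\<in>F n. isolated (\<sigma> \<omega> t) C}" for n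
    have FR: "F n \<subseteq> R k" for n unfolding F_def using from_nat_into[OF Rne(1)] by auto
    have UF: "(\<Union>n. F n) = R k"
    proof
      show "R k \<subseteq> (\<Union>n. F n)"
      proof
        fix t assume "t \<in> R k"
        then obtain n where "t = from_nat_into (R k) n" using from_nat_into_surj[OF Rne(2)] by metis
        then have "t \<in> F n" by (simp add: F_def)
        then show "t \<in> (\<Union>n. F n)" by blast
      qed
    qed (use FR in auto)
    have mA': "A' n \<in> sets ising_law" for n
    proof -
      have "A' n = (\<Union>t\<in>F n. {\<omega> \<in> space ising_law. isolated (\<sigma> \<omega> t) C})" by (auto simp: A'_def)
      moreover have "\<dots> \<in> sets ising_law"
        using FR[of n] R0 by (intro sets.finite_UN S) (auto simp: F_def)
      ultimately show ?thesis by simp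
    qed
    have UA: "(\<Union>n. A' n) = A k" unfolding A'_def A_def UF[symmetric] by blast
    then show "A k \<in> sets ising_law" using sets.countable_UN[of A' UNIV ising_law] mA' by auto
    have "incseq A'"
      unfolding incseq_def A'_def F_def by (auto intro: le_trans)
    then have "(\<lambda>n. measure ising_law (A' n)) \<longlonglongrightarrow> measure ising_law (\<Union>n. A' n)"
      using mA' by (intro ising_law.finite_Lim_measure_incseq) auto
    then have "(\<lambda>n. measure ising_law (A' n) * ?q) \<longlonglongrightarrow> measure ising_law (A k) * ?q"
      unfolding UA by (rule tendsto_mult_right)
    moreover have "measure ising_law (A' n) * ?q \<le> pr (\<lambda>\<omega>. isolated (\<sigma> \<omega> (real k + 1)) C)" for n
      unfolding A'_def using FR[of n] by (intro prob_isolated_at_some_time C) (auto simp: F_def R_def)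
    ultimately show "measure ising_law (A k) * ?q \<le> pr (\<lambda>\<omega>. isolated (\<sigma> \<omega> (real k + 1)) C)"
      by (intro LIMSEQ_le_const2) blast+
  qed
  have "summable (\<lambda>k. pr (\<lambda>\<omega>. isolated (\<sigma> \<omega> (real (Suc k))) C))"
    using summable_isolated[OF C] by (subst summable_Suc_iff)
  then have s: "summable (\<lambda>k. pr (\<lambda>\<omega>. isolated (\<sigma> \<omega> (real k + 1)) C) / ?q)"
    by (intro summable_divide) (simp add: add.commute)
  have "norm (measure ising_law (A k)) \<le> pr (\<lambda>\<omega>. isolated (\<sigma> \<omega> (real k + 1)) C) / ?q" for k
    using le[of k] Q(2) by (simp add: field_simps)
  then have "summable (\<lambda>k. measure ising_law (A k))"
    by (intro summable_comparison_test'[OF s, of 0])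
  then have "AE \<omega> in ising_law. \<forall>\<^sub>F k in sequentially. \<omega> \<in> space ising_law - A k"
    using mA by (intro borel_cantelli_AE1) (auto simp: ising_law.emeasure_eq_measure)
  then show ?thesis using AE_typical
  proof eventually_elim
    case (elim \<omega>)
    then obtain K where K: "\<And>k. k \<ge> K \<Longrightarrow> \<omega> \<in> space ising_law - A k"
      by (auto simp: eventually_sequentially)
    have "\<not> isolated (\<sigma> \<omega> t) C" if t: "t \<ge> real K" for t
    proof
      assume iso: "isolated (\<sigma> \<omega> t) C"
      define k where "k = nat \<lfloor>t\<rfloor>"
      have t0: "t \<ge> 0" using t by (meson of_nat_0_le_iff order_trans)
      have k: "real k \<le> t" "t < real k + 1" "K \<le> k"
        using t t0 unfolding k_def by (auto simp: le_nat_floor)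
      obtain r where r: "r \<in> \<rat>" "t < r" "r < real k + 1" "\<And>y. y \<in> closed_nbhd C \<Longrightarrow> \<sigma> \<omega> r y = \<sigma> \<omega> t y"
        using spin_right_constant[OF elim(2) finite_closed_nbhd[OF C(1)] t0 k(2)] by blast
      have "isolated (\<sigma> \<omega> r) C" using iso isolated_cong[of C "\<sigma> \<omega> r" "\<sigma> \<omega> t"] r(4) by simp
      moreover have "r \<in> R k" using r k by (auto simp: R_def)
      ultimately show False using K[OF k(3)] by (auto simp: A_def)
    qed
    then show ?case by (auto simp: eventually_at_top_linorder)
  qed
qed

end

subsection \<open>Clusters\<close>

text \<open>The ball of radius \<open>n\<close> about the origin in graph distance.\<close>

primrec nbhd_iter :: "nat \<Rightarrow> ('n::finite) site set" where
  "nbhd_iter 0 = {0}"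
| "nbhd_iter (Suc n) = closed_nbhd (nbhd_iter n)"

lemma finite_nbhd_iter: "finite (nbhd_iter n)"
  by (induction n) (auto simp: finite_closed_nbhd)

lemma zero_in_nbhd_iter: "0 \<in> nbhd_iter n"
  by (induction n) (auto simp: closed_nbhd_def)

text \<open>While \<open>A\<close> is not inside the ball, a path in \<open>A\<close> from the
  origin leaves the ball by an edge, so increasing the radius by one captures a new site of
  \<open>A\<close>. At radius \<open>card A\<close> this would give more sites than \<open>A\<close>
  has.\<close>

lemma connected_subset_nbhd_iter:
  assumes "nn_connected A" "0 \<in> A" "finite A"
  shows "A \<subseteq> nbhd_iter (card A)"
proof -
  have "A \<subseteq> nbhd_iter n \<or> card (A \<inter> nbhd_iter n) \<ge> Suc n" for n
  proof (induction n)
    case 0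
    have "0 < card (A \<inter> nbhd_iter 0)" using assms by (subst card_gt_0_iff) auto
    then show ?case by simp
  next
    case (Suc n)
    show ?case
    proof (cases "A \<subseteq> nbhd_iter n")
      case True
      then show ?thesis by (auto simp: closed_nbhd_def)
    next
      case False
      then obtain a where a: "a \<in> A" "a \<notin> nbhd_iter n" by blast
      have "(0, a) \<in> {(u, v). u \<in> A \<and> v \<in> A \<and> nearest_neighbors u v}\<^sup>*"
        using assms a by (simp add: nn_connected_def)
      then have "a \<in> nbhd_iter n \<or> (\<exists>u\<in>A \<inter> nbhd_iter n. \<exists>v\<in>A - nbhd_iter n. nearest_neighbors u v)"
      proof (induction rule: rtrancl_induct)
        case base
        then show ?case by (simp add: zero_in_nbhd_iter)
      next
        case (step y z)
        then show ?case by auto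
      qed
      then obtain u v where uv: "u \<in> A \<inter> nbhd_iter n" "v \<in> A - nbhd_iter n" "nearest_neighbors u v"
        using a by blast
      then have "insert v (A \<inter> nbhd_iter n) \<subseteq> A \<inter> nbhd_iter (Suc n)"
        by (auto simp: closed_nbhd_def nbrs_def)
      then have "card (insert v (A \<inter> nbhd_iter n)) \<le> card (A \<inter> nbhd_iter (Suc n))"
        using assms(3) by (intro card_mono) auto
      then show ?thesis using Suc False uv assms(3) by auto
    qed
  qed
  from this[of "card A"] show ?thesis
    using card_mono[of A "A \<inter> nbhd_iter (card A)"] assms(3) by auto
qed

lemma nn_connected_insert:
  assumes "nn_connected A" "x \<in> A" "nearest_neighbors x y"
  shows "nn_connected (insert y A)"
proof -
  let ?R = "\<lambda>A. {(u, v). u \<in> A \<and> v \<in> A \<and> nearest_neighbors u v}"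
  have "(?R A)\<^sup>* \<subseteq> (?R (insert y A))\<^sup>*" by (intro rtrancl_mono) auto
  then have A: "(a, b) \<in> (?R (insert y A))\<^sup>*" if "a \<in> A" "b \<in> A" for a b
    using assms(1) that unfolding nn_connected_def by blast
  have xy: "(x, y) \<in> (?R (insert y A))\<^sup>*" "(y, x) \<in> (?R (insert y A))\<^sup>*"
    using assms(2,3) by (auto simp: nearest_neighbors_def dist_commute intro!: r_into_rtrancl)
  have "(a, x) \<in> (?R (insert y A))\<^sup>*" "(x, a) \<in> (?R (insert y A))\<^sup>*" if "a \<in> insert y A" for a
    using that A assms(2) xy by auto
  then show ?thesis unfolding nn_connected_def by (blast intro: rtrancl_trans)
qed

text \<open>An agreeing neighbour outside could be added without losing connectedness, against the
  maximality of the cluster.\<close>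

lemma isolated_cluster: "isolated s (cluster s x)"
  unfolding isolated_def
proof (intro conjI ballI)
  note cl = cluster_greatest[where s = s and x = x]
  show "s y = s z" if "y \<in> cluster s x" "z \<in> cluster s x" for y z using cl(3) that by simp
  show "s z \<noteq> s y" if y: "y \<in> cluster s x" and z: "z \<in> nbrs y - cluster s x" for y z
  proof
    assume "s z = s y"
    have "insert z (cluster s x) \<subseteq> cluster s x"
    proof (rule cl(4))
      show "x \<in> insert z (cluster s x)" using cl(1) by (rule insertI2)
      show "nn_connected (insert z (cluster s x))"
        using z by (intro nn_connected_insert[OF cl(2) y]) (simp add: nbrs_def)
      have "s z = s x" using \<open>s z = s y\<close> bspec[OF cl(3) y] by (rule trans)
      then show "\<forall>u\<in>insert z (cluster s x). s u = s x" using cl(3) by (rule ball_insert[THEN iffD2, OF conjI])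
    qed
    then show False using z by simp
  qed
qed

lemma set_size_le_imp:
  assumes "set_size A \<le> enat M"
  shows "finite A" "card A \<le> M"
  using assms by (auto simp: set_size_def split: if_splits)

lemma nbhd_iter_mono: "m \<le> n \<Longrightarrow> nbhd_iter m \<subseteq> nbhd_iter n"
  by (rule lift_Suc_mono_le[of nbhd_iter]) (auto simp: closed_nbhd_def)

text \<open>There are countably many finite sets, so one null set serves them all. A cluster of at
  most \<open>M\<close> sites is a nonempty isolated subset of the ball of radius \<open>M\<close>;
  these subsets are finite in number, so from some time on all of them are excluded.\<close>

lemma (in ising_trajectory) AE_cluster_diverges:
  "AE \<omega> in ising_law. ((\<lambda>t. set_size (cluster (\<sigma> \<omega> t) 0)) \<longlongrightarrow> \<infinity>) at_top"
proof -
  have "AE \<omega> in ising_law. \<forall>C\<in>{C. finite C} - {{}}. \<forall>\<^sub>F t in at_top. \<not> isolated (\<sigma> \<omega> t) C"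
    using AE_eventually_not_isolated countable_Collect_finite
    by (subst AE_ball_countable) (auto intro: countable_Diff)
  then show ?thesis
  proof eventually_elim
    case (elim \<omega>)
    have "\<forall>\<^sub>F t in at_top. enat M < set_size (cluster (\<sigma> \<omega> t) 0)" for M
    proof -
      have "\<forall>\<^sub>F t in at_top. \<forall>C\<in>Pow (nbhd_iter M) - {{}}. \<not> isolated (\<sigma> \<omega> t) C"
        using elim finite_nbhd_iter[of M] by (intro eventually_ball_finite) (auto intro: finite_subset)
      then show ?thesis
      proof eventually_elim
        case (elim t)
        let ?C = "cluster (\<sigma> \<omega> t) 0"
        note cl = cluster_greatest(1,2)[where s = "\<sigma> \<omega> t" and x = 0]
        show ?case
        proof (rule ccontr)
          assume "\<not> enat M < set_size ?C"
          then have fin: "finite ?C" and card: "card ?C \<le> M"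
            using set_size_le_imp[of ?C M] by (auto simp: not_less)
          have "?C \<subseteq> nbhd_iter M"
            using connected_subset_nbhd_iter[OF cl(2,1) fin] nbhd_iter_mono[OF card] by blast
          then show False using elim isolated_cluster[of "\<sigma> \<omega> t" 0] cl(1) by blast
        qed
      qed
    qed
    then show ?case
      by (intro order_tendstoI) (auto elim!: less_infinityE)
  qed
qed

theorem proposition3p1:
  fixes \<sigma> :: "('n::finite) config \<times> ('n site \<Rightarrow> clock) \<Rightarrow> real \<Rightarrow> 'n config"
  assumes "\<And>t x. t \<ge> 0 \<Longrightarrow> (\<lambda>\<omega>. \<sigma> \<omega> t x) \<in> measurable ising_law (count_space UNIV)"
    and "AE (s0, w) in ising_law. ising_path s0 w (\<sigma> (s0, w))"
  shows "AE \<omega> in ising_law. ((\<lambda>t. set_size (cluster (\<sigma> \<omega> t) 0)) \<longlongrightarrow> \<infinity>) at_top"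
proof -
  interpret ising_trajectory \<sigma>
    using assms by (rule ising_trajectory.intro)
  show ?thesis by (rule AE_cluster_diverges)
qed

end
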